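(* Let $m\ge 2$ be an integer and $\rho>-m$ a real number, and set $\nu=\frac{(m-1)(m+\rho)}{m(m+\rho+1)}\in(0,1)$. Let $X^{(n)}$ be the number of descendants of vertex $n$ in the preferential attachment graph $G_n$ with parameters $m$ and $\rho$. Then, for every real $p>0$, as $n\to\infty$, $$\frac{\mathbb E[(X^{(n)})^p]}{n^{p\nu}}\to\left(\frac{\Gamma\left(\frac{(m-1)(m+\rho)}{m(m+\rho+1)}\right)\Gamma\left(\frac{m+\rho}{m(m+\rho+1)}+1\right)}{\Gamma\left(\frac{m+\rho}{m+\rho+1}\right)}\left(\frac{(m+\rho+1)(m-1)}{2m+\rho}\right)^{1-\nu}\right)^p\cdot\frac{\Gamma\left(p(1-\nu)+\frac{m}{m-1}\right)}{\Gamma\left(\frac{m}{m-1}\right)}.$$ In other words, with $\xi_1$ having the $\mathrm{Gamma}(m/(m-1),1)$ distribution, all moments of $n^{-\nu}X^{(n)}$ converge to the corresponding moments of $$\frac{\Gamma\left(\frac{(m-1)(m+\rho)}{m(m+\rho+1)}\right)\Gamma\left(\frac{m+\rho}{m(m+\rho+1)}+1\right)}{\Gamma\left(\frac{m+\rho}{m+\rho+1}\right)}\left(\frac{(m+\rho+1)(m-1)}{2m+\rho}\,\xi_1\right)^{1-\nu}.$$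
   Context: Preferential attachment graph: fix an integer $m\ge2$ and a real $\rho>-m$. The random directed multigraphs $(G_n)_{n\ge1}$, where $G_n$ has vertex set $[n]=\{1,\dots,n\}$, are generated as follows. $G_1$ is a single vertex 1 with no edges. $G_2$ is obtained by adding vertex 2 and $m$ edges from vertex 2 to vertex 1. For $n\ge3$, given $G_{n-1}$, add vertex $n$ and sequentially add $m$ outgoing edges from $n$ to vertices in $[n-1]$: writing $d_j(n-1)$ for the (total) degree of vertex $j$ in $G_{n-1}$, and $n\overset{\ell}{\to}j$ for the event that the $\ell$-th outgoing edge of $n$ is attached to $j$, given the first $k$ outgoing edges of $n$ ($0\le k\le m-1$), the $(k+1)$-th outgoing edge of $n$ is attached to $j\in[n-1]$ with probability $$\frac{d_j(n-1)+\sum_{\ell=1}^k\mathbf 1[n\overset{\ell}{\to}j]+\rho}{2m(n-2)+k+(n-1)\rho}.$$ All edges are directed from the vertex with larger label to the vertex with smaller label; multiple edges are allowed. The number of descendants $X^{(n)}$ of $n$ is the number of vertices of $G_n$ that can be reached from vertex $n$ by a directed path, including vertex $n$ itself. $\mathrm{Gamma}(a,b)$ is the distribution with density $\Gamma(a)^{-1}b^{-a}x^{a-1}e^{-x/b}$ on $(0,\infty)$. *)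

theory Defs
  imports "HOL-Probability.Probability" "Graph_Theory.Digraph"
begin

section \<open>The preferential attachment graph\<close>

text \<open>
  The directed multigraph \<open>G\<^sub>n\<close> has vertices \<open>1, \<dots>, n\<close>, and its arcs are the names \<open>(i, l)\<close>, where
  \<open>(i, l)\<close> is the \<open>l\<close>-th outgoing edge of vertex \<open>i\<close> (\<open>l\<close> counts from 1).
\<close>

type_synonym multigraph = "(nat, nat \<times> nat) pre_digraph"

definition total_degree :: "multigraph \<Rightarrow> nat \<Rightarrow> nat" where
  "total_degree G v = in_degree G v + out_degree G v"

definition single_vertex :: multigraph where
  "single_vertex = \<lparr>verts = {1}, arcs = {}, tail = fst, head = (\<lambda>_. 0)\<rparr>"

definition add_vertex :: "nat \<Rightarrow> nat list \<Rightarrow> multigraph \<Rightarrow> multigraph" where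
  "add_vertex n js G =
     \<lparr>verts = insert n (verts G),
      arcs = arcs G \<union> {n} \<times> {1..length js},
      tail = fst,
      head = (\<lambda>a. if a \<in> {n} \<times> {1..length js} then js ! (snd a - 1) else head G a)\<rparr>"

text \<open>
  Below, \<open>G\<close> is \<open>G\<^bsub>n-1\<^esub>\<close> and \<open>js\<close> lists the endpoints of the outgoing edges of \<open>n\<close> that have already
  been added, so \<open>length js\<close> and \<open>count_list js j\<close> are \<open>k\<close> and
  \<open>\<Sum>\<^bsub>l=1..k\<^esub> 1[n \<rightarrow>\<^sup>l j]\<close>.
\<close>

definition attach_prob :: "nat \<Rightarrow> real \<Rightarrow> nat \<Rightarrow> multigraph \<Rightarrow> nat list \<Rightarrow> nat \<Rightarrow> real" where
  "attach_prob m \<rho> n G js j =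
     (if j \<in> {1..<n} then
        (real (total_degree G j) + real (count_list js j) + \<rho>) /
        (2 * real m * (real n - 2) + real (length js) + (real n - 1) * \<rho>)
      else 0)"

text \<open>
  Theorem \<open>pmf_attach_pmf\<close> below shows that \<open>embed_pmf\<close> is only ever applied to
  probability mass functions in the construction of \<open>pa_graph\<close>.
\<close>

definition attach_pmf :: "nat \<Rightarrow> real \<Rightarrow> nat \<Rightarrow> multigraph \<Rightarrow> nat list \<Rightarrow> nat pmf" where
  "attach_pmf m \<rho> n G js = embed_pmf (attach_prob m \<rho> n G js)"

primrec targets_pmf :: "nat \<Rightarrow> real \<Rightarrow> nat \<Rightarrow> multigraph \<Rightarrow> nat \<Rightarrow> nat list pmf" where
  "targets_pmf m \<rho> n G 0 = return_pmf []"
| "targets_pmf m \<rho> n G (Suc k) =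
     bind_pmf (targets_pmf m \<rho> n G k)
       (\<lambda>js. map_pmf (\<lambda>j. js @ [j]) (attach_pmf m \<rho> n G js))"

text \<open>
  \<open>pa_graph m \<rho> n\<close> is the law of \<open>G\<^sub>n\<close>. The index \<open>n = 0\<close> is not part of the model; \<open>G\<^sub>0\<close> is
  set to \<open>G\<^sub>1\<close>.
\<close>

fun pa_graph :: "nat \<Rightarrow> real \<Rightarrow> nat \<Rightarrow> multigraph pmf" where
  "pa_graph m \<rho> n =
     (if n \<le> 1 then return_pmf single_vertex
      else if n = 2 then return_pmf (add_vertex 2 (replicate m 1) single_vertex)
      else bind_pmf (pa_graph m \<rho> (n - 1))
             (\<lambda>G. map_pmf (\<lambda>js. add_vertex n js G) (targets_pmf m \<rho> n G m)))"

declare pa_graph.simps [simp del]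

definition num_descendants :: "multigraph \<Rightarrow> nat \<Rightarrow> nat" where
  "num_descendants G v = card {w. v \<rightarrow>\<^sup>*\<^bsub>G\<^esub> w}"


section \<open>The Gamma distribution with shape \<open>a\<close> and scale \<open>b\<close>\<close>

definition gamma_density :: "real \<Rightarrow> real \<Rightarrow> real \<Rightarrow> real" where
  "gamma_density a b x =
     (if x > 0 then x powr (a - 1) * exp (- x / b) / (Gamma a * b powr a) else 0)"


section \<open>The attachment probabilities are well defined\<close>

definition pa_shape :: "nat \<Rightarrow> nat \<Rightarrow> multigraph \<Rightarrow> bool" where
  "pa_shape m n G \<longleftrightarrow>
     verts G = {1..n} \<and> arcs G = {2..n} \<times> {1..m} \<and> tail G = fst \<and>
     (\<forall>a\<in>arcs G. head G a \<in> {1..<fst a})"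

lemma pa_shape_single_vertex: "pa_shape m 1 single_vertex"
  by (simp add: pa_shape_def single_vertex_def)

lemma pa_shape_add_vertex:
  assumes "pa_shape m (n - 1) G" "n \<ge> 2" "length js = m" "set js \<subseteq> {1..<n}"
  shows "pa_shape m n (add_vertex n js G)"
proof -
  have "js ! (l - 1) \<in> {1..<n}" if "l \<in> {1..m}" for l
  proof -
    have "js ! (l - 1) \<in> set js" using that assms(3) by (intro nth_mem) auto
    then show ?thesis using assms(4) by blast
  qed
  then show ?thesis using assms unfolding pa_shape_def add_vertex_def
    by fastforce
qed

lemma sum_degree:
  assumes "pa_shape m n G"
  shows "(\<Sum>j\<in>{1..n}. total_degree G j) = 2 * m * (n - 1)"
proof -
  have fin: "finite (arcs G)" and c: "card (arcs G) = m * (n - 1)"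
    using assms by (auto simp: pa_shape_def)
  have img: "head G ` arcs G \<subseteq> {1..n}" "tail G ` arcs G \<subseteq> {1..n}"
  proof -
    have "head G a \<in> {1..n} \<and> tail G a \<in> {1..n}" if "a \<in> arcs G" for a
    proof -
      have "head G a \<in> {1..<fst a}" "fst a \<in> {2..n}" "tail G a = fst a"
        using assms that by (auto simp: pa_shape_def)
      then show ?thesis by auto
    qed
    then show "head G ` arcs G \<subseteq> {1..n}" "tail G ` arcs G \<subseteq> {1..n}" by blast+
  qed
  have "(\<Sum>j\<in>{1..n}. card {e \<in> arcs G. head G e = j}) = card (arcs G)"
    using sum.group[OF fin _ img(1), of "\<lambda>_. 1::nat"] by simp
  moreover have "(\<Sum>j\<in>{1..n}. card {e \<in> arcs G. tail G e = j}) = card (arcs G)"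
    using sum.group[OF fin _ img(2), of "\<lambda>_. 1::nat"] by simp
  ultimately show ?thesis using c
    by (simp add: total_degree_def in_degree_def out_degree_def in_arcs_def out_arcs_def sum.distrib)
qed

lemma degree_ge:
  assumes "pa_shape m n G" "n \<ge> 2" "j \<in> {1..n}"
  shows "total_degree G j \<ge> m"
proof -
  have fin: "finite (arcs G)" using assms by (auto simp: pa_shape_def)
  show ?thesis
  proof (cases "j = 1")
    case True
    have "{2} \<times> {1..m} \<subseteq> in_arcs G j"
    proof
      fix a assume "a \<in> {2::nat} \<times> {1..m}"
      then have "a \<in> arcs G" "fst a = 2" using assms by (auto simp: pa_shape_def)
      moreover from this have "head G a \<in> {1..<2}" using assms by (metis pa_shape_def)
      ultimately show "a \<in> in_arcs G j" using True by (auto simp: in_arcs_def)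
    qed
    then have "card ({2::nat} \<times> {1..m}) \<le> in_degree G j"
      unfolding in_degree_def using fin by (intro card_mono) (auto simp: in_arcs_def)
    then show ?thesis by (simp add: total_degree_def)
  next
    case False
    then have "{j} \<times> {1..m} \<subseteq> out_arcs G j"
      using assms by (auto simp: pa_shape_def out_arcs_def)
    then have "card ({j} \<times> {1..m}) \<le> out_degree G j"
      unfolding out_degree_def using fin by (intro card_mono) (auto simp: out_arcs_def)
    then show ?thesis by (simp add: total_degree_def)
  qed
qed

lemma pmf_attach_pmf_aux:
  assumes "\<rho> > - real m" "n \<ge> 3" "pa_shape m (n - 1) G" "set js \<subseteq> {1..<n}"
  shows "pmf (attach_pmf m \<rho> n G js) = attach_prob m \<rho> n G js"
proof -
  let ?w = "\<lambda>j. real (total_degree G j) + real (count_list js j) + \<rho>"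
  let ?D = "2 * real m * (real n - 2) + real (length js) + (real n - 1) * \<rho>"
  have eq: "{1..<n} = {1..n - 1}" using assms(2) by auto
  have "(\<Sum>j\<in>{1..<n}. real (total_degree G j)) = 2 * real m * (real n - 2)"
    using arg_cong[OF sum_degree[OF assms(3)], of real] assms(2) unfolding eq
    by (simp add: of_nat_diff)
  moreover have "(\<Sum>j\<in>{1..<n}. real (count_list js j)) = real (length js)"
    using arg_cong[OF sum_count_set[OF assms(4)], of real] by simp
  ultimately have D: "(\<Sum>j\<in>{1..<n}. ?w j) = ?D"
    using assms(2) by (simp add: sum.distrib of_nat_diff)
  have pos: "?w j > 0" if "j \<in> {1..<n}" for j
  proof -
    have "real m \<le> real (total_degree G j)"
      using degree_ge[OF assms(3), of j] that assms(2) eq by auto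
    then show ?thesis using assms(1) by linarith
  qed
  have Dpos: "?D > 0"
    unfolding D[symmetric] using pos assms(2) by (intro sum_pos) auto
  have nonneg: "attach_prob m \<rho> n G js j \<ge> 0" for j
    unfolding attach_prob_def using less_imp_le[OF pos[of j]] Dpos
    by (auto intro!: divide_nonneg_pos)
  have "(\<Sum>j\<in>{1..<n}. attach_prob m \<rho> n G js j) = (\<Sum>j\<in>{1..<n}. ?w j) / ?D"
    unfolding sum_divide_distrib by (intro sum.cong) (auto simp: attach_prob_def)
  also have "\<dots> = 1" using D Dpos by simp
  finally have one: "(\<Sum>j\<in>{1..<n}. attach_prob m \<rho> n G js j) = 1" .
  have "(\<integral>\<^sup>+ j. ennreal (attach_prob m \<rho> n G js j) \<partial>count_space UNIV) =
        (\<Sum>j\<in>{1..<n}. ennreal (attach_prob m \<rho> n G js j))"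
    by (intro nn_integral_count_space') (auto simp: attach_prob_def)
  also have "\<dots> = 1" using one nonneg by (simp add: sum_ennreal)
  finally show ?thesis
    unfolding attach_pmf_def by (intro ext pmf_embed_pmf nonneg)
qed

lemma targets_pmf_support:
  assumes "\<rho> > - real m" "n \<ge> 3" "pa_shape m (n - 1) G" "js \<in> set_pmf (targets_pmf m \<rho> n G k)"
  shows "length js = k \<and> set js \<subseteq> {1..<n}"
  using assms(4)
proof (induction k arbitrary: js)
  case (Suc k)
  then obtain is' j where *: "is' \<in> set_pmf (targets_pmf m \<rho> n G k)" "js = is' @ [j]"
    "j \<in> set_pmf (attach_pmf m \<rho> n G is')"
    by auto
  have "attach_prob m \<rho> n G is' j \<noteq> 0"
    using *(3) pmf_attach_pmf_aux[OF assms(1-3)] Suc.IH[OF *(1)] by (metis set_pmf_iff)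
  then have "j \<in> {1..<n}" by (auto simp: attach_prob_def split: if_splits)
  then show ?case using *(2) Suc.IH[OF *(1)] by auto
qed auto

lemma pa_graph_support:
  assumes "\<rho> > - real m" "n \<ge> 1" "G \<in> set_pmf (pa_graph m \<rho> n)"
  shows "pa_shape m n G"
  using assms(2,3)
proof (induction n arbitrary: G rule: less_induct)
  case (less n)
  consider "n = 1" | "n = 2" | "n \<ge> 3" using less.prems(1) by linarith
  then show ?case
  proof cases
    case 1
    have "set_pmf (pa_graph m \<rho> 1) = {single_vertex}" by (subst pa_graph.simps) simp
    then show ?thesis using less.prems 1 pa_shape_single_vertex by auto
  next
    case 2
    have "pa_shape m 2 (add_vertex 2 (replicate m 1) single_vertex)"
      using pa_shape_single_vertex by (intro pa_shape_add_vertex) auto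
    moreover have "set_pmf (pa_graph m \<rho> 2) = {add_vertex 2 (replicate m 1) single_vertex}"
      by (subst pa_graph.simps) simp
    ultimately show ?thesis using less.prems 2 by auto
  next
    case 3
    with less.prems obtain H js where *: "H \<in> set_pmf (pa_graph m \<rho> (n - 1))"
      "js \<in> set_pmf (targets_pmf m \<rho> n H m)" "G = add_vertex n js H"
      by (auto simp: pa_graph.simps[of _ _ n])
    have H: "pa_shape m (n - 1) H" using less.IH[of "n - 1" H] * 3 by auto
    then show ?thesis
      using targets_pmf_support[OF assms(1) 3 H *(2)] pa_shape_add_vertex[OF H] * 3 by auto
  qed
qed

theorem pmf_attach_pmf:
  assumes "\<rho> > - real m" "n \<ge> 3"
    and "G \<in> set_pmf (pa_graph m \<rho> (n - 1))" "js \<in> set_pmf (targets_pmf m \<rho> n G k)"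
  shows "pmf (attach_pmf m \<rho> n G js) j = attach_prob m \<rho> n G js j"
proof -
  have "pa_shape m (n - 1) G" using pa_graph_support[OF assms(1) _ assms(3)] assms(2) by simp
  then show ?thesis
    using pmf_attach_pmf_aux targets_pmf_support assms by metis
qed

end

theory Submission
  imports Defs "HOL-Real_Asymp.Real_Asymp"
begin

text \<open>
  Why the theorem is true. Attaching further edges to \<open>G\<^sub>k\<close> by the preferential rule is drawing from a Polya
  urn whose colours are the vertices of \<open>G\<^sub>k\<close>. Reveal the vertices in decreasing order, starting from
  \<open>n\<close>, and record the number \<open>N\<close> of descendants found so far together with the number \<open>Y\<close> of edges
  that lead from them to vertices not yet revealed. Since the draws of an urn are exchangeable, these \<open>Y\<close> edges
  are \<open>Y\<close> draws from the urn of \<open>G\<^sub>k\<close>, whatever has been revealed. The number of them that hit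
  vertex \<open>k\<close> is a two-colour Polya count; the others, together with the \<open>m\<close> edges of \<open>k\<close> if
  \<open>k\<close> was hit, are draws from the urn of \<open>G\<^bsub>k-1\<^esub>\<close>. Hence \<open>(Y, N)\<close> is a Markov
  chain, and the number of descendants is read off from its last state (lemma \<open>num_descendants_law\<close>).

  Write \<open>a = m + \<rho>\<close>, \<open>\<theta> = a + m\<close>, \<open>\<chi> = (m - 1) a / \<theta>\<close> and
  \<open>r = 1 + \<chi>\<close>, so that \<open>\<nu> = \<chi> / r\<close> and \<open>1 - \<nu> = 1 / r\<close>. The chain has two regimes.

  As long as \<open>Y\<close> is small compared with \<open>k\<close>, it is a branching process: each of the \<open>Y\<close> edges is
  replaced by \<open>m\<close> edges at rate \<open>a / (\<theta> k)\<close>. For every real \<open>s > 0\<close> the function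
  \<open>y \<mapsto> \<Gamma>(y / (m - 1) + s) / \<Gamma>(y / (m - 1))\<close> is an eigenfunction of such a process, and it
  behaves like \<open>(y / (m - 1))\<^sup>s\<close> for large \<open>y\<close>. Started at \<open>y = m\<close> it produces, for all real
  \<open>s\<close> at once, the moments of \<open>\<xi>\<^sub>1\<close>: at a time \<open>K\<close> in the branching regime,
  \<open>(K / n)\<^sup>\<chi> Y\<close> has asymptotically the moments of \<open>(m - 1) \<xi>\<^sub>1\<close>
  (lemma \<open>branching_limit\<close>).

  Once \<open>Y\<close> is large, it follows a deterministic flow. With \<open>u = Y / (\<theta> k)\<close> the quantity
  \<open>k\<^sup>r ((1 + u)\<^bsup>a+1\<^esup> - 1)\<close> is preserved by the flow; let \<open>A\<close> be its value. The flow
  expands distances by at most \<open>1 + \<chi> / k\<close> per step, so that mean square errors stay under control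
  (lemmas \<open>fluid_tracking\<close> and \<open>hits_tracking\<close>). Vertex \<open>k\<close> is hit with probability about
  \<open>1 - (1 + A k\<^bsup>-r\<^esup>)\<^bsup>-a/(a+1)\<^esup>\<close>, and the sum of these probabilities is a Riemann sum with
  value \<open>C A\<^bsup>1/r\<^esup>\<close>, where \<open>C\<close> comes from a Beta integral (lemma
  \<open>sum_hit_fun_riemann\<close>). Given the state at time \<open>K\<close>, the number of descendants is therefore close to
  \<open>C A\<^bsup>1/r\<^esup>\<close>, and \<open>A\<close> is asymptotically the multiple \<open>(a + 1) K\<^sup>\<chi> / \<theta>\<close> of
  the value of \<open>Y\<close> at time \<open>K\<close> (lemma \<open>descendants_given_state\<close>).

  With \<open>K\<close> a power of \<open>n\<close> between \<open>n\<^sup>\<nu>\<close> and \<open>n\<close> both regimes apply and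
  \<open>n\<^bsup>-\<nu>\<^esup> X\<close> is close in mean to a constant times \<open>((K / n)\<^sup>\<chi> Y)\<^bsup>1-\<nu>\<^esup>\<close>
  (lemma \<open>descendants_L1\<close>). All moments of both quantities are bounded (lemmas \<open>moment_bound\<close> and
  \<open>descendants_moment_bound\<close>), so the limits of the moments agree.
\<close>


section \<open>Expectations and mean square norms under finitely supported distributions\<close>

abbreviation E :: "'a pmf \<Rightarrow> ('a \<Rightarrow> real) \<Rightarrow> real" where
  "E p f \<equiv> measure_pmf.expectation p f"

lemma E_mono:
  assumes "finite (set_pmf p)" "\<And>x. x \<in> set_pmf p \<Longrightarrow> f x \<le> g x"
  shows "E p f \<le> E p g"
  using assms by (intro integral_mono_AE integrable_measure_pmf_finite) (auto simp: AE_measure_pmf_iff)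

lemma E_cong:
  assumes "\<And>x. x \<in> set_pmf p \<Longrightarrow> f x = g x"
  shows "E p f = E p g"
  using assms by (intro integral_cong_AE) (auto simp: AE_measure_pmf_iff)

lemma E_add: "finite (set_pmf p) \<Longrightarrow> E p (\<lambda>x. f x + g x) = E p f + E p g"
  by (intro Bochner_Integration.integral_add integrable_measure_pmf_finite)

lemma E_diff: "finite (set_pmf p) \<Longrightarrow> E p (\<lambda>x. f x - g x) = E p f - E p g"
  by (intro Bochner_Integration.integral_diff integrable_measure_pmf_finite)

lemma E_nonneg: "(\<And>x. x \<in> set_pmf p \<Longrightarrow> 0 \<le> f x) \<Longrightarrow> 0 \<le> E p f"
  by (intro integral_nonneg_AE) (auto simp: AE_measure_pmf_iff)

lemma E_bind:
  assumes "finite (set_pmf p)" "\<And>x. x \<in> set_pmf p \<Longrightarrow> finite (set_pmf (f x))"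
  shows "E (bind_pmf p f) h = E p (\<lambda>x. E (f x) h)"
  using pmf_expectation_bind[OF assms(1), of f p h] assms
  by (simp add: integral_measure_pmf[OF assms(1)])

lemma E_abs_le: "finite (set_pmf p) \<Longrightarrow> \<bar>E p f\<bar> \<le> E p (\<lambda>x. \<bar>f x\<bar>)"
  using integral_norm_bound[of p f] by simp

text \<open>
  The norm of \<open>L\<^sup>2(p)\<close>. For a finitely supported \<open>p\<close> it is a weighted instance of \<open>L2_set\<close>, which
  provides Minkowski's inequality.
\<close>

definition norm2 :: "'a pmf \<Rightarrow> ('a \<Rightarrow> real) \<Rightarrow> real" where
  "norm2 p f = sqrt (E p (\<lambda>x. (f x)\<^sup>2))"

lemma norm2_nonneg: "0 \<le> norm2 p f" by (simp add: norm2_def)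

lemma norm2_power2: "(norm2 p f)\<^sup>2 = E p (\<lambda>x. (f x)\<^sup>2)"
  by (simp add: norm2_def E_nonneg)

lemma norm2_eq_L2_set:
  assumes "finite (set_pmf p)"
  shows "norm2 p f = L2_set (\<lambda>x. sqrt (pmf p x) * f x) (set_pmf p)"
  unfolding norm2_def L2_set_def integral_measure_pmf[OF assms, of p "\<lambda>x. (f x)\<^sup>2", simplified]
  by (simp add: power_mult_distrib)

lemma norm2_triangle:
  assumes "finite (set_pmf p)"
  shows "norm2 p (\<lambda>x. f x + g x) \<le> norm2 p f + norm2 p g"
  unfolding norm2_eq_L2_set[OF assms]
  using L2_set_triangle_ineq[of "\<lambda>x. sqrt (pmf p x) * f x" "\<lambda>x. sqrt (pmf p x) * g x" "set_pmf p"]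
  by (simp add: distrib_left)

lemma norm2_cmult: "norm2 p (\<lambda>x. c * f x) = \<bar>c\<bar> * norm2 p f"
  by (simp add: norm2_def power_mult_distrib real_sqrt_mult)

lemma norm2_const: "norm2 p (\<lambda>x. c) = \<bar>c\<bar>" by (simp add: norm2_def)

lemma norm2_abs: "norm2 p (\<lambda>x. \<bar>f x\<bar>) = norm2 p f" by (simp add: norm2_def)

lemma E_abs_le_norm2:
  assumes "finite (set_pmf p)"
  shows "E p (\<lambda>x. \<bar>f x\<bar>) \<le> norm2 p f"
proof -
  let ?e = "E p (\<lambda>x. \<bar>f x\<bar>)"
  have "0 \<le> E p (\<lambda>x. (\<bar>f x\<bar> - ?e)\<^sup>2)" by (intro E_nonneg) simp
  also have "E p (\<lambda>x. (\<bar>f x\<bar> - ?e)\<^sup>2) = E p (\<lambda>x. (f x)\<^sup>2 - 2 * ?e * \<bar>f x\<bar> + ?e\<^sup>2)"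
    by (simp add: power2_diff algebra_simps)
  also have "\<dots> = E p (\<lambda>x. (f x)\<^sup>2) - ?e\<^sup>2"
    using assms by (simp add: E_add E_diff power2_eq_square)
  finally have "?e\<^sup>2 \<le> (norm2 p f)\<^sup>2" by (simp add: norm2_power2)
  then show ?thesis using norm2_nonneg by (rule power2_le_imp_le)
qed

text \<open>
  The first summand is the bias and the second one bounds the variance, which is the least mean square deviation from
  any constant \<open>c\<close>.
\<close>

lemma E_square_deviation_le:
  assumes "finite (set_pmf q)"
  shows "E q (\<lambda>x. (h x - t)\<^sup>2) \<le> (E q h - t)\<^sup>2 + E q (\<lambda>x. (h x - c)\<^sup>2)"
proof -
  have exp: "E q (\<lambda>x. (h x - u)\<^sup>2) = E q (\<lambda>x. (h x)\<^sup>2) - 2 * u * E q h + u\<^sup>2" for u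
  proof -
    have "E q (\<lambda>x. (h x - u)\<^sup>2) = E q (\<lambda>x. (h x)\<^sup>2 - 2 * u * h x + u\<^sup>2)"
      by (simp add: power2_diff algebra_simps)
    then show ?thesis using assms by (simp add: E_add E_diff)
  qed
  have "0 \<le> (E q h - c)\<^sup>2" by simp
  then show ?thesis unfolding exp by (simp add: power2_eq_square algebra_simps)
qed

text \<open>
  The error made by one step of a Markov chain: the drift errors \<open>g\<close> are measured in norm, whereas the conditional
  variances \<open>v\<close> enter only under the square root. This is why independent fluctuations of many steps accumulate
  like a square root.
\<close>

lemma norm2_bind_le:
  assumes p: "finite (set_pmf p)" and q: "\<And>x. x \<in> set_pmf p \<Longrightarrow> finite (set_pmf (q x))"
    and v: "\<And>x. x \<in> set_pmf p \<Longrightarrow> E (q x) (\<lambda>y. (h y - c x)\<^sup>2) \<le> v x"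
    and g: "\<And>x. x \<in> set_pmf p \<Longrightarrow> \<bar>E (q x) h - t\<bar> \<le> g x"
  shows "norm2 (bind_pmf p q) (\<lambda>y. h y - t) \<le> sqrt ((norm2 p g)\<^sup>2 + E p v)"
proof -
  have "E (bind_pmf p q) (\<lambda>y. (h y - t)\<^sup>2) = E p (\<lambda>x. E (q x) (\<lambda>y. (h y - t)\<^sup>2))"
    by (rule E_bind[OF p q])
  also have "\<dots> \<le> E p (\<lambda>x. (g x)\<^sup>2 + v x)"
  proof (rule E_mono[OF p])
    fix x assume x: "x \<in> set_pmf p"
    have "(E (q x) h - t)\<^sup>2 \<le> (g x)\<^sup>2" using g[OF x] by (metis abs_le_square_iff abs_of_nonneg
        abs_ge_zero order_trans)
    then show "E (q x) (\<lambda>y. (h y - t)\<^sup>2) \<le> (g x)\<^sup>2 + v x"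
      using E_square_deviation_le[OF q[OF x], of h t "c x"] v[OF x] by linarith
  qed
  also have "\<dots> = (norm2 p g)\<^sup>2 + E p v" by (simp add: E_add[OF p] norm2_power2)
  finally show ?thesis unfolding norm2_def[of "bind_pmf p q"] by (rule real_sqrt_le_mono)
qed

text \<open>
  The recursion that \<open>norm2_bind_le\<close> produces along a chain running downwards from \<open>K\<close>, in solved form.
\<close>

lemma sqrt_recursion_bound:
  fixes x d v :: "nat \<Rightarrow> real"
  assumes "\<And>k. J < k \<Longrightarrow> k \<le> K \<Longrightarrow> x (k - 1) \<le> sqrt ((x k + d k)\<^sup>2 + v k)"
    and "\<And>k. J < k \<Longrightarrow> k \<le> K \<Longrightarrow> 0 \<le> d k" "\<And>k. J < k \<Longrightarrow> k \<le> K \<Longrightarrow> 0 \<le> v k"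
    and "\<And>k. 0 \<le> x k" "J \<le> j" "j \<le> K"
  shows "x j \<le> x K + (\<Sum>k\<in>{j<..K}. d k) + sqrt (\<Sum>k\<in>{j<..K}. v k)"
  using assms(6,5)
proof (induction j rule: inc_induct)
  case base
  then show ?case by simp
next
  case (step i)
  let ?k = "Suc i"
  have ik: "J < ?k" "?k \<le> K" using step.hyps step.prems by auto
  define D where "D = x K + (\<Sum>k\<in>{?k<..K}. d k)"
  define V where "V = (\<Sum>k\<in>{?k<..K}. v k)"
  have IH: "x ?k \<le> D + sqrt V" using step.IH ik by (simp add: D_def V_def)
  have V0: "V \<ge> 0" unfolding V_def using assms(3) ik by (intro sum_nonneg) auto
  have D0: "D \<ge> 0" unfolding D_def using assms(2,4) ik by (intro add_nonneg_nonneg sum_nonneg) auto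
  have dv: "d ?k \<ge> 0" "v ?k \<ge> 0" using assms(2,3) ik by auto
  have ins: "{i<..K} = insert ?k {?k<..K}" using ik by auto
  have "x i \<le> sqrt ((x ?k + d ?k)\<^sup>2 + v ?k)" using assms(1)[OF ik] by simp
  also have "\<dots> \<le> sqrt ((D + d ?k + sqrt V)\<^sup>2 + v ?k)"
    using IH assms(4)[of ?k] dv by (intro real_sqrt_le_mono add_right_mono power_mono) auto
  also have "\<dots> \<le> D + d ?k + sqrt (V + v ?k)"
  proof (rule real_le_lsqrt)
    show "0 \<le> D + d ?k + sqrt (V + v ?k)" using D0 V0 dv by simp
    have "(D + d ?k) * sqrt V \<le> (D + d ?k) * sqrt (V + v ?k)" using D0 dv by (intro mult_left_mono) auto
    moreover have "(D + d ?k + sqrt U)\<^sup>2 = (D + d ?k)\<^sup>2 + 2 * ((D + d ?k) * sqrt U) + U" if "U \<ge> 0" for U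
      using that by (simp add: power2_sum)
    ultimately show "(D + d ?k + sqrt V)\<^sup>2 + v ?k \<le> (D + d ?k + sqrt (V + v ?k))\<^sup>2"
      using V0 dv by simp
  qed
  also have "\<dots> = x K + (\<Sum>k\<in>{i<..K}. d k) + sqrt (\<Sum>k\<in>{i<..K}. v k)"
    unfolding ins by (simp add: D_def V_def add_ac)
  finally show ?case .
qed

section \<open>Two-colour Polya urns\<close>

text \<open>
  The number of red balls among \<open>y\<close> draws from a Polya urn in which the red balls have initial weight \<open>a\<close> out
  of a total weight \<open>w\<close>; that is, the beta-binomial distribution. The recursion on draws is the form in which it
  arises from the attachment rule.
\<close>

primrec polya_count :: "real \<Rightarrow> real \<Rightarrow> nat \<Rightarrow> nat pmf" where
  "polya_count a w 0 = return_pmf 0"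
| "polya_count a w (Suc y) =
     bind_pmf (polya_count a w y)
       (\<lambda>z. map_pmf (\<lambda>h. if h then Suc z else z) (bernoulli_pmf ((a + real z) / (w + real y))))"

lemma set_pmf_polya_count: "z \<in> set_pmf (polya_count a w y) \<Longrightarrow> z \<le> y"
  by (induction y arbitrary: z) (auto split: if_splits, (meson le_SucI Suc_le_mono)+)

lemma finite_polya_count: "finite (set_pmf (polya_count a w y))"
  by (rule finite_subset[of _ "{..y}"]) (auto dest: set_pmf_polya_count)

lemma E_polya_count_Suc:
  assumes "0 < a" "a \<le> w"
  shows "E (polya_count a w (Suc y)) f =
    E (polya_count a w y) (\<lambda>z. f z + (a + real z) / (w + real y) * (f (Suc z) - f z))"
proof -
  have "E (polya_count a w (Suc y)) f = E (polya_count a w y)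
     (\<lambda>z. E (map_pmf (\<lambda>h. if h then Suc z else z) (bernoulli_pmf ((a + real z) / (w + real y)))) f)"
    unfolding polya_count.simps by (intro E_bind finite_polya_count) simp
  also have "\<dots> = E (polya_count a w y) (\<lambda>z. f z + (a + real z) / (w + real y) * (f (Suc z) - f z))"
  proof (rule E_cong)
    fix z assume "z \<in> set_pmf (polya_count a w y)"
    then have "z \<le> y" by (rule set_pmf_polya_count)
    moreover define p where "p = (a + real z) / (w + real y)"
    ultimately have "0 \<le> p" "p \<le> 1" using assms by auto
    then show "E (map_pmf (\<lambda>h. if h then Suc z else z) (bernoulli_pmf ((a + real z) / (w + real y)))) f =
      f z + (a + real z) / (w + real y) * (f (Suc z) - f z)"
      unfolding p_def[symmetric] by (simp add: algebra_simps)
  qed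
  finally show ?thesis .
qed

text \<open>
  The proportion of red weight \<open>(a + Z\<^sub>y) / (w + y)\<close> is a martingale.
\<close>

lemma E_polya_count:
  assumes "0 < a" "a \<le> w"
  shows "E (polya_count a w y) real = a * real y / w"
proof (induction y)
  case (Suc y)
  have "E (polya_count a w (Suc y)) real = E (polya_count a w y) (\<lambda>z. real z + (a / (w + real y) + 1 /
      (w + real y) * real z))"
    unfolding E_polya_count_Suc[OF assms] by (simp add: add_divide_distrib)
  also have "\<dots> = a * real y / w + (a / (w + real y) + 1 / (w + real y) * (a * real y / w))"
    using finite_polya_count[of a w y] by (simp add: E_add Suc.IH)
  also have "\<dots> = a * real (Suc y) / w"
  proof -
    have "w \<noteq> 0" "w + real y \<noteq> 0" using assms by auto
    then show ?thesis by (simp add: divide_simps) (simp add: algebra_simps)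
  qed
  finally show ?case .
qed simp

lemma E_polya_count_fact2:
  assumes "0 < a" "a \<le> w"
  shows "E (polya_count a w y) (\<lambda>z. real z * (real z - 1)) = real y * (real y - 1) * a * (a + 1) / (w * (w + 1))"
proof (induction y)
  case (Suc y)
  let ?P = "polya_count a w y" and ?u = "w + real y"
  have "E (polya_count a w (Suc y)) (\<lambda>z. real z * (real z - 1)) =
     E ?P (\<lambda>z. (1 + 2 / ?u) * (real z * (real z - 1)) + 2 * (a + 1) / ?u * real z)"
    unfolding E_polya_count_Suc[OF assms] by (rule E_cong) (simp add: algebra_simps add_divide_distrib
        diff_divide_distrib)
  also have "\<dots> = (1 + 2 / ?u) * E ?P (\<lambda>z. real z * (real z - 1)) + 2 * (a + 1) / ?u * E ?P real"
    using finite_polya_count[of a w y] by (simp add: E_add)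
  also have "\<dots> = (1 + 2 / ?u) * (real y * (real y - 1) * a * (a + 1) / (w * (w + 1))) + 2 * (a + 1) / ?u
      * (a * real y / w)"
    unfolding Suc.IH E_polya_count[OF assms] ..
  also have "\<dots> = real (Suc y) * (real (Suc y) - 1) * a * (a + 1) / (w * (w + 1))"
  proof -
    have "w \<noteq> 0" "w + 1 \<noteq> 0" "?u \<noteq> 0" using assms by auto
    then show ?thesis by (simp add: divide_simps) (simp add: algebra_simps)
  qed
  finally show ?case .
qed simp

lemma E_polya_count_miss:
  assumes "0 < a" "a \<le> w"
  shows "E (polya_count a w y) (\<lambda>z. if z = 0 then 1 else 0) = (\<Prod>i<y. 1 - a / (w + real i))"
proof (induction y)
  case (Suc y)
  have "E (polya_count a w (Suc y)) (\<lambda>z. if z = 0 then 1 else 0) =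
     E (polya_count a w y) (\<lambda>z. (1 - a / (w + real y)) * (if z = 0 then 1 else 0))"
    unfolding E_polya_count_Suc[OF assms] by (rule E_cong) simp
  then show ?case by (simp add: Suc.IH)
qed simp

section \<open>The number of descendants as a functional of a Markov chain\<close>

definition reach :: "multigraph \<Rightarrow> nat set \<Rightarrow> nat set" where
  "reach G S = {w. \<exists>v\<in>S. v \<rightarrow>\<^sup>*\<^bsub>G\<^esub> w}"

locale pa_model =
  fixes m :: nat and \<rho> :: real
  assumes m_ge_2: "m \<ge> 2" and rho_gt: "\<rho> > - real m"
begin

text \<open>
  The weight \<open>m + \<rho>\<close> with which every vertex enters the urn.
\<close>

definition a :: real where "a = real m + \<rho>"

lemma a_pos: "a > 0" using rho_gt by (simp add: a_def)

text \<open>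
  The total weight of the urn of \<open>G\<^sub>k\<close>: the sum of \<open>d\<^sub>j(k) + \<rho>\<close> over all vertices \<open>j\<close>.
\<close>

definition weight :: "nat \<Rightarrow> real" where
  "weight k = 2 * real m * (real k - 1) + real k * \<rho>"

text \<open>
  Revealing vertex \<open>k\<close>. In the state \<open>(y, N)\<close> there are \<open>y\<close> edges from the descendants found so far to
  vertices in \<open>{1..k}\<close>, and \<open>N\<close> descendants have been found. If \<open>z > 0\<close> of the edges end in \<open>k\<close>,
  these are replaced by the \<open>m\<close> edges that leave \<open>k\<close>.
\<close>

definition step :: "nat \<Rightarrow> nat \<times> nat \<Rightarrow> (nat \<times> nat) pmf" where
  "step k s = map_pmf (\<lambda>z. if z = 0 then s else (fst s - z + m, Suc (snd s)))
                (polya_count a (weight k) (fst s))"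

text \<open>
  \<open>descend j k\<close> reveals the vertices \<open>k, k - 1, \<dots>, j + 1\<close> in this order.
\<close>

primrec descend :: "nat \<Rightarrow> nat \<Rightarrow> nat \<times> nat \<Rightarrow> (nat \<times> nat) pmf" where
  "descend j 0 s = return_pmf s"
| "descend j (Suc k) s = (if Suc k \<le> j then return_pmf s else bind_pmf (step (Suc k) s) (descend j k))"

text \<open>
  The difference of the two sides is \<open>m (k - 2)\<close>. At \<open>k = 1\<close> the inequality fails and the weight can be
  negative, which is why the chain is only run down to \<open>k = 2\<close>: vertex \<open>1\<close> is hit with certainty.
\<close>

lemma weight_ge: "k \<ge> 2 \<Longrightarrow> weight k \<ge> a * real k"
proof -
  assume k: "k \<ge> 2"
  have "weight k - a * real k = real m * (real k - 2)"
    by (simp add: weight_def a_def algebra_simps)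
  moreover have "\<dots> \<ge> 0" using k by simp
  ultimately show ?thesis by linarith
qed

lemma weight_gt: "k \<ge> 2 \<Longrightarrow> weight k > a"
proof -
  assume k: "k \<ge> 2"
  have "a * real k \<ge> a * 2" using k a_pos by simp
  then show ?thesis using weight_ge[OF k] a_pos by linarith
qed

lemma total_degree_add_vertex_old:
  assumes "pa_shape m (k - 1) H" "k \<ge> 3" "length is = m" "j \<in> {1..<k}"
  shows "total_degree (add_vertex k is H) j = total_degree H j + count_list is j"
proof -
  let ?G = "add_vertex k is H"
  have arcs: "arcs H = {2..k - 1} \<times> {1..m}" and tail: "tail H = fst"
    using assms(1) by (auto simp: pa_shape_def)
  let ?new = "{k} \<times> {l \<in> {1..m}. is ! (l - 1) = j}"
  have "in_arcs ?G j = in_arcs H j \<union> ?new"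
  proof (rule set_eqI)
    fix e :: "nat \<times> nat"
    have "e \<in> arcs H \<Longrightarrow> e \<notin> {k} \<times> {1..m}" using arcs assms(2) by auto
    then show "e \<in> in_arcs ?G j \<longleftrightarrow> e \<in> in_arcs H j \<union> ?new"
      using assms(3) by (cases e) (simp add: in_arcs_def add_vertex_def, blast)
  qed
  moreover have "in_arcs H j \<inter> ?new = {}" using arcs assms(2) by (auto simp: in_arcs_def)
  moreover have "finite (in_arcs H j)" using arcs by (auto simp: in_arcs_def)
  ultimately have "in_degree ?G j = in_degree H j + card {l \<in> {1..m}. is ! (l - 1) = j}"
    unfolding in_degree_def by (simp add: card_Un_disjoint card_cartesian_product)
  moreover have "card {l \<in> {1..m}. is ! (l - 1) = j} = card {i. i < m \<and> is ! i = j}"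
  proof (rule bij_betw_same_card[of "\<lambda>l. l - 1"], rule bij_betw_byWitness[where f' = Suc])
    show "(\<lambda>l. l - 1) ` {l \<in> {1..m}. is ! (l - 1) = j} \<subseteq> {i. i < m \<and> is ! i = j}" by auto
    show "Suc ` {i. i < m \<and> is ! i = j} \<subseteq> {l \<in> {1..m}. is ! (l - 1) = j}" by auto
  qed simp_all
  moreover have "\<dots> = count_list is j"
    using assms(3) by (simp add: count_list_eq_length_filter length_filter_conv_card eq_commute)
  moreover have "out_arcs ?G j = out_arcs H j"
    using assms tail by (auto simp: out_arcs_def add_vertex_def)
  ultimately show ?thesis by (simp add: total_degree_def out_degree_def)
qed

lemma total_degree_newest:
  assumes "pa_shape m k G" "k \<ge> 2"
  shows "total_degree G k = m"
proof -
  note sh = assms(1)[unfolded pa_shape_def, THEN conjunct2]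
  note arcs = sh[THEN conjunct1] and tail = sh[THEN conjunct2, THEN conjunct1]
    and head = sh[THEN conjunct2, THEN conjunct2]
  have "head G e \<noteq> k" if e: "e \<in> arcs G" for e
  proof -
    have "head G e < fst e" using head e by simp
    moreover have "fst e \<le> k" using e by (simp add: arcs mem_Times_iff)
    ultimately show ?thesis by simp
  qed
  then have "in_arcs G k = {}" by (simp add: in_arcs_def)
  moreover have "out_arcs G k = {k} \<times> {1..m}"
    unfolding out_arcs_def arcs tail using assms(2) by (intro set_eqI) (simp add: mem_Times_iff, linarith)
  ultimately
  show ?thesis by (simp add: total_degree_def in_degree_def out_degree_def card_cartesian_product)
qed

text \<open>
  The newest vertex of \<open>G\<^sub>k\<close> has degree \<open>m\<close>, whatever the graph; so lumping all other vertices into one colour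
  gives a two-colour urn.
\<close>

lemma count_newest_distr:
  assumes "pa_shape m k G" "k \<ge> 2"
  shows "map_pmf (\<lambda>js. count_list js k) (targets_pmf m \<rho> (Suc k) G y) = polya_count a (weight k) y"
proof (induction y)
  case (Suc y)
  let ?T = "targets_pmf m \<rho> (Suc k) G y"
  have shape: "pa_shape m (Suc k - 1) G" using assms by simp
  have eq: "map_pmf (\<lambda>j. count_list (js @ [j]) k) (attach_pmf m \<rho> (Suc k) G js) =
        map_pmf (\<lambda>h. if h then Suc (count_list js k) else count_list js k)
          (bernoulli_pmf ((a + real (count_list js k)) / (weight k + real y)))"
    if js: "js \<in> set_pmf ?T" for js
  proof -
    have sup: "length js = y" "set js \<subseteq> {1..<Suc k}"
      using targets_pmf_support[OF rho_gt _ shape js] assms(2) by auto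
    let ?p = "(a + real (count_list js k)) / (weight k + real y)"
    have p1: "pmf (attach_pmf m \<rho> (Suc k) G js) k = ?p"
      using pmf_attach_pmf_aux[OF rho_gt _ shape sup(2)] assms sup(1) total_degree_newest[OF assms]
      by (simp add: attach_prob_def weight_def a_def algebra_simps)
    have "map_pmf (\<lambda>j. j = k) (attach_pmf m \<rho> (Suc k) G js) = bernoulli_pmf ?p"
    proof (rule pmf_eqI)
      fix b :: bool
      have pp: "0 \<le> ?p" "?p \<le> 1" using p1 pmf_nonneg pmf_le_1 by metis+
      have "pmf (map_pmf (\<lambda>j. j = k) (attach_pmf m \<rho> (Suc k) G js)) True = ?p"
      proof -
        have "(\<lambda>j. j = k) -` {True} = {k}" by auto
        then show ?thesis using p1 by (simp add: pmf_map measure_pmf_single)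
      qed
      moreover have "pmf (map_pmf (\<lambda>j. j = k) (attach_pmf m \<rho> (Suc k) G js)) False = 1 - ?p"
        using calculation pmf_False_conv_True by metis
      ultimately show "pmf (map_pmf (\<lambda>j. j = k) (attach_pmf m \<rho> (Suc k) G js)) b = pmf (bernoulli_pmf ?p) b"
        using pp by (cases b) simp_all
    qed
    then have "map_pmf (\<lambda>h. if h then Suc (count_list js k) else count_list js k) (bernoulli_pmf ?p) =
       map_pmf (\<lambda>h. if h then Suc (count_list js k) else count_list js k) (map_pmf (\<lambda>j. j = k)
           (attach_pmf m \<rho> (Suc k) G js))"
      by simp
    also have "\<dots> = map_pmf (\<lambda>j. count_list (js @ [j]) k) (attach_pmf m \<rho> (Suc k) G js)"
      by (auto simp: pmf.map_comp o_def intro!: map_pmf_cong)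
    finally show ?thesis by simp
  qed
  have "map_pmf (\<lambda>js. count_list js k) (targets_pmf m \<rho> (Suc k) G (Suc y)) =
     bind_pmf ?T (\<lambda>js. map_pmf (\<lambda>j. count_list (js @ [j]) k) (attach_pmf m \<rho> (Suc k) G js))"
    by (simp add: map_bind_pmf pmf.map_comp o_def)
  also have "\<dots> = bind_pmf ?T (\<lambda>js. map_pmf (\<lambda>h. if h then Suc (count_list js k) else count_list js k)
          (bernoulli_pmf ((a + real (count_list js k)) / (weight k + real y))))"
    by (intro bind_pmf_cong refl eq)
  also have "\<dots> = bind_pmf (map_pmf (\<lambda>js. count_list js k) ?T) (\<lambda>z. map_pmf (\<lambda>h. if h then Suc z else z)
          (bernoulli_pmf ((a + real z) / (weight k + real y))))"
    by (simp add: bind_map_pmf)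
  also have "\<dots> = polya_count a (weight k) (Suc y)" by (simp add: Suc.IH)
  finally show ?case .
qed simp

text \<open>
  One further draw from the urn of \<open>G\<^sub>k\<close> either gives \<open>k\<close> or is a draw from the urn of \<open>G\<^bsub>k-1\<^esub>\<close>
  in which the edges of \<open>k\<close> and the earlier draws different from \<open>k\<close> have already been counted: these are
  exactly the contributions to the degrees of the old vertices.
\<close>

lemma attach_split:
  assumes H: "pa_shape m (k - 1) H" and k: "k \<ge> 3"
    and "length is = m" "set is \<subseteq> {1..<k}" "set js \<subseteq> {1..<Suc k}"
  shows "attach_pmf m \<rho> (Suc k) (add_vertex k is H) js =
         bind_pmf (bernoulli_pmf ((a + real (count_list js k)) / (weight k + real (length js))))
           (\<lambda>h. if h then return_pmf k else attach_pmf m \<rho> k H (is @ filter (\<lambda>j. j \<noteq> k) js))"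
proof (rule pmf_eqI)
  fix j
  let ?G = "add_vertex k is H" and ?l = "is @ filter (\<lambda>j. j \<noteq> k) js"
  let ?z = "count_list js k" and ?y = "length js"
  let ?D = "weight k + real ?y" and ?D' = "2 * real m * (real k - 2) + real (length ?l) + (real k - 1) * \<rho>"
  have G: "pa_shape m k ?G" using pa_shape_add_vertex[OF H _ assms(3,4)] k by simp
  have len: "?z + length (filter (\<lambda>j. j \<noteq> k) js) = ?y"
    by (induction js) auto
  have D': "?D' = ?D - (a + real ?z)"
    using arg_cong[OF len, of real] assms(3) by (simp add: weight_def a_def algebra_simps)
  have "a * real k \<le> weight k" using weight_ge k by simp
  have zy: "real ?z \<le> real ?y" using len by linarith
  have D'pos: "?D' > 0" unfolding D' using weight_gt[of k] zy k by simp
  have Dpos: "?D > 0" and p: "0 \<le> (a + real ?z) / ?D" "(a + real ?z) / ?D \<le> 1"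
    using D'pos D' a_pos zy by (auto simp: divide_simps)
  have setl: "set ?l \<subseteq> {1..<k}" using assms(4,5) by auto
  have lhs: "pmf (attach_pmf m \<rho> (Suc k) ?G js) j = attach_prob m \<rho> (Suc k) ?G js j"
    using pmf_attach_pmf_aux[OF rho_gt _ _ assms(5), of ?G] G k by simp
  have att: "pmf (attach_pmf m \<rho> k H ?l) j = attach_prob m \<rho> k H ?l j"
    using pmf_attach_pmf_aux[OF rho_gt k H setl] by simp
  have rhs: "pmf (bind_pmf (bernoulli_pmf ((a + real ?z) / ?D))
           (\<lambda>h. if h then return_pmf k else attach_pmf m \<rho> k H ?l)) j =
        (if j = k then (a + real ?z) / ?D else 0) + attach_prob m \<rho> k H ?l j * (?D' / ?D)"
    using p Dpos unfolding D' by (simp add: pmf_bind att diff_divide_distrib indicator_def)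
  have den: "2 * real m * (real (Suc k) - 2) + real ?y + (real (Suc k) - 1) * \<rho> = ?D"
    by (simp add: weight_def algebra_simps)
  consider "j = k" | "j \<in> {1..<k}" | "j \<notin> {1..<Suc k}" by fastforce
  then show "pmf (attach_pmf m \<rho> (Suc k) ?G js) j = pmf (bind_pmf (bernoulli_pmf ((a + real ?z) / ?D))
           (\<lambda>h. if h then return_pmf k else attach_pmf m \<rho> k H ?l)) j"
  proof cases
    case 1
    then show ?thesis unfolding lhs rhs
      using total_degree_newest[OF G] k den by (simp add: attach_prob_def a_def add_ac)
  next
    case 2
    have c: "count_list (filter (\<lambda>j. j \<noteq> k) js) j = count_list js j"
      using 2 by (induction js) auto
    show ?thesis unfolding lhs rhs
      using 2 k D'pos Dpos total_degree_add_vertex_old[OF H k assms(3) 2] c den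
      by (simp add: attach_prob_def add_ac del: length_append)
  next
    case 3
    then show ?thesis unfolding lhs rhs using k by (auto simp: attach_prob_def)
  qed
qed

text \<open>
  The draws from the urn of \<open>G\<^sub>k\<close> that miss \<open>k\<close> continue the sequence of the \<open>m\<close> draws made by \<open>k\<close>
  itself, independently of how many draws hit \<open>k\<close>. This is the step that makes the exploration Markovian.
\<close>

lemma newest_and_older_draws:
  assumes H: "pa_shape m (k - 1) H" and k: "k \<ge> 3"
  shows "bind_pmf (targets_pmf m \<rho> k H m) (\<lambda>is.
           map_pmf (\<lambda>js. (count_list js k, is @ filter (\<lambda>j. j \<noteq> k) js))
             (targets_pmf m \<rho> (Suc k) (add_vertex k is H) y)) =
         bind_pmf (polya_count a (weight k) y) (\<lambda>z. map_pmf (Pair z) (targets_pmf m \<rho> k H (m + y - z)))"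
    (is "?L y = ?R y")
proof (induction y)
  case 0
  then show ?case by (simp add: bind_return_pmf map_pmf_def)
next
  case (Suc y)
  \<comment> \<open>the next draw, as a transition of the number \<open>z\<close> of hits and the list \<open>l\<close> of the other draws\<close>
  define next_draw where "next_draw = (\<lambda>(z::nat, l). bind_pmf (bernoulli_pmf ((a + real z) / (weight k + real y)))
      (\<lambda>h. if h then return_pmf (Suc z, l) else map_pmf (\<lambda>j. (z, l @ [j])) (attach_pmf m \<rho> k H l)))"
  have step: "map_pmf (\<lambda>j. (count_list (js @ [j]) k, is @ filter (\<lambda>j. j \<noteq> k) (js @ [j])))
        (attach_pmf m \<rho> (Suc k) (add_vertex k is H) js) = next_draw (count_list js k, is @ filter (\<lambda>j. j \<noteq> k) js)"
    if "is \<in> set_pmf (targets_pmf m \<rho> k H m)"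
       "js \<in> set_pmf (targets_pmf m \<rho> (Suc k) (add_vertex k is H) y)" for "is" js
  proof -
    have s1: "length is = m" "set is \<subseteq> {1..<k}"
      using targets_pmf_support[OF rho_gt k H that(1)] by auto
    have G: "pa_shape m (Suc k - 1) (add_vertex k is H)"
      using pa_shape_add_vertex[OF H _ s1] k by simp
    have s2: "length js = y" "set js \<subseteq> {1..<Suc k}"
      using targets_pmf_support[OF rho_gt _ G that(2)] k by auto
    let ?l = "is @ filter (\<lambda>j. j \<noteq> k) js"
    have setl: "set ?l \<subseteq> {1..<k}" using s1 s2 by auto
    have att: "j \<noteq> k" if "j \<in> set_pmf (attach_pmf m \<rho> k H ?l)" for j
    proof -
      have "attach_prob m \<rho> k H ?l j \<noteq> 0"
        using that pmf_attach_pmf_aux[OF rho_gt k H setl] by (metis set_pmf_iff)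
      then show ?thesis by (auto simp: attach_prob_def)
    qed
    let ?f = "\<lambda>j. (count_list (js @ [j]) k, is @ filter (\<lambda>j. j \<noteq> k) (js @ [j]))"
    have "map_pmf ?f (attach_pmf m \<rho> k H ?l) =
        map_pmf (\<lambda>j. (count_list js k, ?l @ [j])) (attach_pmf m \<rho> k H ?l)"
    proof (rule map_pmf_cong[OF refl])
      fix j assume "j \<in> set_pmf (attach_pmf m \<rho> k H ?l)"
      then show "?f j = (count_list js k, ?l @ [j])" using att[of j] by simp
    qed
    moreover have "map_pmf ?f (return_pmf k) = return_pmf (Suc (count_list js k), ?l)"
      by simp
    ultimately have "(\<lambda>h. map_pmf ?f (if h then return_pmf k else attach_pmf m \<rho> k H ?l)) =
      (\<lambda>h. if h then return_pmf (Suc (count_list js k), ?l)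
           else map_pmf (\<lambda>j. (count_list js k, ?l @ [j])) (attach_pmf m \<rho> k H ?l))"
      by (intro ext) (simp only: if_distrib[where f = "map_pmf ?f"])
    then show ?thesis
      unfolding attach_split[OF H k s1 s2(2)] next_draw_def split map_bind_pmf s2(1) by simp
  qed
  have "?L (Suc y) = bind_pmf (targets_pmf m \<rho> k H m) (\<lambda>is.
        bind_pmf (targets_pmf m \<rho> (Suc k) (add_vertex k is H) y) (\<lambda>js.
         map_pmf (\<lambda>j. (count_list (js @ [j]) k, is @ filter (\<lambda>j. j \<noteq> k) (js @ [j])))
           (attach_pmf m \<rho> (Suc k) (add_vertex k is H) js)))"
    by (simp add: map_bind_pmf pmf.map_comp o_def)
  also have "\<dots> = bind_pmf (targets_pmf m \<rho> k H m) (\<lambda>is.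
        bind_pmf (targets_pmf m \<rho> (Suc k) (add_vertex k is H) y) (\<lambda>js.
         next_draw (count_list js k, is @ filter (\<lambda>j. j \<noteq> k) js)))"
    by (intro bind_pmf_cong refl step)
  also have "\<dots> = bind_pmf (?L y) next_draw"
    by (simp add: bind_assoc_pmf bind_map_pmf)
  also have "\<dots> = bind_pmf (?R y) next_draw" by (simp add: Suc.IH)
  also have "\<dots> = bind_pmf (polya_count a (weight k) y) (\<lambda>z.
      bind_pmf (targets_pmf m \<rho> k H (m + y - z)) (\<lambda>l. next_draw (z, l)))"
    by (simp add: bind_assoc_pmf bind_map_pmf)
  also have "\<dots> = bind_pmf (polya_count a (weight k) y) (\<lambda>z.
      bind_pmf (bernoulli_pmf ((a + real z) / (weight k + real y))) (\<lambda>h.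
        if h then map_pmf (Pair (Suc z)) (targets_pmf m \<rho> k H (m + Suc y - Suc z))
        else map_pmf (Pair z) (targets_pmf m \<rho> k H (m + Suc y - z))))"
  proof (intro bind_pmf_cong refl)
    fix z assume "z \<in> set_pmf (polya_count a (weight k) y)"
    then have "z \<le> y" by (rule set_pmf_polya_count)
    then have zy: "m + Suc y - z = Suc (m + y - z)" by simp
    have *: "bind_pmf (targets_pmf m \<rho> k H (m + y - z)) (\<lambda>l. if h then return_pmf (Suc z, l)
         else map_pmf (\<lambda>j. (z, l @ [j])) (attach_pmf m \<rho> k H l)) =
       (if h then map_pmf (Pair (Suc z)) (targets_pmf m \<rho> k H (m + Suc y - Suc z))
        else map_pmf (Pair z) (targets_pmf m \<rho> k H (m + Suc y - z)))" for h
      unfolding zy by (cases h) (simp_all add: map_pmf_def bind_assoc_pmf bind_return_pmf)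
    show "bind_pmf (targets_pmf m \<rho> k H (m + y - z)) (\<lambda>l. next_draw (z, l)) =
      bind_pmf (bernoulli_pmf ((a + real z) / (weight k + real y))) (\<lambda>h.
        if h then map_pmf (Pair (Suc z)) (targets_pmf m \<rho> k H (m + Suc y - Suc z))
        else map_pmf (Pair z) (targets_pmf m \<rho> k H (m + Suc y - z)))"
      unfolding next_draw_def split by (subst bind_commute_pmf) (simp only: *)
  qed
  also have "\<dots> = ?R (Suc y)"
  proof -
    have "(if h then map_pmf (Pair (Suc z)) (targets_pmf m \<rho> k H (m + Suc y - Suc z))
        else map_pmf (Pair z) (targets_pmf m \<rho> k H (m + Suc y - z))) =
      map_pmf (Pair (if h then Suc z else z)) (targets_pmf m \<rho> k H (m + Suc y - (if h then Suc z else z)))"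
      for h z by simp
    then show ?thesis unfolding polya_count.simps by (simp only: bind_assoc_pmf bind_map_pmf)
  qed
  finally show ?case .
qed

text \<open>
  The probability of a sequence of draws depends only on the multiset of its entries.
\<close>

lemma pmf_targets:
  assumes H: "pa_shape m (k - 1) H" and k: "k \<ge> 3" and "set l \<subseteq> {1..<k}"
  shows "pmf (targets_pmf m \<rho> k H (length l)) l =
    (\<Prod>j\<in>{1..<k}. pochhammer (real (total_degree H j) + \<rho>) (count_list l j)) /
    pochhammer (2 * real m * (real k - 2) + (real k - 1) * \<rho>) (length l)"
  using assms(3)
proof (induction l rule: rev_induct)
  case (snoc x l)
  let ?T = "targets_pmf m \<rho> k H (length l)"
  have l: "set l \<subseteq> {1..<k}" and x: "x \<in> {1..<k}" using snoc.prems by auto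
  have "pmf (targets_pmf m \<rho> k H (length (l @ [x]))) (l @ [x]) =
     (\<integral>js. pmf (map_pmf (\<lambda>j. js @ [j]) (attach_pmf m \<rho> k H js)) (l @ [x]) \<partial>?T)"
    by (simp add: pmf_bind)
  also have "\<dots> = (\<integral>js. attach_prob m \<rho> k H l x * indicator {l} js \<partial>?T)"
  proof (rule integral_cong_AE)
    show "AE js in ?T. pmf (map_pmf (\<lambda>j. js @ [j]) (attach_pmf m \<rho> k H js)) (l @ [x]) =
        attach_prob m \<rho> k H l x * indicator {l} js"
    proof (rule AE_pmfI)
      fix js assume js: "js \<in> set_pmf ?T"
      show "pmf (map_pmf (\<lambda>j. js @ [j]) (attach_pmf m \<rho> k H js)) (l @ [x]) =
        attach_prob m \<rho> k H l x * indicator {l} js"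
      proof (cases "js = l")
        case True
        then show ?thesis using pmf_map_inj'[of "\<lambda>j. l @ [j]" "attach_pmf m \<rho> k H l" x]
          pmf_attach_pmf_aux[OF rho_gt k H l] by (simp add: inj_def)
      next
        case False
        then have "l @ [x] \<notin> set_pmf (map_pmf (\<lambda>j. js @ [j]) (attach_pmf m \<rho> k H js))" by auto
        then have "pmf (map_pmf (\<lambda>j. js @ [j]) (attach_pmf m \<rho> k H js)) (l @ [x]) = 0"
          by (simp only: set_pmf_iff not_not)
        then show ?thesis using False by simp
      qed
    qed
  qed auto
  also have "\<dots> = attach_prob m \<rho> k H l x * pmf ?T l"
    by (simp add: measure_pmf_single)
  also have "\<dots> = attach_prob m \<rho> k H l x * ((\<Prod>j\<in>{1..<k}. pochhammer (real (total_degree H j) + \<rho>) (count_list l j)) /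
    pochhammer (2 * real m * (real k - 2) + (real k - 1) * \<rho>) (length l))"
    using snoc.IH l by simp
  also have "\<dots> = (\<Prod>j\<in>{1..<k}. pochhammer (real (total_degree H j) + \<rho>) (count_list (l @ [x]) j)) /
    pochhammer (2 * real m * (real k - 2) + (real k - 1) * \<rho>) (length (l @ [x]))"
  proof -
    have "(\<Prod>j\<in>{1..<k}. pochhammer (real (total_degree H j) + \<rho>) (count_list (l @ [x]) j)) =
      (\<Prod>j\<in>{1..<k}. pochhammer (real (total_degree H j) + \<rho>) (count_list l j) *
         (if j = x then real (total_degree H x) + \<rho> + real (count_list l x) else 1))"
      by (intro prod.cong) (auto simp: pochhammer_Suc)
    also have "\<dots> = (\<Prod>j\<in>{1..<k}. pochhammer (real (total_degree H j) + \<rho>) (count_list l j)) *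
        (real (total_degree H x) + \<rho> + real (count_list l x))"
      using x by (simp add: prod.distrib prod.delta)
    finally show ?thesis
      unfolding attach_prob_def using x by (simp only: if_True length_append_singleton pochhammer_Suc)
          (simp add: ac_simps)
  qed
  finally show ?case .
qed simp

text \<open>
  Exchangeability, in the only form needed below: reversing the order turns the last draws into the first ones.
\<close>

lemma targets_rev:
  assumes H: "pa_shape m (k - 1) H" and k: "k \<ge> 3"
  shows "map_pmf rev (targets_pmf m \<rho> k H y) = targets_pmf m \<rho> k H y"
proof (rule pmf_eqI)
  fix l
  have "pmf (map_pmf rev (targets_pmf m \<rho> k H y)) l = pmf (targets_pmf m \<rho> k H y) (rev l)"
    using pmf_map_inj'[of rev "targets_pmf m \<rho> k H y" "rev l"] by simp
  also have "\<dots> = pmf (targets_pmf m \<rho> k H y) l"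
  proof (cases "length l = y \<and> set l \<subseteq> {1..<k}")
    case True
    then show ?thesis
      using pmf_targets[OF H k, of l] pmf_targets[OF H k, of "rev l"] by simp
  next
    case False
    then have "l \<notin> set_pmf (targets_pmf m \<rho> k H y)" "rev l \<notin> set_pmf (targets_pmf m \<rho> k H y)"
      using targets_pmf_support[OF rho_gt k H, of _ y] by fastforce+
    then show ?thesis by (simp add: set_pmf_iff)
  qed
  finally show "pmf (map_pmf rev (targets_pmf m \<rho> k H y)) l = pmf (targets_pmf m \<rho> k H y) l" .
qed

lemma targets_take:
  assumes H: "pa_shape m (k - 1) H" and k: "k \<ge> 3"
  shows "map_pmf (take y) (targets_pmf m \<rho> k H (x + y)) = targets_pmf m \<rho> k H y"
proof (induction x)
  case 0
  have "map_pmf (take y) (targets_pmf m \<rho> k H y) = map_pmf id (targets_pmf m \<rho> k H y)"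
    using targets_pmf_support[OF rho_gt k H] by (intro map_pmf_cong) auto
  then show ?case by simp
next
  case (Suc x)
  have "map_pmf (take y) (targets_pmf m \<rho> k H (Suc x + y)) =
     bind_pmf (targets_pmf m \<rho> k H (x + y)) (\<lambda>js. map_pmf (\<lambda>j. take y (js @ [j])) (attach_pmf m \<rho> k H js))"
    by (simp add: map_bind_pmf pmf.map_comp o_def)
  also have "\<dots> = bind_pmf (targets_pmf m \<rho> k H (x + y)) (\<lambda>js. return_pmf (take y js))"
  proof (intro bind_pmf_cong refl)
    fix js assume "js \<in> set_pmf (targets_pmf m \<rho> k H (x + y))"
    then have "length js = x + y" using targets_pmf_support[OF rho_gt k H] by blast
    then show "map_pmf (\<lambda>j. take y (js @ [j])) (attach_pmf m \<rho> k H js) = return_pmf (take y js)"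
      by (simp add: map_pmf_const)
  qed
  finally show ?case using Suc.IH by (simp add: map_pmf_def)
qed

text \<open>
  If vertex \<open>k\<close> was missed, its own \<open>m\<close> edges must be discarded. By exchangeability the draws that come after
  them are distributed like fresh draws.
\<close>

lemma targets_drop:
  assumes H: "pa_shape m (k - 1) H" and k: "k \<ge> 3"
  shows "map_pmf (\<lambda>l. set (drop x l)) (targets_pmf m \<rho> k H (x + y)) = map_pmf set (targets_pmf m \<rho> k H y)"
proof -
  have "map_pmf (\<lambda>l. set (drop x l)) (targets_pmf m \<rho> k H (x + y)) =
     map_pmf (\<lambda>l. set (drop x (rev l))) (targets_pmf m \<rho> k H (x + y))"
    by (subst (2) targets_rev[OF H k, symmetric]) (simp add: pmf.map_comp o_def)
  also have "\<dots> = map_pmf (\<lambda>l. set (take y l)) (targets_pmf m \<rho> k H (x + y))"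
    using targets_pmf_support[OF rho_gt k H, of _ "x + y"]
    by (intro map_pmf_cong) (auto simp: drop_rev)
  also have "\<dots> = map_pmf set (map_pmf (take y) (targets_pmf m \<rho> k H (x + y)))"
    by (simp add: pmf.map_comp o_def)
  finally show ?thesis by (simp add: targets_take[OF H k])
qed

lemma wf_digraph_shape:
  assumes "pa_shape m k G" shows "wf_digraph G"
proof
  fix e assume e: "e \<in> arcs G"
  note sh = assms[unfolded pa_shape_def, THEN conjunct2]
  note verts = assms[unfolded pa_shape_def, THEN conjunct1]
  have f: "2 \<le> fst e" "fst e \<le> k" using e by (simp_all add: sh[THEN conjunct1] mem_Times_iff)
  then show "tail G e \<in> verts G"
    by (simp add: verts sh[THEN conjunct2, THEN conjunct1])
  have "head G e \<in> {1..<fst e}" using sh[THEN conjunct2, THEN conjunct2] e by blast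
  then show "head G e \<in> verts G" using f by (simp add: verts)
qed

lemma arcs_ends_add_vertex:
  assumes "pa_shape m (k - 1) H" "k \<ge> 3"
  shows "arcs_ends (add_vertex k is H) = arcs_ends H \<union> {k} \<times> set is"
proof -
  let ?G = "add_vertex k is H" and ?A = "Pair k ` {1..length is}"
  note sh = assms(1)[unfolded pa_shape_def, THEN conjunct2]
  have arcs: "arcs ?G = arcs H \<union> ?A" by (auto simp: add_vertex_def)
  have old: "arc_to_ends ?G ` arcs H = arc_to_ends H ` arcs H"
  proof (rule image_cong[OF refl])
    fix e assume "e \<in> arcs H"
    then have "fst e \<le> k - 1" by (simp add: sh[THEN conjunct1] mem_Times_iff)
    then have "fst e \<noteq> k" using assms(2) by linarith
    then show "arc_to_ends ?G e = arc_to_ends H e"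
      by (simp add: add_vertex_def arc_to_ends_def sh[THEN conjunct2, THEN conjunct1] mem_Times_iff)
  qed
  have "arc_to_ends ?G ` ?A = (\<lambda>l. arc_to_ends ?G (k, l)) ` {1..length is}"
    by (simp only: image_image)
  also have "\<dots> = (\<lambda>l. (k, is ! (l - 1))) ` {1..length is}"
    by (intro image_cong refl) (simp add: add_vertex_def arc_to_ends_def)
  also have "\<dots> = (\<lambda>l. (k, is ! (l - 1))) ` (Suc ` {..<length is})"
    by (simp only: image_Suc_lessThan)
  also have "\<dots> = Pair k ` ((!) is ` {..<length is})"
    by (simp only: image_image diff_Suc_1)
  also have "(!) is ` {..<length is} = set is" by (rule set_eqI) (auto simp: in_set_conv_nth)
  also have "Pair k ` set is = {k} \<times> set is" by (rule set_eqI) (simp add: image_iff mem_Times_iff prod_eq_iff)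
  finally show ?thesis by (simp only: arcs_ends_def arcs image_Un old)
qed

lemma reach_add_vertex:
  assumes H: "pa_shape m (k - 1) H" and k: "k \<ge> 3" and "is": "length is = m" "set is \<subseteq> {1..<k}"
  shows "S \<subseteq> {1..<k} \<Longrightarrow> reach (add_vertex k is H) S = reach H S"
    and "reach (add_vertex k is H) {k} = insert k (reach H (set is))"
proof -
  let ?G = "add_vertex k is H"
  interpret H: wf_digraph H using wf_digraph_shape[OF H] .
  interpret G: wf_digraph ?G using wf_digraph_shape[OF pa_shape_add_vertex[OF H _ "is"]] k by simp
  have "{1..k - 1} = {1..<k}" using k by auto
  then have vH: "verts H = {1..<k}" using H[unfolded pa_shape_def, THEN conjunct1] by simp
  have vG: "verts ?G = insert k (verts H)" by (simp add: add_vertex_def)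
  note ends = arcs_ends_add_vertex[OF H k, of "is"]
  have tail: "u \<in> verts H \<and> w \<in> verts H" if "(u, w) \<in> arcs_ends H" for u w
    using H.adj_in_verts that by blast
  have eq: "v \<rightarrow>\<^sup>*\<^bsub>?G\<^esub> w \<longleftrightarrow> v \<rightarrow>\<^sup>*\<^bsub>H\<^esub> w" if v: "v \<in> verts H" for v w
  proof -
    have "(v, w) \<in> (arcs_ends H)\<^sup>* \<and> w \<in> verts H" if "(v, w) \<in> (arcs_ends ?G)\<^sup>*"
      using that
    proof (induction rule: rtrancl_induct)
      case (step y z)
      then have "(y, z) \<in> arcs_ends H" using ends vH by auto
      then show ?case using step tail by (meson rtrancl.rtrancl_into_rtrancl)
    qed (use v in simp)
    moreover have "(arcs_ends H)\<^sup>* \<subseteq> (arcs_ends ?G)\<^sup>*" by (rule rtrancl_mono) (use ends in auto)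
    ultimately show ?thesis using H.reachable_conv'[OF v] G.reachable_conv'[of v] v vG by auto
  qed
  show *: "reach ?G S = reach H S" if "S \<subseteq> {1..<k}" for S
    unfolding reach_def using eq that vH by blast
  have kG: "k \<in> verts ?G" using vG by simp
  have "k \<rightarrow>\<^sup>*\<^bsub>?G\<^esub> w \<longleftrightarrow> w = k \<or> (\<exists>j\<in>set is. j \<rightarrow>\<^sup>*\<^bsub>?G\<^esub> w)" for w
  proof
    assume "k \<rightarrow>\<^sup>*\<^bsub>?G\<^esub> w"
    then have "(k, w) \<in> (arcs_ends ?G)\<^sup>*" using G.reachable_conv'[OF kG] by simp
    then show "w = k \<or> (\<exists>j\<in>set is. j \<rightarrow>\<^sup>*\<^bsub>?G\<^esub> w)"
    proof (cases rule: converse_rtranclE)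
      case (step y)
      then have y: "y \<in> set is" using ends tail vH by auto
      then have "y \<in> verts ?G" using "is" vH vG by auto
      then show ?thesis using step(2) G.reachable_conv'[of y] y by blast
    qed simp
  next
    assume "w = k \<or> (\<exists>j\<in>set is. j \<rightarrow>\<^sup>*\<^bsub>?G\<^esub> w)"
    then show "k \<rightarrow>\<^sup>*\<^bsub>?G\<^esub> w"
    proof
      assume "w = k" then show ?thesis using kG by simp
    next
      assume "\<exists>j\<in>set is. j \<rightarrow>\<^sup>*\<^bsub>?G\<^esub> w"
      then obtain j where "j \<in> set is" "j \<rightarrow>\<^sup>*\<^bsub>?G\<^esub> w" by blast
      then show ?thesis using ends by (intro G.adj_reachable_trans[of k j w]) auto
    qed
  qed
  then have "reach ?G {k} = insert k (reach ?G (set is))" by (auto simp: reach_def)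
  then show "reach ?G {k} = insert k (reach H (set is))" using *[OF "is"(2)] by simp
qed

lemma reach_Un: "reach G (S \<union> T) = reach G S \<union> reach G T"
  by (auto simp: reach_def)

lemma reach_subset: "pa_shape m k G \<Longrightarrow> reach G S \<subseteq> {1..k}"
  using wf_digraph.reachable_in_verts(2)[OF wf_digraph_shape] unfolding reach_def pa_shape_def by blast

lemma card_reach_add_vertex:
  assumes H: "pa_shape m (k - 1) H" and k: "k \<ge> 3" and "is": "length is = m" "set is \<subseteq> {1..<k}"
    and js: "set js \<subseteq> {1..<Suc k}"
  shows "card (reach (add_vertex k is H) (set js)) =
    (if count_list js k = 0 then card (reach H (set js))
     else Suc (card (reach H (set (is @ filter (\<lambda>j. j \<noteq> k) js)))))"
proof (cases "count_list js k = 0")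
  case True
  then have "k \<notin> set js" by (simp add: count_list_0_iff)
  have "set js \<subseteq> {1..<k}"
  proof
    fix j assume "j \<in> set js"
    then have "j \<in> {1..<Suc k}" "j \<noteq> k" using js \<open>k \<notin> set js\<close> by blast+
    then show "j \<in> {1..<k}" by simp
  qed
  then show ?thesis using True reach_add_vertex(1)[OF H k "is"] by simp
next
  case False
  then have "k \<in> set js" by (simp add: count_list_0_iff)
  let ?F = "set (filter (\<lambda>j. j \<noteq> k) js)"
  have split: "set js = {k} \<union> ?F" using \<open>k \<in> set js\<close> by auto
  have F: "?F \<subseteq> {1..<k}" using js by auto
  have "reach (add_vertex k is H) (set js) = insert k (reach H (set is) \<union> reach H ?F)"
    unfolding split reach_Un reach_add_vertex(1)[OF H k "is" F] reach_add_vertex(2)[OF H k "is"] by simp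
  also have "reach H (set is) \<union> reach H ?F = reach H (set (is @ filter (\<lambda>j. j \<noteq> k) js))"
    by (simp add: reach_Un)
  finally have *: "reach (add_vertex k is H) (set js) = insert k (reach H (set (is @ filter (\<lambda>j. j \<noteq> k) js)))" .
  have "reach H T \<subseteq> {1..k - 1}" for T using reach_subset[OF H] .
  then have "finite (reach H T)" "k \<notin> reach H T" for T
    using finite_subset[of "reach H T" "{1..k-1}"] k by (blast, fastforce)
  then show ?thesis using False unfolding * by simp
qed

text \<open>
  The law of the number of descendants in \<open>G\<^sub>k\<close> of the endpoints of \<open>y\<close> further edges attached to \<open>G\<^sub>k\<close>.
\<close>

definition desc_law :: "nat \<Rightarrow> nat \<Rightarrow> nat pmf" where
  "desc_law k y = bind_pmf (pa_graph m \<rho> k)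
     (\<lambda>G. map_pmf (\<lambda>js. card (reach G (set js))) (targets_pmf m \<rho> (Suc k) G y))"

lemma desc_law_rec:
  assumes k: "k \<ge> 3"
  shows "desc_law k y = bind_pmf (polya_count a (weight k) y)
    (\<lambda>z. if z = 0 then desc_law (k - 1) y else map_pmf Suc (desc_law (k - 1) (m + y - z)))"
proof -
  define F where "F = (\<lambda>H (z::nat, l). if z = 0 then card (reach H (set (drop m l)))
      else Suc (card (reach H (set l))))"
  have "desc_law k y = bind_pmf (pa_graph m \<rho> (k - 1)) (\<lambda>H. bind_pmf (targets_pmf m \<rho> k H m)
     (\<lambda>is. map_pmf (\<lambda>js. card (reach (add_vertex k is H) (set js))) (targets_pmf m \<rho> (Suc k) (add_vertex k is H) y)))"
    unfolding desc_law_def using k by (subst pa_graph.simps) (simp add: bind_assoc_pmf bind_map_pmf)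
  also have "\<dots> = bind_pmf (pa_graph m \<rho> (k - 1)) (\<lambda>H. bind_pmf (polya_count a (weight k) y)
    (\<lambda>z. if z = 0 then map_pmf (\<lambda>js. card (reach H (set js))) (targets_pmf m \<rho> k H y)
         else map_pmf Suc (map_pmf (\<lambda>js. card (reach H (set js))) (targets_pmf m \<rho> k H (m + y - z)))))"
  proof (intro bind_pmf_cong refl)
    fix H assume "H \<in> set_pmf (pa_graph m \<rho> (k - 1))"
    then have H: "pa_shape m (k - 1) H" using pa_graph_support[OF rho_gt] k by simp
    have "bind_pmf (targets_pmf m \<rho> k H m)
     (\<lambda>is. map_pmf (\<lambda>js. card (reach (add_vertex k is H) (set js))) (targets_pmf m \<rho> (Suc k) (add_vertex k is H) y)) =
      bind_pmf (targets_pmf m \<rho> k H m)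
       (\<lambda>is. map_pmf (\<lambda>js. F H (count_list js k, is @ filter (\<lambda>j. j \<noteq> k) js)) (targets_pmf m \<rho> (Suc k)
           (add_vertex k is H) y))"
    proof (intro bind_pmf_cong map_pmf_cong refl)
      fix "is" js assume a1: "is \<in> set_pmf (targets_pmf m \<rho> k H m)"
        and a2: "js \<in> set_pmf (targets_pmf m \<rho> (Suc k) (add_vertex k is H) y)"
      have s1: "length is = m" "set is \<subseteq> {1..<k}"
        using targets_pmf_support[OF rho_gt k H a1] by auto
      have G: "pa_shape m (Suc k - 1) (add_vertex k is H)"
        using pa_shape_add_vertex[OF H _ s1] k by simp
      have s2: "set js \<subseteq> {1..<Suc k}"
        using targets_pmf_support[OF rho_gt _ G a2] k by auto
      have "filter (\<lambda>j. j \<noteq> k) js = js" if "count_list js k = 0"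
        using that by (induction js) (auto split: if_splits)
      then show "card (reach (add_vertex k is H) (set js)) = F H (count_list js k, is @ filter (\<lambda>j. j \<noteq> k) js)"
        unfolding card_reach_add_vertex[OF H k s1 s2] F_def using s1 by simp
    qed
    also have "\<dots> = map_pmf (F H) (bind_pmf (targets_pmf m \<rho> k H m) (\<lambda>is.
           map_pmf (\<lambda>js. (count_list js k, is @ filter (\<lambda>j. j \<noteq> k) js))
             (targets_pmf m \<rho> (Suc k) (add_vertex k is H) y)))"
      by (simp only: map_bind_pmf pmf.map_comp o_def)
    also have "\<dots> = bind_pmf (polya_count a (weight k) y) (\<lambda>z. map_pmf (\<lambda>l. F H (z, l)) (targets_pmf m \<rho>
        k H (m + y - z)))"
      unfolding newest_and_older_draws[OF H k] by (simp only: map_bind_pmf pmf.map_comp o_def)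
    also have "\<dots> = bind_pmf (polya_count a (weight k) y)
      (\<lambda>z. if z = 0 then map_pmf (\<lambda>js. card (reach H (set js))) (targets_pmf m \<rho> k H y)
         else map_pmf Suc (map_pmf (\<lambda>js. card (reach H (set js))) (targets_pmf m \<rho> k H (m + y - z))))"
    proof (intro bind_pmf_cong refl)
      fix z
      have "map_pmf (\<lambda>l. card (reach H (set (drop m l)))) (targets_pmf m \<rho> k H (m + y)) =
         map_pmf (\<lambda>S. card (reach H S)) (map_pmf (\<lambda>l. set (drop m l)) (targets_pmf m \<rho> k H (m + y)))"
        by (simp add: pmf.map_comp o_def)
      also have "\<dots> = map_pmf (\<lambda>js. card (reach H (set js))) (targets_pmf m \<rho> k H y)"
        unfolding targets_drop[OF H k] by (simp add: pmf.map_comp o_def)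
      finally show "map_pmf (\<lambda>l. F H (z, l)) (targets_pmf m \<rho> k H (m + y - z)) =
        (if z = 0 then map_pmf (\<lambda>js. card (reach H (set js))) (targets_pmf m \<rho> k H y)
         else map_pmf Suc (map_pmf (\<lambda>js. card (reach H (set js))) (targets_pmf m \<rho> k H (m + y - z))))"
        by (cases "z = 0") (simp_all add: F_def pmf.map_comp o_def)
    qed
    finally show "bind_pmf (targets_pmf m \<rho> k H m)
     (\<lambda>is. map_pmf (\<lambda>js. card (reach (add_vertex k is H) (set js))) (targets_pmf m \<rho> (Suc k) (add_vertex k is H) y)) =
      bind_pmf (polya_count a (weight k) y)
      (\<lambda>z. if z = 0 then map_pmf (\<lambda>js. card (reach H (set js))) (targets_pmf m \<rho> k H y)
         else map_pmf Suc (map_pmf (\<lambda>js. card (reach H (set js))) (targets_pmf m \<rho> k H (m + y - z))))" .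
  qed
  also have "\<dots> = bind_pmf (polya_count a (weight k) y)
    (\<lambda>z. if z = 0 then desc_law (k - 1) y else map_pmf Suc (desc_law (k - 1) (m + y - z)))"
    unfolding desc_law_def using k
    by (subst bind_commute_pmf) (intro bind_pmf_cong refl, simp add: map_bind_pmf)
  finally show ?thesis .
qed

text \<open>
  The recursion cannot be started at \<open>k = 1\<close>, because the attachment rule is not well defined for the single
  vertex when \<open>\<rho> \<le> 0\<close>. In \<open>G\<^sub>2\<close> the only question is whether vertex \<open>2\<close> is hit.
\<close>

lemma desc_law_2:
  assumes "y \<ge> 1"
  shows "desc_law 2 y = map_pmf (\<lambda>z. if z = 0 then 1 else 2) (polya_count a (weight 2) y)"
proof -
  let ?G = "add_vertex 2 (replicate m 1) single_vertex"
  have G: "pa_shape m 2 ?G" using pa_shape_single_vertex by (intro pa_shape_add_vertex) auto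
  interpret wf_digraph ?G using wf_digraph_shape[OF G] .
  have v: "verts ?G = {1, 2}" by (auto simp: add_vertex_def single_vertex_def)
  have "(2, 1) = (tail ?G (2, 1), head ?G (2, 1))" "(2, 1) \<in> arcs ?G"
    using m_ge_2 by (auto simp: add_vertex_def)
  then have "2 \<rightarrow>\<^bsub>?G\<^esub> 1" unfolding arcs_ends_def arc_to_ends_def by (rule image_eqI)
  then have r2: "2 \<rightarrow>\<^sup>*\<^bsub>?G\<^esub> 1" by (rule reachable_adjI)
  have refl: "1 \<rightarrow>\<^sup>*\<^bsub>?G\<^esub> 1" "2 \<rightarrow>\<^sup>*\<^bsub>?G\<^esub> 2" using v by (intro reachable_refl; simp only: insert_iff simp_thms)+
  have in12: "w = 1 \<or> w = 2" if "u \<rightarrow>\<^sup>*\<^bsub>?G\<^esub> w" for u w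
    using reachable_in_verts(2)[OF that] v by simp
  have no: "\<not> 1 \<rightarrow>\<^sup>*\<^bsub>?G\<^esub> 2"
  proof
    assume "1 \<rightarrow>\<^sup>*\<^bsub>?G\<^esub> 2"
    then have "(1, 2) \<in> (arcs_ends ?G)\<^sup>*" by (rule reachable_rtranclI)
    then show False
      by (cases rule: converse_rtranclE) (auto simp: arcs_ends_def arc_to_ends_def add_vertex_def single_vertex_def)
  qed
  have r: "card (reach ?G (set js)) = (if count_list js 2 = 0 then 1 else 2)"
    if "length js = y" "set js \<subseteq> {1..<Suc 2}" for js
  proof (cases "2 \<in> set js")
    case True
    then have "reach ?G (set js) = {1, 2}"
      unfolding reach_def using r2 refl in12 by blast
    then show ?thesis using True by (simp add: count_list_0_iff)
  next
    case False
    have js1: "set js = {1}"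
    proof -
      have "set js \<noteq> {}" using that assms by auto
      moreover have "set js \<subseteq> {1}"
      proof
        fix j assume "j \<in> set js"
        then have "j \<in> {1..<Suc 2}" "j \<noteq> 2" using that False by auto
        then show "j \<in> {1}" by auto
      qed
      ultimately show ?thesis by (metis subset_singletonD)
    qed
    have "reach ?G (set js) = {1}"
      unfolding reach_def js1 using no refl in12 by blast
    then show ?thesis using False by (simp add: count_list_0_iff)
  qed
  have "desc_law 2 y = map_pmf (\<lambda>js. card (reach ?G (set js))) (targets_pmf m \<rho> (Suc 2) ?G y)"
    unfolding desc_law_def by (subst pa_graph.simps) (simp add: bind_return_pmf)
  also have "\<dots> = map_pmf (\<lambda>js. if count_list js 2 = 0 then 1 else 2) (targets_pmf m \<rho> (Suc 2) ?G y)"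
    using targets_pmf_support[OF rho_gt _ _, of "Suc 2" ?G _ y] G by (intro map_pmf_cong refl r) auto
  also have "\<dots> = map_pmf (\<lambda>z. if z = 0 then 1 else 2) (map_pmf (\<lambda>js. count_list js 2) (targets_pmf m \<rho> (Suc 2) ?G y))"
    by (simp add: pmf.map_comp o_def)
  finally show ?thesis using count_newest_distr[OF G] by simp
qed

text \<open>
  \<open>desc_law_rec\<close> is the same recursion as that of the chain. The final \<open>Suc\<close> accounts for vertex \<open>1\<close>.
\<close>

lemma desc_law_descend:
  assumes "k \<ge> 2" "y \<ge> 1"
  shows "map_pmf (\<lambda>d. d + N) (desc_law k y) = map_pmf (\<lambda>s. Suc (snd s)) (descend 1 k (y, N))"
  using assms
proof (induction k arbitrary: y N rule: nat_induct_at_least)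
  case base
  have "descend 1 2 (y, N) = step 2 (y, N)"
    using bind_return_pmf' by (simp add: numeral_2_eq_2 cong: bind_pmf_cong)
  then show ?case using desc_law_2[OF base]
    by (auto simp: step_def pmf.map_comp o_def intro!: map_pmf_cong)
next
  case (Suc k)
  have "map_pmf (\<lambda>d. d + N) (desc_law (Suc k) y) = bind_pmf (polya_count a (weight (Suc k)) y)
    (\<lambda>z. if z = 0 then map_pmf (\<lambda>d. d + N) (desc_law k y) else map_pmf (\<lambda>d. d + Suc N) (desc_law k (m + y - z)))"
    using Suc.hyps by (subst desc_law_rec) (auto simp: map_bind_pmf pmf.map_comp o_def intro!: bind_pmf_cong)
  also have "\<dots> = bind_pmf (polya_count a (weight (Suc k)) y)
    (\<lambda>z. map_pmf (\<lambda>s. Suc (snd s)) (descend 1 k (if z = 0 then (y, N) else (y - z + m, Suc N))))"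
  proof (intro bind_pmf_cong refl)
    fix z assume "z \<in> set_pmf (polya_count a (weight (Suc k)) y)"
    then have "m + y - z = y - z + m" using set_pmf_polya_count by fastforce
    moreover have "y - z + m \<ge> 1" using m_ge_2 by simp
    ultimately show "(if z = 0 then map_pmf (\<lambda>d. d + N) (desc_law k y) else map_pmf (\<lambda>d. d + Suc N)
        (desc_law k (m + y - z))) =
       map_pmf (\<lambda>s. Suc (snd s)) (descend 1 k (if z = 0 then (y, N) else (y - z + m, Suc N)))"
      using Suc.IH[OF Suc.prems] Suc.IH[of "m + y - z" "Suc N"] by (cases "z = 0") simp_all
  qed
  also have "\<dots> = map_pmf (\<lambda>s. Suc (snd s)) (descend 1 (Suc k) (y, N))"
    using Suc.hyps by (simp add: step_def map_bind_pmf bind_map_pmf) (intro bind_pmf_cong refl, simp)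
  finally show ?case .
qed

text \<open>
  Vertex \<open>n\<close> is a descendant of itself and has \<open>m\<close> edges into \<open>G\<^bsub>n-1\<^esub>\<close>, which explains the initial
  state \<open>(m, 1)\<close>.
\<close>

theorem num_descendants_law:
  assumes n: "n \<ge> 3"
  shows "map_pmf (\<lambda>G. num_descendants G n) (pa_graph m \<rho> n) = map_pmf (\<lambda>s. Suc (snd s)) (descend 1 (n - 1) (m, 1))"
proof -
  have "map_pmf (\<lambda>G. num_descendants G n) (pa_graph m \<rho> n) =
    bind_pmf (pa_graph m \<rho> (n - 1)) (\<lambda>H. map_pmf (\<lambda>js. num_descendants (add_vertex n js H) n)
        (targets_pmf m \<rho> n H m))"
    using n by (subst pa_graph.simps) (simp add: map_bind_pmf pmf.map_comp o_def)
  also have "\<dots> = bind_pmf (pa_graph m \<rho> (n - 1)) (\<lambda>H. map_pmf (\<lambda>js. card (reach H (set js)) + 1)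
      (targets_pmf m \<rho> n H m))"
  proof (intro bind_pmf_cong map_pmf_cong refl)
    fix H js assume "H \<in> set_pmf (pa_graph m \<rho> (n - 1))" and js: "js \<in> set_pmf (targets_pmf m \<rho> n H m)"
    then have H: "pa_shape m (n - 1) H" using pa_graph_support[OF rho_gt] n by simp
    have s1: "length js = m" "set js \<subseteq> {1..<n}"
      using targets_pmf_support[OF rho_gt n H js] by auto
    show "num_descendants (add_vertex n js H) n = card (reach H (set js)) + 1"
      using card_reach_add_vertex[OF H n s1, of "[n]"] n by (simp add: num_descendants_def reach_def)
  qed
  also have "\<dots> = map_pmf (\<lambda>d. d + 1) (desc_law (n - 1) m)"
    using n by (simp add: desc_law_def map_bind_pmf pmf.map_comp o_def)
  also have "\<dots> = map_pmf (\<lambda>s. Suc (snd s)) (descend 1 (n - 1) (m, 1))"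
    using n m_ge_2 by (intro desc_law_descend) auto
  finally show ?thesis .
qed

end

section \<open>Ratios of Gamma functions and elementary estimates\<close>

definition gamma_ratio :: "real \<Rightarrow> real \<Rightarrow> real" where
  "gamma_ratio x s = Gamma (x + s) / Gamma x"

lemma gamma_ratio_pos: "x > 0 \<Longrightarrow> s \<ge> 0 \<Longrightarrow> gamma_ratio x s > 0"
  by (simp add: gamma_ratio_def)

lemma ln_Gamma_MVT:
  fixes x y :: real
  assumes "0 < x" "x < y"
  obtains z where "x < z" "z < y" "ln (Gamma y) - ln (Gamma x) = (y - x) * Digamma z"
proof -
  have "\<exists>z>x. z < y \<and> ln (Gamma y) - ln (Gamma x) = (y - x) * Digamma z"
  proof (rule MVT2[OF assms(2)])
    fix t assume "x \<le> t" "t \<le> y"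
    then have "t > 0" using assms by simp
    then show "((\<lambda>t. ln (Gamma t)) has_real_derivative Digamma t) (at t)"
      by (auto intro!: derivative_eq_intros simp: Gamma_eq_zero_iff elim!: nonpos_Ints_cases')
  qed
  then show ?thesis using that by blast
qed

lemma Gamma_plus1_pos: "x > 0 \<Longrightarrow> Gamma (x + 1) = x * Gamma (x::real)"
  by (rule Gamma_plus1) (auto elim!: nonpos_Ints_cases')

lemma ln_Gamma_plus1: "x > 0 \<Longrightarrow> ln (Gamma (x + 1)) - ln (Gamma x) = ln (x::real)"
proof -
  assume "x > 0"
  then have "Gamma x > 0" by simp
  then have "ln (x * Gamma x) = ln x + ln (Gamma x)" using \<open>x > 0\<close> by (intro ln_mult_pos)
  then show ?thesis using \<open>x > 0\<close> by (simp only: Gamma_plus1_pos)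
qed

lemma ln_gamma_ratio:
  assumes "x > 0" "s \<ge> 0"
  shows "ln (gamma_ratio x s) = ln (Gamma (x + s)) - ln (Gamma x)"
proof -
  have "Gamma x > 0" "Gamma (x + s) > 0" using assms by simp_all
  then show ?thesis unfolding gamma_ratio_def by (simp add: ln_div)
qed

text \<open>
  The Digamma function is increasing, and its mean over \<open>[x + s, x + s + 1]\<close> is \<open>ln (x + s)\<close> by the
  functional equation. The lower bound below compares with the mean over \<open>[x, x + 1]\<close> instead.
\<close>

lemma gamma_ratio_le:
  assumes "x > 0" "s > 0"
  shows "gamma_ratio x s \<le> (x + s) powr s"
proof -
  obtain z where z: "x < z" "z < x + s" "ln (Gamma (x + s)) - ln (Gamma x) = s * Digamma z"
    using ln_Gamma_MVT[of x "x + s"] assms by auto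
  obtain w where w: "x + s < w" "w < x + s + 1" "ln (Gamma (x + s + 1)) - ln (Gamma (x + s)) = Digamma w"
    using ln_Gamma_MVT[of "x + s" "x + s + 1"] assms by auto
  have "Digamma z \<le> Digamma w"
    using z w assms by (intro Polygamma_real_mono) auto
  then have "ln (gamma_ratio x s) \<le> s * ln (x + s)"
    using z w assms ln_Gamma_plus1[of "x + s"] by (simp add: ln_gamma_ratio mult_left_mono)
  then have "gamma_ratio x s \<le> exp (s * ln (x + s))"
    using gamma_ratio_pos[of x s] assms by (simp add: ln_ge_iff[symmetric] flip: ln_le_cancel_iff)
  then show ?thesis using assms by (simp add: powr_def)
qed

lemma gamma_ratio_shift:
  assumes "x > 0" "s \<ge> 0"
  shows "gamma_ratio (x + 1) s = gamma_ratio x s * ((x + s) / x)"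
proof -
  have "Gamma (x + 1 + s) = (x + s) * Gamma (x + s)"
    using assms Gamma_plus1_pos[of "x + s"] by (simp add: add_ac)
  moreover have "Gamma (x + 1) = x * Gamma x" using assms(1) by (rule Gamma_plus1_pos[of x])
  ultimately show ?thesis by (simp add: gamma_ratio_def mult_ac)
qed

lemma gamma_ratio_ge:
  assumes "x > 0" "s > 0"
  shows "gamma_ratio x s \<ge> x powr s * (x / (x + s))"
proof -
  obtain z where z: "x + 1 < z" "z < x + 1 + s" "ln (Gamma (x + 1 + s)) - ln (Gamma (x + 1)) = s * Digamma z"
    using ln_Gamma_MVT[of "x + 1" "x + 1 + s"] assms by auto
  obtain w where w: "x < w" "w < x + 1" "ln (Gamma (x + 1)) - ln (Gamma x) = Digamma w"
    using ln_Gamma_MVT[of x "x + 1"] assms by auto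
  have "Digamma w \<le> Digamma z"
    using z w assms by (intro Polygamma_real_mono) auto
  then have "s * ln x \<le> ln (gamma_ratio (x + 1) s)"
    using z w assms ln_Gamma_plus1[of x] by (simp add: ln_gamma_ratio mult_left_mono)
  then have "exp (s * ln x) \<le> gamma_ratio (x + 1) s"
    using gamma_ratio_pos[of "x + 1" s] assms by (simp add: ln_ge_iff)
  then have "x powr s \<le> gamma_ratio x s * ((x + s) / x)"
    using assms gamma_ratio_shift[of x s] by (simp add: powr_def)
  then show ?thesis using assms by (simp add: field_simps)
qed

lemma gamma_ratio_mono:
  assumes "0 < x" "x \<le> y" "s \<ge> 0"
  shows "gamma_ratio x s \<le> gamma_ratio y s"
proof -
  have "ln (Gamma (x + s)) - ln (Gamma x) \<le> ln (Gamma (y + s)) - ln (Gamma y)"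
  proof (rule DERIV_nonneg_imp_nondecreasing[OF assms(2), where f = "\<lambda>t. ln (Gamma (t + s)) - ln (Gamma t)"])
    fix t assume "x \<le> t" "t \<le> y"
    then have t: "t > 0" using assms by simp
    have "((\<lambda>t. ln (Gamma (t + s)) - ln (Gamma t)) has_real_derivative (Digamma (t + s) - Digamma t)) (at t)"
      using t assms(3)
      by (auto intro!: derivative_eq_intros simp: Gamma_eq_zero_iff add_pos_nonneg elim!: nonpos_Ints_cases')
    moreover have "Digamma (t + s) - Digamma t \<ge> 0" using t assms(3) Polygamma_real_mono[of t "t + s" 0] by simp
    ultimately show "\<exists>D. ((\<lambda>t. ln (Gamma (t + s)) - ln (Gamma t)) has_real_derivative D) (at t) \<and> 0 \<le> D" by blast
  qed
  then have "ln (gamma_ratio x s) \<le> ln (gamma_ratio y s)" using assms by (simp add: ln_gamma_ratio)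
  then show ?thesis using gamma_ratio_pos[of x s] gamma_ratio_pos[of y s] assms by simp
qed

lemma gamma_ratio_plus1:
  assumes "x > 0" "s \<ge> 0"
  shows "gamma_ratio x (s + 1) = (x + s) * gamma_ratio x s"
  using Gamma_plus1_pos[of "x + s"] assms by (simp add: gamma_ratio_def add.assoc)

lemma gamma_ratio_two_sided:
  assumes "x \<ge> x0" "x0 > 0" "s > 0"
  shows "(x0 / (x0 + s)) * x powr s \<le> gamma_ratio x s" "gamma_ratio x s \<le> ((x0 + s) / x0) powr s * x powr s"
proof -
  have x: "x > 0" using assms by simp
  have "x0 / (x0 + s) \<le> x / (x + s)" using assms x by (simp add: divide_simps) (simp add: algebra_simps)
  then have "(x0 / (x0 + s)) * x powr s \<le> x / (x + s) * x powr s" by (intro mult_right_mono) auto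
  also have "\<dots> \<le> gamma_ratio x s" using gamma_ratio_ge[OF x assms(3)] by (simp add: mult.commute)
  finally show "(x0 / (x0 + s)) * x powr s \<le> gamma_ratio x s" .
  have "x + s \<le> (x0 + s) / x0 * x" using assms by (simp add: field_simps)
  have "gamma_ratio x s \<le> (x + s) powr s" by (rule gamma_ratio_le[OF x assms(3)])
  also have "\<dots> \<le> ((x0 + s) / x0 * x) powr s"
    using \<open>x + s \<le> (x0 + s) / x0 * x\<close> assms x by (intro powr_mono2) auto
  also have "\<dots> = ((x0 + s) / x0) powr s * x powr s" using assms x by (intro powr_mult)
  finally show "gamma_ratio x s \<le> ((x0 + s) / x0) powr s * x powr s" .
qed

lemma gamma_ratio_asymp:
  assumes "s > 0"
  shows "((\<lambda>x. gamma_ratio x s / x powr s) \<longlongrightarrow> 1) at_top"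
proof (rule real_tendsto_sandwich)
  show "\<forall>\<^sub>F x in at_top. x / (x + s) \<le> gamma_ratio x s / x powr s"
    using eventually_gt_at_top[of 0]
    by eventually_elim (use gamma_ratio_ge[OF _ assms] in \<open>simp add: field_simps\<close>)
  show "\<forall>\<^sub>F x in at_top. gamma_ratio x s / x powr s \<le> ((x + s) / x) powr s"
    using eventually_gt_at_top[of 0]
    by eventually_elim (use gamma_ratio_le[OF _ assms] assms in \<open>simp add: powr_divide divide_right_mono\<close>)
  show "((\<lambda>x. x / (x + s)) \<longlongrightarrow> 1) at_top" using assms by real_asymp
  have "((\<lambda>x. (x + s) / x) \<longlongrightarrow> 1) at_top" by real_asymp
  then have "((\<lambda>x. ((x + s) / x) powr s) \<longlongrightarrow> 1 powr s) at_top"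
    by (intro tendsto_powr) auto
  then show "((\<lambda>x. ((x + s) / x) powr s) \<longlongrightarrow> 1) at_top" by simp
qed

lemma powr_le_exp:
  fixes z p :: real
  assumes "z > -1" "p \<ge> 0"
  shows "(1 + z) powr p \<le> exp (p * z)"
proof -
  have "p * ln (1 + z) \<le> p * z" using ln_add_one_self_le_self2 assms by (intro mult_left_mono) auto
  then show ?thesis using assms unfolding powr_def by simp
qed

lemma exp_minus_le: "z \<ge> 0 \<Longrightarrow> exp (- z) \<le> 1 / (1 + z)" for z :: real
  using exp_ge_add_one_self[of z] by (simp add: exp_minus field_simps)

text \<open>
  Used in the form \<open>(k - 1)\<^sup>x (1 + x / k) \<le> k\<^sup>x\<close>: a quantity that grows by a factor \<open>1 + x / k\<close> in the
  step from \<open>k\<close> to \<open>k - 1\<close> grows altogether at most like \<open>k\<^bsup>-x\<^esup>\<close>.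
\<close>

lemma powr_shrink_le:
  fixes k x :: real
  assumes "k \<ge> 1" "x \<ge> 0"
  shows "(1 - 1 / k) powr x \<le> 1 / (1 + x / k)"
proof (cases "k = 1")
  case True
  then show ?thesis using assms by simp
next
  case False
  then have "(1 + (- 1 / k)) powr x \<le> exp (x * (- 1 / k))"
    using assms by (intro powr_le_exp) (auto simp: field_simps)
  also have "\<dots> \<le> 1 / (1 + x / k)" using exp_minus_le[of "x / k"] assms by simp
  finally show ?thesis by simp
qed

lemma sum_powr_tail_le:
  fixes x :: real and J K :: nat
  assumes "x > 0" "J \<ge> 1"
  shows "(\<Sum>k\<in>{J<..K}. real k powr (- 1 - x)) \<le> real J powr (- x) / x"
proof (cases "J \<le> K")
  case True
  then have "(\<Sum>k\<in>{J<..K}. real k powr (- 1 - x)) \<le> (real J powr (- x) - real K powr (- x)) / x"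
  proof (induction K rule: dec_induct)
    case (step n)
    have "\<exists>z>real n. z < real (Suc n) \<and> real (Suc n) powr (- x) - real n powr (- x) =
        (real (Suc n) - real n) * ((- x) * z powr (- x - 1))"
      using step.hyps assms
      by (intro MVT2) (auto intro!: derivative_eq_intros simp: powr_diff field_simps)
    then obtain z where z: "real n < z" "z < real (Suc n)"
      "real (Suc n) powr (- x) - real n powr (- x) = - x * z powr (- x - 1)" by auto
    have "real (Suc n) powr (- 1 - x) \<le> z powr (- 1 - x)"
      using z step.hyps assms by (intro powr_mono2') auto
    then have "x * real (Suc n) powr (- 1 - x) \<le> x * z powr (- 1 - x)" using assms by simp
    moreover have "real n powr (- x) - real (Suc n) powr (- x) = x * z powr (- 1 - x)"
    proof -
      have e: "- x - 1 = - 1 - x" by simp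
      show ?thesis using z(3)[unfolded e] by linarith
    qed
    ultimately have "x * real (Suc n) powr (- 1 - x) \<le> real n powr (- x) - real (Suc n) powr (- x)" by linarith
    then have "real (Suc n) powr (- 1 - x) \<le> (real n powr (- x) - real (Suc n) powr (- x)) / x"
      using assms by (simp add: pos_le_divide_eq mult.commute)
    moreover have "{J<..Suc n} = insert (Suc n) {J<..n}" using step.hyps by auto
    ultimately show ?case using step.IH by (simp add: diff_divide_distrib)
  qed simp
  also have "\<dots> \<le> real J powr (- x) / x" using assms by (simp add: divide_right_mono)
  finally show ?thesis .
qed (use assms in simp)

lemma sum_inverse_square_tail_le:
  assumes "J \<ge> 1"
  shows "(\<Sum>k\<in>{J<..K}. 1 / (real k)\<^sup>2) \<le> 1 / real J"
proof -
  have "(\<Sum>k\<in>{J<..K}. 1 / (real k)\<^sup>2) = (\<Sum>k\<in>{J<..K}. real k powr (- 1 - 1))"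
    using assms by (intro sum.cong) (auto simp: powr_minus_divide powr_numeral)
  also have "\<dots> \<le> real J powr (- 1) / 1" by (rule sum_powr_tail_le) (use assms in auto)
  finally show ?thesis using assms by (simp add: powr_minus_divide)
qed

lemma sum_powr_le:
  fixes x :: real and J K :: nat
  assumes "x > 0" "J \<ge> 1"
  shows "(\<Sum>k\<in>{J<..K}. real k powr (x - 1)) \<le> (1 + x) / x * real K powr x"
proof (cases "J \<le> K")
  case True
  then have "(\<Sum>k\<in>{J<..K}. real k powr (x - 1)) \<le> (1 + x) / x * real K powr x"
  proof (induction K rule: dec_induct)
    case base
    then show ?case using assms by simp
  next
    case (step n)
    let ?k = "real (Suc n)"
    have k: "?k > 1" using step.hyps assms by simp
    have "(1 - 1 / ?k) powr x \<le> 1 / (1 + x / ?k)" using k assms by (intro powr_shrink_le) auto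
    then have "real n powr x \<le> ?k powr x * (1 / (1 + x / ?k))"
    proof -
      have "real n = ?k * (1 - 1 / ?k)" by (simp add: field_simps)
      then have "real n powr x = ?k powr x * (1 - 1 / ?k) powr x"
        using k by (metis powr_mult)
      then show ?thesis using \<open>(1 - 1 / ?k) powr x \<le> 1 / (1 + x / ?k)\<close>
        by (metis mult_left_mono powr_ge_zero)
    qed
    also have "1 / (1 + x / ?k) = 1 - x / (?k + x)" using k assms by (simp add: field_simps)
    also have "?k powr x * (1 - x / (?k + x)) \<le> ?k powr x * (1 - x / ((1 + x) * ?k))"
    proof -
      have "?k + x \<le> (1 + x) * ?k" using k assms by (simp add: algebra_simps)
      then have "x / ((1 + x) * ?k) \<le> x / (?k + x)" using k assms by (intro divide_left_mono) auto
      then show ?thesis by (intro mult_left_mono) auto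
    qed
    finally have "?k powr x * (x / ((1 + x) * ?k)) \<le> ?k powr x - real n powr x"
      by (simp add: algebra_simps)
    then have "(1 + x) / x * (?k powr x * (x / ((1 + x) * ?k))) \<le> (1 + x) / x * (?k powr x - real n powr x)"
      using assms by (intro mult_left_mono) auto
    moreover have "(1 + x) / x * (?k powr x * (x / ((1 + x) * ?k))) = ?k powr x / ?k"
    proof -
      have "x \<noteq> 0" "1 + x \<noteq> 0" "?k \<noteq> 0" using assms k by auto
      then show ?thesis by (simp only: times_divide_eq_left times_divide_eq_right mult_ac) (simp add: divide_simps)
    qed
    ultimately have "?k powr (x - 1) \<le> (1 + x) / x * (?k powr x - real n powr x)"
      using k by (simp add: powr_diff)
    moreover have "{J<..Suc n} = insert (Suc n) {J<..n}" using step.hyps by auto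
    ultimately show ?case using step.IH by (simp add: right_diff_distrib)
  qed
  then show ?thesis .
next
  case False
  then show ?thesis using assms by simp
qed

lemma powr_one_minus_bounds:
  fixes t a :: real
  assumes "0 \<le> t" "t \<le> 1/2" "a \<ge> 0"
  shows "\<bar>(1 - t) powr a - (1 - a * t)\<bar> \<le> (a + a\<^sup>2) * t\<^sup>2"
proof -
  have "(1 + (- t)) powr a \<le> exp (a * (- t))" using assms by (intro powr_le_exp) auto
  also have "\<dots> \<le> 1 / (1 + a * t)" using exp_minus_le[of "a * t"] assms by simp
  also have "\<dots> \<le> 1 - a * t + (a * t)\<^sup>2" 
  proof -
    have "1 \<le> (1 - a * t + (a * t)\<^sup>2) * (1 + a * t)"
      using assms by (simp add: algebra_simps power2_eq_square)
    then show ?thesis using assms by (simp add: divide_le_eq add_pos_nonneg)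
  qed
  finally have up: "(1 - t) powr a \<le> 1 - a * t + (a * t)\<^sup>2" by simp
  have l: "ln (1 - t) \<ge> - t - t\<^sup>2"
  proof -
    have "(\<lambda>t. ln (1 - t) + t + t\<^sup>2) 0 \<le> (\<lambda>t. ln (1 - t) + t + t\<^sup>2) t"
    proof (rule DERIV_nonneg_imp_nondecreasing[OF assms(1)])
      fix x assume x: "0 \<le> x" "x \<le> t"
      have "((\<lambda>t. ln (1 - t) + t + t\<^sup>2) has_real_derivative (- 1 / (1 - x) + 1 + 2 * x)) (at x)"
        using x assms by (auto intro!: derivative_eq_intros)
      moreover have "- 1 / (1 - x) + 1 + 2 * x = x * (1 - 2 * x) / (1 - x)"
        using x assms by (simp add: field_simps)
      moreover have "\<dots> \<ge> 0" using x assms by (intro divide_nonneg_pos mult_nonneg_nonneg) auto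
      ultimately have "0 \<le> - 1 / (1 - x) + 1 + 2 * x" by simp
      then show "\<exists>y. ((\<lambda>t. ln (1 - t) + t + t\<^sup>2) has_real_derivative y) (at x) \<and> 0 \<le> y"
        using \<open>((\<lambda>t. ln (1 - t) + t + t\<^sup>2) has_real_derivative (- 1 / (1 - x) + 1 + 2 * x)) (at x)\<close> by blast
    qed
    then show ?thesis by simp
  qed
  have "1 - a * t - a * t\<^sup>2 \<le> exp (a * (- t - t\<^sup>2))"
    using exp_ge_add_one_self[of "a * (- t - t\<^sup>2)"] by (simp add: algebra_simps)
  also have "\<dots> \<le> exp (a * ln (1 - t))" using l assms by (simp add: mult_left_mono)
  also have "\<dots> = (1 - t) powr a" using assms by (simp add: powr_def)
  finally have lo: "1 - a * t - a * t\<^sup>2 \<le> (1 - t) powr a" .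
  have "a * t\<^sup>2 \<le> (a + a\<^sup>2) * t\<^sup>2" "(a * t)\<^sup>2 \<le> (a + a\<^sup>2) * t\<^sup>2"
    using assms by (auto simp: power_mult_distrib intro!: mult_right_mono)
  then show ?thesis using up lo by linarith
qed

lemma prod_shift_powr:
  fixes x a :: real
  assumes "x > 0"
  shows "(\<Prod>i<y. (1 - 1 / (x + real i + 1)) powr a) = (1 + real y / x) powr (- a)"
proof (induction y)
  case (Suc y)
  have "(1 + real y / x) powr (- a) * (1 - 1 / (x + real y + 1)) powr a =
      ((x + real y) / x) powr (- a) * ((x + real y) / (x + real y + 1)) powr a"
    using assms by (simp add: field_simps)
  also have "\<dots> = ((x + real y + 1) / x) powr (- a)"
    using assms by (simp add: powr_divide powr_minus field_simps)
  also have "(x + real y + 1) / x = 1 + real (Suc y) / x" using assms by (simp add: field_simps)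
  finally show ?case using Suc.IH by simp
qed (use assms in simp)

text \<open>
  The left product is the probability that \<open>y\<close> draws miss the red colour. Each of its factors is close to
  \<open>(1 - 1 / (x + i + 1))\<^sup>a\<close>, and the product of these telescopes.
\<close>

lemma urn_miss_prob_approx:
  fixes x w a :: real
  assumes "a > 0" "w \<ge> a" "x > 1" "w \<le> x"
  shows "\<bar>(\<Prod>i<y. 1 - a / (w + real i)) - (1 + real y / x) powr (- a)\<bar>
         \<le> real y * ((a + a\<^sup>2) / x\<^sup>2 + a * (x + 1 - w) / (w * x))"
proof -
  let ?f = "\<lambda>i. 1 - a / (w + real i)" and ?g = "\<lambda>i. (1 - 1 / (x + real i + 1)) powr a"
  have d: "\<bar>?f i - ?g i\<bar> \<le> (a + a\<^sup>2) / x\<^sup>2 + a * (x + 1 - w) / (w * x)" for i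
  proof -
    let ?t = "1 / (x + real i + 1)"
    have t: "0 \<le> ?t" "?t \<le> 1/2" "?t \<le> 1 / x" using assms by (auto simp: field_simps)
    have "\<bar>?g i - (1 - a * ?t)\<bar> \<le> (a + a\<^sup>2) * ?t\<^sup>2"
      using t assms by (intro powr_one_minus_bounds) auto
    also have "\<dots> \<le> (a + a\<^sup>2) * (1 / x)\<^sup>2" using t assms by (intro mult_left_mono power_mono) auto
    finally have 1: "\<bar>?g i - (1 - a * ?t)\<bar> \<le> (a + a\<^sup>2) / x\<^sup>2" by (simp add: power_divide)
    have "a / (w + real i) - a * ?t = a * (x + 1 - w) / ((w + real i) * (x + real i + 1))"
      using assms by (simp add: field_simps)
    moreover have "\<dots> \<le> a * (x + 1 - w) / (w * x)"
      using assms by (intro divide_left_mono mult_mono mult_pos_pos) auto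
    moreover have "0 \<le> a * (x + 1 - w) / ((w + real i) * (x + real i + 1))" using assms by simp
    ultimately have 2: "\<bar>a / (w + real i) - a * ?t\<bar> \<le> a * (x + 1 - w) / (w * x)" by linarith
    show ?thesis using 1 2 by linarith
  qed
  have "\<bar>(\<Prod>i<y. ?f i) - (\<Prod>i<y. ?g i)\<bar> \<le> (\<Sum>i<y. \<bar>?f i - ?g i\<bar>)"
  proof (rule norm_prod_diff[where 'a = real, simplified])
    fix i
    show "\<bar>?f i\<bar> \<le> 1" using assms by (auto simp: abs_le_iff field_simps)
    have "0 \<le> 1 - 1 / (x + real i + 1)" "1 - 1 / (x + real i + 1) \<le> 1" using assms by (auto simp: field_simps)
    then show "\<bar>?g i\<bar> \<le> 1" using assms powr_mono2[of a "1 - 1 / (x + real i + 1)" 1] by simp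
  qed
  also have "\<dots> \<le> (\<Sum>i<y. (a + a\<^sup>2) / x\<^sup>2 + a * (x + 1 - w) / (w * x))" by (intro sum_mono d)
  finally show ?thesis using prod_shift_powr[of x a y] assms by simp
qed

lemma powr_one_plus_approx:
  fixes B s :: real
  assumes "B \<ge> 0" "0 < s" "s \<le> 1"
  shows "\<bar>(1 + B) powr s - 1 - s * B\<bar> \<le> B\<^sup>2"
proof (cases "B = 0")
  case False
  then have B: "B > 0" using assms by simp
  have "\<exists>z>0. z < B \<and> ((1 + B) powr s - s * B) - ((1 + 0) powr s - s * 0) = (B - 0) * (s * (1 + z) powr (s - 1) - s)"
    using B by (intro MVT2) (auto intro!: derivative_eq_intros simp: powr_diff)
  then obtain z where z: "0 < z" "z < B" "(1 + B) powr s - 1 - s * B = B * (s * (1 + z) powr (s - 1) - s)" by auto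
  have u: "(1 + z) powr (s - 1) \<le> 1"
    using z assms powr_mono[of "s - 1" 0 "1 + z"] by simp
  have "(1 + z) powr (-1) \<le> (1 + z) powr (s - 1)" using z assms by (intro powr_mono) auto
  moreover have "(1 + z) powr (-1) \<ge> 1 - z" using z by (simp add: powr_minus_divide field_simps)
  ultimately have l: "(1 + z) powr (s - 1) \<ge> 1 - B" using z by linarith
  have "\<bar>s * (1 + z) powr (s - 1) - s\<bar> = s * \<bar>(1 + z) powr (s - 1) - 1\<bar>"
  proof -
    have "s * (1 + z) powr (s - 1) - s = s * ((1 + z) powr (s - 1) - 1)" by (simp add: right_diff_distrib)
    then show ?thesis using assms by (simp add: abs_mult)
  qed
  also have "\<dots> \<le> 1 * B" using u l assms by (intro mult_mono) auto
  finally have "B * \<bar>s * (1 + z) powr (s - 1) - s\<bar> \<le> B * B" using B by (intro mult_left_mono) auto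
  then show ?thesis using z B by (simp add: abs_mult power2_eq_square)
qed simp

lemma powr_neg_le_1: "x \<ge> 1 \<Longrightarrow> p \<le> 0 \<Longrightarrow> x powr p \<le> 1" for x p :: real
  using powr_mono[of p 0 x] by simp

lemma less_nat_floor_iff: "i < nat \<lfloor>x\<rfloor> \<longleftrightarrow> real (Suc i) \<le> x"
proof -
  have "i < nat \<lfloor>x\<rfloor> \<longleftrightarrow> int i < \<lfloor>x\<rfloor>" by linarith
  also have "\<dots> \<longleftrightarrow> real (Suc i) \<le> x" by (simp add: less_floor_iff add.commute)
  finally show ?thesis .
qed

text \<open>
  A form of Young's inequality that avoids conjugate exponents: distinguish whether \<open>y \<le> \<tau> x\<close>.
\<close>

lemma young_power:
  fixes x y \<tau> :: real
  assumes "x \<ge> 0" "y \<ge> 0" "\<tau> > 0" "q \<ge> 1"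
  shows "x ^ (q - 1) * y \<le> \<tau> * x ^ q + (1 / \<tau>) ^ (q - 1) * y ^ q"
proof (cases "y \<le> \<tau> * x")
  case True
  then have "x ^ (q - 1) * y \<le> x ^ (q - 1) * (\<tau> * x)" using assms by (intro mult_left_mono) auto
  also have "\<dots> = \<tau> * x ^ q" using assms by (cases q) auto
  finally show ?thesis using assms by (simp add: add_increasing2)
next
  case False
  then have "x \<le> 1 / \<tau> * y" using assms by (simp add: field_simps)
  then have "x ^ (q - 1) * y \<le> (1 / \<tau> * y) ^ (q - 1) * y" using assms by (intro mult_right_mono power_mono) auto
  also have "\<dots> = (1 / \<tau>) ^ (q - 1) * y ^ q" using assms unfolding power_mult_distrib by (cases q) auto
  finally show ?thesis using assms by (simp add: add_increasing)
qed

section \<open>The fluid limit of the chain\<close>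

text \<open>
  The limiting probability that at least one of \<open>u \<theta> k\<close> edges hits vertex \<open>k\<close>: the weight of \<open>k\<close> in the
  urn is asymptotically Gamma distributed with shape \<open>a\<close>, and \<open>(1 + u)\<^bsup>-a\<^esup>\<close> is its Laplace transform.
\<close>

definition hit_fun :: "real \<Rightarrow> real \<Rightarrow> real" where
  "hit_fun a u = 1 - (1 + u) powr (- a)"

lemma hit_fun_Lipschitz:
  assumes "a > 0" "0 \<le> u" "u \<le> v"
  shows "0 \<le> hit_fun a v - hit_fun a u" "hit_fun a v - hit_fun a u \<le> a * (v - u)"
proof -
  have "hit_fun a v - hit_fun a u \<ge> 0 \<and> hit_fun a v - hit_fun a u \<le> a * (v - u)"
  proof (cases "u = v")
    case False
    have "\<exists>z>u. z < v \<and> hit_fun a v - hit_fun a u = (v - u) * (a * (1 + z) powr (- a - 1))"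
      unfolding hit_fun_def using assms False
      by (intro MVT2) (auto intro!: derivative_eq_intros simp: powr_diff)
    then obtain z where z: "u < z" "z < v" "hit_fun a v - hit_fun a u = (v - u) * (a * (1 + z) powr (- a
        - 1))" by auto
    have "(1 + z) powr (- a - 1) \<le> 1" using z assms powr_mono[of "- a - 1" 0 "1 + z"] by simp
    then have "(v - u) * (a * (1 + z) powr (- a - 1)) \<le> (v - u) * (a * 1)"
      using assms by (intro mult_left_mono) auto
    then show ?thesis using z assms by (simp add: mult.commute)
  qed simp
  then show "0 \<le> hit_fun a v - hit_fun a u" "hit_fun a v - hit_fun a u \<le> a * (v - u)" by auto
qed

lemma hit_fun_Lipschitz_abs:
  assumes "a > 0" "0 \<le> u" "0 \<le> v"
  shows "\<bar>hit_fun a v - hit_fun a u\<bar> \<le> a * \<bar>v - u\<bar>"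
  using hit_fun_Lipschitz[of a u v] hit_fun_Lipschitz[of a v u] assms by (cases "u \<le> v") auto

lemma hit_fun_bounds:
  assumes "a > 0" "0 \<le> u"
  shows "0 \<le> hit_fun a u" "hit_fun a u \<le> 1" "hit_fun a u \<le> a * u"
  using hit_fun_Lipschitz[of a 0 u] assms by (auto simp: hit_fun_def)

text \<open>
  The expected number of edges after revealing a vertex, to leading order, where \<open>x = \<theta> k\<close>: each of the \<open>y\<close>
  edges is lost with probability \<open>a / x\<close>, and \<open>m\<close> edges are gained if the vertex is hit.
\<close>

definition drift_map :: "real \<Rightarrow> real \<Rightarrow> real \<Rightarrow> real \<Rightarrow> real" where
  "drift_map a m x y = y - a * y / x + m * hit_fun a (y / x)"

lemma drift_map_Lipschitz:
  assumes "a > 0" "m \<ge> 1" "x \<ge> a" "y \<ge> 0" "y' \<ge> 0"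
  shows "\<bar>drift_map a m x y - drift_map a m x y'\<bar> \<le> (1 + (m - 1) * a / x) * \<bar>y - y'\<bar>"
proof -
  have *: "\<bar>drift_map a m x v - drift_map a m x u\<bar> \<le> (1 + (m - 1) * a / x) * \<bar>v - u\<bar>"
    if "0 \<le> u" "u \<le> v" for u v
  proof -
    have x: "x > 0" using assms by simp
    have "a * (v / x - u / x) = a * (v - u) / x" by (simp add: diff_divide_distrib right_diff_distrib)
    then have d: "0 \<le> hit_fun a (v / x) - hit_fun a (u / x)" "hit_fun a (v / x) - hit_fun a (u / x) \<le> a * (v - u) / x"
      using hit_fun_Lipschitz[of a "u / x" "v / x"] assms(1) that x by (simp_all add: divide_right_mono)
    have "drift_map a m x v - drift_map a m x u = (1 - a / x) * (v - u) + m * (hit_fun a (v / x) - hit_fun a (u / x))"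
      using x by (simp add: drift_map_def field_simps)
    moreover have "0 \<le> (1 - a / x) * (v - u)" using assms that x by (intro mult_nonneg_nonneg) auto
    moreover have "0 \<le> m * (hit_fun a (v / x) - hit_fun a (u / x))" using d assms by simp
    moreover have "m * (hit_fun a (v / x) - hit_fun a (u / x)) \<le> m * (a * (v - u) / x)"
      using d assms by (intro mult_left_mono) auto
    moreover have "(1 - a / x) * (v - u) + m * (a * (v - u) / x) = (1 + (m - 1) * a / x) * (v - u)"
      using x by (simp add: field_simps)
    ultimately show ?thesis using that by linarith
  qed
  show ?thesis
  proof (cases "y \<le> y'")
    case True
    then show ?thesis using *[of y y'] assms by (simp add: abs_minus_commute)
  next
    case False
    then show ?thesis using *[of y' y] assms by simp
  qed
qed

text \<open>
  The solution \<open>u\<close> of the flow as a function of \<open>x = k\<close>: the quantity \<open>x\<^sup>r ((1 + u)\<^bsup>a+1\<^esup> - 1)\<close> has the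
  constant value \<open>A\<close>.
\<close>

definition profile :: "real \<Rightarrow> real \<Rightarrow> real \<Rightarrow> real \<Rightarrow> real" where
  "profile a r A x = (1 + A * x powr (- r)) powr (1 / (a + 1)) - 1"

lemma hit_fun_profile:
  assumes "a > 0" "A \<ge> 0"
  shows "hit_fun a (profile a r A x) = hit_fun (a / (a + 1)) (A * x powr (- r))"
  using assms by (simp add: hit_fun_def profile_def powr_powr)

lemma profile_bounds:
  assumes "a > 0" "A \<ge> 0"
  shows "0 \<le> profile a r A x" "profile a r A x \<le> A * x powr (- r)"
proof -
  let ?B = "A * x powr (- r)"
  have B: "?B \<ge> 0" using assms by simp
  show "0 \<le> profile a r A x" using B assms ge_one_powr_ge_zero[of "1 + ?B" "1 / (a + 1)"] by (simp add: profile_def)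
  have "(1 + ?B) powr (1 / (a + 1)) \<le> (1 + ?B) powr 1"
    using B assms by (intro powr_mono) auto
  then show "profile a r A x \<le> ?B" using B by (simp add: profile_def)
qed

text \<open>
  The exponent \<open>r\<close> is the one for which \<open>profile\<close> solves the flow of \<open>drift_map\<close>.
\<close>

locale fluid =
  fixes a m \<theta> r :: real
  assumes a_pos: "a > 0" and m_ge_1: "m \<ge> 1" and \<theta>_def: "\<theta> = a + m" and r_def: "r = m * (a + 1) / \<theta>"
begin

lemma \<theta>_pos: "\<theta> > 0" using a_pos m_ge_1 \<theta>_def by simp

lemma r_gt_0: "r > 0" using a_pos m_ge_1 \<theta>_pos by (simp add: r_def)

lemma profile_deriv:
  assumes "x > 0" "A \<ge> 0"
  shows "(profile a r A has_real_derivative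
     - (m / \<theta>) * (A * x powr (- r - 1)) * (1 + A * x powr (- r)) powr (- (a / (a + 1)))) (at x)"
proof -
  have B: "1 + A * x powr (- r) > 0" using assms by (simp add: add_pos_nonneg)
  have "(profile a r A has_real_derivative
     (1 / (a + 1)) * (1 + A * x powr (- r)) powr (1 / (a + 1) - 1) * (A * ((- r) * x powr (- r - 1)))) (at x)"
    unfolding profile_def[abs_def] using assms B
    by (auto intro!: derivative_eq_intros simp: powr_diff)
  moreover have e1: "1 / (a + 1) - 1 = - (a / (a + 1))" using a_pos by (simp add: field_simps)
  have e2: "m / \<theta> = r / (a + 1)" 
    using a_pos unfolding r_def by (simp add: divide_divide_eq_left mult_divide_mult_cancel_right del:
        distrib_left distrib_right)
  ultimately show ?thesis
    unfolding e2 by (simp only: e1) (erule DERIV_cong, simp add: mult_ac)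
qed

text \<open>
  The number of edges \<open>\<theta> x u\<close> along the flow, differentiated in \<open>x\<close>. As \<open>x\<close> decreases by one, the change is
  the increment of \<open>drift_map\<close>.
\<close>

lemma scaled_profile_deriv:
  assumes "x > 0" "A \<ge> 0"
  shows "((\<lambda>x. \<theta> * x * profile a r A x) has_real_derivative
     a * profile a r A x - m * hit_fun a (profile a r A x)) (at x)"
proof -
  let ?B = "A * x powr (- r)" and ?c = "a / (a + 1)"
  have B: "1 + ?B > 0" using assms by (simp add: add_pos_nonneg)
  have "((\<lambda>x. \<theta> * x * profile a r A x) has_real_derivative
     \<theta> * profile a r A x + \<theta> * x * (- (m / \<theta>) * (A * x powr (- r - 1)) * (1 + ?B) powr (- ?c))) (at x)"
    by (rule derivative_eq_intros profile_deriv[OF assms] refl)+ (simp add: algebra_simps)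
  moreover have "\<theta> * x * (- (m / \<theta>) * (A * x powr (- r - 1)) * (1 + ?B) powr (- ?c)) = - m * (?B * (1 +
      ?B) powr (- ?c))"
    using assms \<theta>_pos by (simp add: powr_diff)
  moreover have "?B * (1 + ?B) powr (- ?c) = (1 + ?B) powr (1 / (a + 1)) - (1 + ?B) powr (- ?c)"
  proof -
    have "1 / (a + 1) = 1 + - ?c" using a_pos by (simp add: field_simps)
    then have "(1 + ?B) powr (1 / (a + 1)) = (1 + ?B) * (1 + ?B) powr (- ?c)"
      using B by (simp only: powr_add powr_one)
    then show ?thesis by (simp add: algebra_simps)
  qed
  moreover have "hit_fun a (profile a r A x) = 1 - (1 + ?B) powr (- ?c)"
    using hit_fun_profile[OF a_pos assms(2)] by (simp add: hit_fun_def)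
  moreover have "(1 + ?B) powr (1 / (a + 1)) = profile a r A x + 1" by (simp add: profile_def)
  ultimately show ?thesis
    by (simp only: \<theta>_def) (erule DERIV_cong, simp add: algebra_simps)
qed

lemma profile_diff:
  assumes "k \<ge> 2" "A \<ge> 0" "k - 1 \<le> x" "x \<le> k"
  shows "\<bar>profile a r A x - profile a r A k\<bar> \<le> (m / \<theta>) * 2 powr (r + 1) * (A * k powr (- r - 1))"
proof (cases "x = k")
  case True
  then show ?thesis using assms a_pos \<theta>_pos m_ge_1 by simp
next
  case False
  then have xk: "x < k" "x > 0" using assms by auto
  have "\<exists>z>x. z < k \<and> profile a r A k - profile a r A x =
      (k - x) * (- (m / \<theta>) * (A * z powr (- r - 1)) * (1 + A * z powr (- r)) powr (- (a / (a + 1))))"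
    using xk by (intro MVT2 profile_deriv) (auto simp: assms)
  then obtain z where z: "x < z" "z < k" "profile a r A k - profile a r A x =
      (k - x) * (- (m / \<theta>) * (A * z powr (- r - 1)) * (1 + A * z powr (- r)) powr (- (a / (a + 1))))"
    by blast
  have "(1 + A * z powr (- r)) powr (- (a / (a + 1))) \<le> 1"
    using assms a_pos by (intro powr_neg_le_1) auto
  moreover have "z powr (- r - 1) \<le> 2 powr (r + 1) * k powr (- r - 1)"
  proof -
    have "z powr (- r - 1) \<le> (k / 2) powr (- r - 1)"
      using z assms r_gt_0 by (intro powr_mono2') auto
    also have "\<dots> = 2 powr (r + 1) * k powr (- r - 1)"
    proof -
      have "2 powr (- r - 1) = 1 / (2 :: real) powr (r + 1)" using powr_minus_divide[of 2 "r + 1"] by simp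
      then show ?thesis using assms by (simp add: powr_divide)
    qed
    finally show ?thesis .
  qed
  ultimately have "(k - x) * ((m / \<theta>) * (A * z powr (- r - 1)) * (1 + A * z powr (- r)) powr (- (a / (a + 1))))
     \<le> 1 * ((m / \<theta>) * (A * (2 powr (r + 1) * k powr (- r - 1))) * 1)"
    using assms m_ge_1 \<theta>_pos by (intro mult_mono mult_nonneg_nonneg) auto
  moreover have "0 \<le> (k - x) * ((m / \<theta>) * (A * z powr (- r - 1)) * (1 + A * z powr (- r)) powr (- (a / (a + 1))))"
    using assms m_ge_1 \<theta>_pos by simp
  ultimately show ?thesis using z(3) by (simp add: mult_ac)
qed

text \<open>
  One step of \<open>drift_map\<close> evaluates the increment at \<open>k\<close>, whereas the mean value theorem evaluates it at some point
  of \<open>(k - 1, k)\<close>. The difference is of order \<open>k\<^bsup>-r-1\<^esup>\<close> and therefore, after multiplication by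
  \<open>k\<^bsup>r-1\<^esup>\<close>, summable.
\<close>

lemma profile_consistency:
  assumes "k \<ge> 2" "A \<ge> 0"
  shows "\<bar>drift_map a m (\<theta> * k) (\<theta> * k * profile a r A k) - \<theta> * (k - 1) * profile a r A (k - 1)\<bar>
     \<le> (a + m * a) * ((m / \<theta>) * 2 powr (r + 1) * (A * k powr (- r - 1)))"
proof -
  let ?u = "profile a r A"
  have "\<exists>z>k - 1. z < k \<and> \<theta> * k * ?u k - \<theta> * (k - 1) * ?u (k - 1) = (k - (k - 1)) * (a * ?u z - m * hit_fun a (?u z))"
    using assms scaled_profile_deriv by (intro MVT2) auto
  then obtain z where z: "k - 1 < z" "z < k" "\<theta> * k * ?u k - \<theta> * (k - 1) * ?u (k - 1) = a * ?u z - m *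
      hit_fun a (?u z)"
    by auto
  define d where "d = (m / \<theta>) * 2 powr (r + 1) * (A * k powr (- r - 1))"
  have d: "\<bar>?u z - ?u k\<bar> \<le> d" unfolding d_def using profile_diff[of k A z] assms z by simp
  have u0: "0 \<le> ?u x" for x using profile_bounds(1)[OF a_pos assms(2)] .
  have "drift_map a m (\<theta> * k) (\<theta> * k * ?u k) = \<theta> * k * ?u k - a * ?u k + m * hit_fun a (?u k)"
    using \<theta>_pos assms by (simp add: drift_map_def)
  then have "drift_map a m (\<theta> * k) (\<theta> * k * ?u k) - \<theta> * (k - 1) * ?u (k - 1) =
     a * (?u z - ?u k) + m * (hit_fun a (?u k) - hit_fun a (?u z))"
    using z(3) by (simp add: algebra_simps)
  also have "\<bar>\<dots>\<bar> \<le> a * \<bar>?u z - ?u k\<bar> + m * \<bar>hit_fun a (?u k) - hit_fun a (?u z)\<bar>"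
    using a_pos m_ge_1 by (intro order_trans[OF abs_triangle_ineq]) (simp add: abs_mult)
  also have "\<dots> \<le> a * d + m * (a * d)"
  proof -
    have "\<bar>hit_fun a (?u k) - hit_fun a (?u z)\<bar> \<le> a * \<bar>?u k - ?u z\<bar>"
      using hit_fun_Lipschitz_abs[OF a_pos u0 u0] .
    also have "\<dots> \<le> a * d" using d a_pos by (simp add: abs_minus_commute)
    finally show ?thesis using d a_pos m_ge_1 by (intro add_mono mult_left_mono) auto
  qed
  finally show ?thesis unfolding d_def[symmetric] by (simp only: distrib_right mult.assoc)
qed

end

text \<open>
  Let \<open>V\<close> have the distribution function \<open>v\<^sup>c\<close> on \<open>[0, 1]\<close>. Then \<open>hit_fun c (A k\<^bsup>-r\<^esup>)\<close> is the probability
  that \<open>V\<close> exceeds the threshold on the left, so by this equivalence it is the probability that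
  \<open>Z = A\<^bsup>1/r\<^esup> (V / (1 - V))\<^bsup>1/r\<^esup>\<close> is at least \<open>k\<close>.
\<close>

lemma fluid_threshold:
  fixes A r v :: real
  assumes "A > 0" "r > 0" "0 < v" "v < 1"
  shows "1 / (1 + A * real (Suc i) powr (- r)) \<le> v \<longleftrightarrow> real (Suc i) \<le> A powr (1 / r) * (v / (1 - v)) powr (1 / r)"
proof -
  let ?k = "real (Suc i)"
  have k: "?k > 0" by simp
  have "1 / (1 + A * ?k powr (- r)) \<le> v \<longleftrightarrow> 1 \<le> v * (1 + A * ?k powr (- r))"
    using assms by (simp add: divide_le_eq add_pos_pos)
  also have "\<dots> \<longleftrightarrow> 1 - v \<le> v * A * ?k powr (- r)" by (simp add: algebra_simps)
  also have "\<dots> \<longleftrightarrow> (1 - v) * ?k powr r \<le> v * A"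
    using k by (simp add: powr_minus_divide pos_le_divide_eq)
  also have "\<dots> \<longleftrightarrow> ?k powr r \<le> A * (v / (1 - v))"
    using assms by (simp add: pos_le_divide_eq mult_ac)
  also have "\<dots> \<longleftrightarrow> ?k \<le> (A * (v / (1 - v))) powr (1 / r)"
  proof
    assume "?k powr r \<le> A * (v / (1 - v))"
    then have "(?k powr r) powr (1 / r) \<le> (A * (v / (1 - v))) powr (1 / r)"
      using assms by (intro powr_mono2) auto
    then show "?k \<le> (A * (v / (1 - v))) powr (1 / r)" using assms k by (simp add: powr_powr)
  next
    assume "?k \<le> (A * (v / (1 - v))) powr (1 / r)"
    then have "?k powr r \<le> ((A * (v / (1 - v))) powr (1 / r)) powr r"
      using assms k by (intro powr_mono2) auto
    then show "?k powr r \<le> A * (v / (1 - v))" using assms by (simp add: powr_powr)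
  qed
  moreover have "A powr (1 / r) * (v / (1 - v)) powr (1 / r) = (A * (v / (1 - v))) powr (1 / r)"
    using assms by (simp only: powr_mult)
  ultimately show ?thesis by (simp only:)
qed

lemma nn_integral_powr_density:
  fixes c t :: real
  assumes "c > 0" "0 < t" "t \<le> 1"
  shows "(\<integral>\<^sup>+v. ennreal (c * v powr (c - 1)) * indicator {t..1} v \<partial>lborel) = ennreal (1 - t powr c)"
proof -
  have "(\<integral>\<^sup>+v. ennreal (c * v powr (c - 1)) * indicator {t..1} v \<partial>lborel) = ennreal (1 powr c - t powr c)"
  proof (rule nn_integral_FTC_Icc[where F = "\<lambda>v. v powr c"])
    fix v assume "v \<in> {t..1}"
    then show "((\<lambda>v. v powr c) has_real_derivative c * v powr (c - 1)) (at v)"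
      using assms by (auto intro!: derivative_eq_intros simp: powr_diff)
  qed (use assms in auto)
  then show ?thesis by simp
qed

lemma nn_integral_powr_density_0:
  fixes c :: real
  assumes "c > 0"
  shows "(\<integral>\<^sup>+v. ennreal (c * v powr (c - 1)) * indicator {0<..<1} v \<partial>lborel) \<le> 1"
proof -
  have "((\<lambda>v. v powr (c - 1) * (1 - v) powr (1 - 1)) has_integral Beta c 1) {0..1}"
    using has_integral_Beta_real[of c 1] assms by simp
  then have "((\<lambda>v. c * (v powr (c - 1) * (1 - v) powr (1 - 1))) has_integral c * Beta c 1) {0..1}"
    by (rule has_integral_mult_right)
  then have "(\<integral>\<^sup>+v. ennreal (indicator {0..1} v * (c * (v powr (c - 1) * (1 - v) powr (1 - 1))))
      \<partial>lborel) = ennreal (c * Beta c 1)"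
    using assms by (intro nn_integral_has_integral_lebesgue) auto
  moreover have "c * Beta c 1 = 1"
    using assms Gamma_plus1_pos[of c] Gamma_real_pos[of c] by (simp add: Beta_def del: Gamma_real_pos)
  ultimately have "(\<integral>\<^sup>+v. ennreal (indicator {0..1} v * (c * (v powr (c - 1) * (1 - v) powr (1 - 1)))) \<partial>lborel) = 1"
    by (simp only: ennreal_1)
  moreover have "(\<integral>\<^sup>+v. ennreal (c * v powr (c - 1)) * indicator {0<..<1} v \<partial>lborel) \<le>
      (\<integral>\<^sup>+v. ennreal (indicator {0..1} v * (c * (v powr (c - 1) * (1 - v) powr (1 - 1)))) \<partial>lborel)"
    by (intro nn_integral_mono) (auto simp: indicator_def)
  ultimately show ?thesis by simp
qed

text \<open>
  The expectation of \<open>(V / (1 - V))\<^sup>s\<close> for the variable \<open>V\<close> with distribution function \<open>v\<^sup>c\<close>; it is a Beta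
  integral. This is the source of the Gamma functions in the leading constant.
\<close>

lemma nn_integral_ratio_powr:
  fixes c s :: real
  assumes "c > 0" "0 < s" "s < 1"
  shows "(\<integral>\<^sup>+v. ennreal ((v / (1 - v)) powr s * (c * v powr (c - 1))) * indicator {0<..<1} v \<partial>lborel)
    = ennreal (Gamma (1 - s) * Gamma (c + s) / Gamma c)"
proof -
  let ?f = "\<lambda>v. c * (v powr (c + s - 1) * (1 - v) powr (1 - s - 1))"
  have "((\<lambda>v. v powr (c + s - 1) * (1 - v) powr (1 - s - 1)) has_integral Beta (c + s) (1 - s)) {0..1}"
    using has_integral_Beta_real[of "c + s" "1 - s"] assms by simp
  then have "(?f has_integral c * Beta (c + s) (1 - s)) {0..1}"
    by (rule has_integral_mult_right)
  then have "(\<integral>\<^sup>+v. ennreal (indicator {0..1} v * ?f v) \<partial>lborel) = ennreal (c * Beta (c + s) (1 - s))"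
    using assms by (intro nn_integral_has_integral_lebesgue) auto
  moreover have "c * Beta (c + s) (1 - s) = Gamma (1 - s) * Gamma (c + s) / Gamma c"
    using assms Gamma_plus1_pos[of c] by (simp add: Beta_def field_simps)
  moreover have "(\<integral>\<^sup>+v. ennreal (indicator {0..1} v * ?f v) \<partial>lborel) =
      (\<integral>\<^sup>+v. ennreal ((v / (1 - v)) powr s * (c * v powr (c - 1))) * indicator {0<..<1} v \<partial>lborel)"
  proof (rule nn_integral_cong_AE)
    have "AE v in lborel. v \<noteq> (0::real) \<and> v \<noteq> 1"
      using AE_lborel_singleton[of 0] AE_lborel_singleton[of 1] by (auto elim!: eventually_elim2)
    then show "AE v in lborel. ennreal (indicator {0..1} v * ?f v) =
       ennreal ((v / (1 - v)) powr s * (c * v powr (c - 1))) * indicator {0<..<1} v"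
    proof eventually_elim
      case (elim v)
      show ?case
      proof (cases "0 < v \<and> v < 1")
        case True
        have "(v / (1 - v)) powr s * (c * v powr (c - 1)) = ?f v"
        proof -
          have "v powr (c + s - 1) = v powr s * v powr (c - 1)" using True by (simp flip: powr_add add: algebra_simps)
          moreover have "(1 - v) powr (1 - s - 1) = 1 / (1 - v) powr s" using powr_minus_divide[of "1 - v" s] by simp
          moreover have "(v / (1 - v)) powr s = v powr s / (1 - v) powr s" using True by (simp add: powr_divide)
          ultimately show ?thesis by (simp only: times_divide_eq_left times_divide_eq_right mult_ac mult_1_right)
        qed
        moreover have "indicator {0..1} v = (1::real)" "indicator {0<..<1} v = (1::ennreal)" using True by auto
        ultimately show ?thesis by (simp only: mult_1 mult_1_right)
      qed (use elim in \<open>auto simp: indicator_def\<close>)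
    qed
  qed
  ultimately show ?thesis by simp
qed

text \<open>
  By \<open>fluid_threshold\<close> the sum over all \<open>k \<ge> 1\<close> is the expectation of the integer part of \<open>Z\<close>, which differs from
  the expectation of \<open>Z\<close> by at most \<open>1\<close>; the last term on the right bounds the tail \<open>k > K\<close>.
\<close>

lemma sum_hit_fun_riemann:
  fixes A c r :: real
  assumes A: "A > 0" and c: "c > 0" and r: "r > 1" and K: "K \<ge> 1"
  shows "\<bar>(\<Sum>k\<in>{0<..K}. hit_fun c (A * real k powr (- r))) - Gamma (1 - 1 / r) * Gamma (c + 1 / r) /
      Gamma c * A powr (1 / r)\<bar>
     \<le> 1 + c * A / (r - 1) * real K powr (- (r - 1))"
proof -
  define C where "C = Gamma (1 - 1 / r) * Gamma (c + 1 / r) / Gamma c"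
  have C0: "C \<ge> 0" unfolding C_def using c r by (intro divide_nonneg_pos mult_nonneg_nonneg less_imp_le
      Gamma_real_pos) (auto simp: add_pos_pos)
  \<comment> \<open>\<open>z\<close> is the variable \<open>Z\<close> as a function of \<open>v\<close>, \<open>g\<close> the density of \<open>V\<close>, and vertex \<open>i + 1\<close> has threshold \<open>t i\<close>\<close>
  define t where "t = (\<lambda>i. 1 / (1 + A * real (Suc i) powr (- r)))"
  define f where "f = (\<lambda>i. hit_fun c (A * real (Suc i) powr (- r)))"
  define g where "g = (\<lambda>v. ennreal (c * v powr (c - 1)))"
  define z where "z = (\<lambda>v. A powr (1 / r) * (v / (1 - v)) powr (1 / r))"
  have t: "0 < t i" "t i \<le> 1" for i
    using A by (auto simp: t_def add_pos_nonneg divide_le_eq)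
  have f0: "0 \<le> f i" for i unfolding f_def using hit_fun_bounds(1)[OF c] A by simp
  have f_eq: "ennreal (f i) = (\<integral>\<^sup>+v. g v * indicator {t i..1} v \<partial>lborel)" for i
  proof -
    have "t i powr c = (1 + A * real (Suc i) powr (- r)) powr (- c)"
      using A unfolding t_def by (simp add: powr_divide powr_minus_divide add_pos_nonneg)
    then have "f i = 1 - t i powr c" by (simp only: f_def hit_fun_def)
    then show ?thesis unfolding g_def by (simp only: nn_integral_powr_density[OF c t])
  qed
  have [measurable]: "g \<in> borel_measurable borel" unfolding g_def by measurable
  have meas: "(\<lambda>v. g v * indicator {t i..1} v) \<in> borel_measurable lborel" for i by measurable
  have zint: "(\<integral>\<^sup>+v. ennreal (z v) * g v * indicator {0<..<1} v \<partial>lborel) = ennreal (C * A powr (1 / r))"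
  proof -
    have "(\<integral>\<^sup>+v. ennreal (z v) * g v * indicator {0<..<1} v \<partial>lborel) =
      (\<integral>\<^sup>+v. ennreal (A powr (1 / r)) * (ennreal ((v / (1 - v)) powr (1 / r) * (c * v powr (c - 1))) *
          indicator {0<..<1} v) \<partial>lborel)"
      using c by (intro nn_integral_cong) (simp add: z_def g_def ennreal_mult'' mult_ac)
    also have "\<dots> = ennreal (A powr (1 / r)) * ennreal C"
      unfolding C_def using c r by (subst nn_integral_cmult) (auto simp: nn_integral_ratio_powr)
    finally show ?thesis using C0 by (simp add: ennreal_mult mult.commute)
  qed
  have AE1: "AE v in lborel. v \<noteq> (1::real)" by (rule AE_lborel_singleton)
  have thr: "t i \<le> v \<longleftrightarrow> real (Suc i) \<le> z v" if "0 < v" "v < 1" for i v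
    unfolding t_def z_def using fluid_threshold[of A r v i] A r that by simp
  have upper: "(\<Sum>i<K. f i) \<le> C * A powr (1 / r)"
  proof -
    have "ennreal (\<Sum>i<K. f i) = (\<Sum>i<K. ennreal (f i))" using f0 by (simp add: sum_ennreal)
    also have "\<dots> = (\<integral>\<^sup>+v. (\<Sum>i<K. g v * indicator {t i..1} v) \<partial>lborel)"
      unfolding f_eq by (rule nn_integral_sum[symmetric]) measurable
    also have "\<dots> \<le> (\<integral>\<^sup>+v. ennreal (z v) * g v * indicator {0<..<1} v \<partial>lborel)"
    proof (rule nn_integral_mono_AE)
      show "AE v in lborel. (\<Sum>i<K. g v * indicator {t i..1} v) \<le> ennreal (z v) * g v * indicator {0<..<1} v"
        using AE1
      proof eventually_elim
        case (elim v)
        show ?case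
        proof (cases "0 < v \<and> v < 1")
          case True
          have z0: "z v \<ge> 0" by (simp add: z_def)
          have "(\<Sum>i<K. indicator {t i..1} v) = (\<Sum>i<K. if real (Suc i) \<le> z v then 1 else (0::real))"
            using True thr by (intro sum.cong refl) (auto simp: indicator_def)
          also have "\<dots> = real (card {i \<in> {..<K}. real (Suc i) \<le> z v})"
            by (simp add: sum.If_cases Collect_conj_eq Int_commute lessThan_def)
          also have "{i \<in> {..<K}. real (Suc i) \<le> z v} \<subseteq> {..<nat \<lfloor>z v\<rfloor>}"
            by (auto simp: less_nat_floor_iff)
          then have "real (card {i \<in> {..<K}. real (Suc i) \<le> z v}) \<le> real (nat \<lfloor>z v\<rfloor>)"
            using card_mono[of "{..<nat \<lfloor>z v\<rfloor>}"] by fastforce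
          also have "\<dots> \<le> z v" using z0 by simp
          finally have "(\<Sum>i<K. indicator {t i..1} v) \<le> z v" .
          then have "ennreal (\<Sum>i<K. indicator {t i..1} v) * g v \<le> ennreal (z v) * g v"
            by (intro mult_right_mono ennreal_leI) auto
          moreover have "ennreal (\<Sum>i<K. indicator {t i..1} v) = (\<Sum>i<K. indicator {t i..1} v)"
            by (subst sum_ennreal[symmetric]) (auto simp: ennreal_indicator)
          ultimately have "(\<Sum>i<K. indicator {t i..1} v) * g v \<le> ennreal (z v) * g v" by (simp only:)
          then have "(\<Sum>i<K. g v * indicator {t i..1} v) \<le> ennreal (z v) * g v"
            by (simp only: sum_distrib_right mult.commute[of "g v"])
          then show ?thesis using True by (simp only: indicator_simps greaterThanLessThan_iff simp_thms mult_1_right)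
        next
          case False
          then have "v \<notin> {t i..1}" for i using elim t[of i] by auto
          then show ?thesis by simp
        qed
      qed
    qed
    finally show ?thesis unfolding zint using C0 by simp
  qed
  have tail: "(\<Sum>i<M. f i) \<le> (\<Sum>i<K. f i) + c * A / (r - 1) * real K powr (- (r - 1))" for M
  proof (cases "M \<le> K")
    case True
    then have "(\<Sum>i<M. f i) \<le> (\<Sum>i<K. f i)" using f0 by (intro sum_mono2) auto
    moreover have "0 \<le> c * A / (r - 1) * real K powr (- (r - 1))" using c A r by simp
    ultimately show ?thesis by linarith
  next
    case False
    then have "{..<M} = {..<K} \<union> {K..<M}" by auto
    then have "(\<Sum>i<M. f i) = (\<Sum>i<K. f i) + (\<Sum>i\<in>{K..<M}. f i)"
      by (simp add: sum.union_disjoint ivl_disj_int)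
    also have "(\<Sum>i\<in>{K..<M}. f i) = (\<Sum>k\<in>{K<..M}. hit_fun c (A * real k powr (- r)))"
      unfolding f_def by (rule sum.reindex_bij_witness[of _ "\<lambda>k. k - 1" Suc]) auto
    also have "\<dots> \<le> (\<Sum>k\<in>{K<..M}. c * A * real k powr (- 1 - (r - 1)))"
      using hit_fun_bounds(3)[OF c] A by (intro sum_mono) (simp add: mult.assoc)
    also have "\<dots> = c * A * (\<Sum>k\<in>{K<..M}. real k powr (- 1 - (r - 1)))" by (simp add: sum_distrib_left)
    also have "\<dots> \<le> c * A * (real K powr (- (r - 1)) / (r - 1))"
      using c A r K by (intro mult_left_mono sum_powr_tail_le) auto
    finally show ?thesis by simp
  qed
  define S where "S = (\<Sum>i<K. f i) + c * A / (r - 1) * real K powr (- (r - 1))"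
  have S0: "S \<ge> 0" unfolding S_def using f0 c A r by (intro add_nonneg_nonneg sum_nonneg) auto
  have "ennreal (C * A powr (1 / r)) \<le> (\<integral>\<^sup>+v. g v * indicator {0<..<1} v + (\<Sum>i. g v * indicator {t i..1} v) \<partial>lborel)"
    unfolding zint[symmetric]
  proof (rule nn_integral_mono)
    fix v :: real
    show "ennreal (z v) * g v * indicator {0<..<1} v \<le> g v * indicator {0<..<1} v + (\<Sum>i. g v * indicator {t i..1} v)"
    proof (cases "0 < v \<and> v < 1")
      case True
      have z0: "z v \<ge> 0" by (simp add: z_def)
      let ?n = "nat \<lfloor>z v\<rfloor>"
      have "z v \<le> 1 + real ?n" using z0 by linarith
      then have "ennreal (z v) * g v \<le> ennreal (1 + real ?n) * g v" by (intro mult_right_mono ennreal_leI) auto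
      also have "\<dots> = g v + (\<Sum>i<?n. g v)" by (simp add: ennreal_plus distrib_right ennreal_of_nat_eq_real_of_nat)
      also have "(\<Sum>i<?n. g v) = (\<Sum>i<?n. g v * indicator {t i..1} v)"
      proof (intro sum.cong refl)
        fix i assume "i \<in> {..<?n}"
        then have "real (Suc i) \<le> z v" by (simp only: lessThan_iff less_nat_floor_iff)
        then show "g v = g v * indicator {t i..1} v" using thr True by simp
      qed
      also have "\<dots> \<le> (\<Sum>i. g v * indicator {t i..1} v)" by (rule sum_le_suminf) auto
      finally show ?thesis using True by (simp add: add_left_mono)
    qed simp
  qed
  also have "\<dots> = (\<integral>\<^sup>+v. g v * indicator {0<..<1} v \<partial>lborel) + (\<integral>\<^sup>+v. (\<Sum>i. g v * indicator {t i..1} v) \<partial>lborel)"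
    by (rule nn_integral_add) measurable
  also have "\<dots> \<le> 1 + (\<Sum>i. ennreal (f i))"
    using nn_integral_powr_density_0[OF c] unfolding f_eq g_def[symmetric]
    by (subst nn_integral_suminf) (auto intro!: add_mono simp: g_def)
  also have "(\<Sum>i. ennreal (f i)) \<le> ennreal S"
  proof (rule suminf_le_const)
    fix M
    show "(\<Sum>i<M. ennreal (f i)) \<le> ennreal S"
      using tail[of M] f0 by (simp add: sum_ennreal S_def ennreal_leI)
  qed simp
  finally have "ennreal (C * A powr (1 / r)) \<le> ennreal (1 + S)"
    using S0 by (simp add: ennreal_plus add_left_mono)
  moreover have "0 \<le> 1 + S" using S0 by simp
  ultimately have lower: "C * A powr (1 / r) \<le> 1 + S" by (simp only: ennreal_le_iff)
  have "(\<Sum>k\<in>{0<..K}. hit_fun c (A * real k powr (- r))) = (\<Sum>i<K. f i)"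
    unfolding f_def by (rule sum.reindex_bij_witness[of _ Suc "\<lambda>k. k - 1"]) auto
  then show ?thesis using upper lower unfolding S_def C_def[symmetric] abs_le_iff
    using c A r by (auto intro: add_nonneg_nonneg order_trans)
qed

section \<open>The branching regime of the chain\<close>

context pa_model
begin

text \<open>
  The total weight of the urn of \<open>G\<^sub>k\<close> is \<open>\<theta> (k - delta)\<close>.
\<close>

definition \<theta> :: real where "\<theta> = a + real m"

text \<open>
  The growth exponent of the branching regime: \<open>Y\<close> is of the order \<open>(n / k)\<^sup>\<chi>\<close>.
\<close>

definition chi :: real where "chi = (real m - 1) * a / \<theta>"
definition fluid_exp :: real where "fluid_exp = real m * (a + 1) / \<theta>"
definition delta :: real where "delta = 2 * real m / \<theta>"

lemma \<theta>_gt: "\<theta> > real m" using a_pos by (simp add: \<theta>_def)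

lemma \<theta>_pos: "\<theta> > 0" by (rule le_less_trans[OF of_nat_0_le_iff \<theta>_gt])

lemma chi_pos: "chi > 0" using a_pos m_ge_2 \<theta>_pos by (simp add: chi_def)

lemma fluid_exp_eq: "fluid_exp = 1 + chi"
proof -
  have "real m * (a + 1) = \<theta> + (real m - 1) * a" by (simp add: \<theta>_def algebra_simps)
  then show ?thesis using \<theta>_pos by (simp add: fluid_exp_def chi_def add_divide_distrib)
qed

sublocale fluid a "real m" \<theta> fluid_exp
  by unfold_locales (use a_pos m_ge_2 in \<open>auto simp: \<theta>_def fluid_exp_def\<close>)

lemma weight_eq: "weight k = \<theta> * real k - 2 * real m"
  by (simp add: weight_def \<theta>_def a_def algebra_simps)

lemma weight_eq': "weight k = \<theta> * (real k - delta)"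
  using \<theta>_pos by (simp add: weight_eq delta_def algebra_simps)

lemma delta_bounds: "0 < delta" "delta < 2"
  using m_ge_2 \<theta>_gt \<theta>_pos by (simp_all add: delta_def divide_less_eq)

lemma E_step:
  "E (step k (y, N)) f = E (polya_count a (weight k) y) (\<lambda>z. if z = 0 then f (y, N) else f (y - z + m, Suc N))"
  unfolding step_def by (simp, rule arg_cong[where f = "\<lambda>f. E _ f"]) (auto simp: fun_eq_iff)

lemma finite_step: "finite (set_pmf (step k s))"
  by (simp add: step_def finite_polya_count)

lemma finite_descend: "finite (set_pmf (descend j k s))"
  by (induction k arbitrary: s) (auto simp: finite_step)

lemma descend_self [simp]: "descend k k s = return_pmf s"
  by (cases k) auto

lemma descend_split:
  assumes "j \<le> i" "i \<le> k"
  shows "descend j k s = bind_pmf (descend i k s) (descend j i)"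
  using assms(2)
proof (induction k arbitrary: s rule: dec_induct)
  case base
  then show ?case by (simp add: bind_return_pmf)
next
  case (step k)
  then show ?case using assms(1) by (simp add: bind_assoc_pmf cong: bind_pmf_cong)
qed

lemma descend_last:
  assumes "j < k"
  shows "descend j k s = bind_pmf (descend (Suc j) k s) (step (Suc j))"
proof -
  have "descend j j = return_pmf" by (rule ext) simp
  then have "descend j (Suc j) = step (Suc j)"
    by (intro ext) (simp add: bind_return_pmf')
  then show ?thesis using descend_split[of j "Suc j" k s] assms by simp
qed

lemma E_descend_last:
  assumes "j < k"
  shows "E (descend j k s) f = E (descend (Suc j) k s) (\<lambda>t. E (step (Suc j) t) f)"
  unfolding descend_last[OF assms] by (intro E_bind finite_descend finite_step)

lemma set_pmf_step:
  assumes "t \<in> set_pmf (step k s)" "fst s \<ge> 1"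
  shows "fst t \<ge> 1" "snd s \<le> snd t" "snd t \<le> Suc (snd s)"
  using assms m_ge_2 by (auto simp: step_def split: if_splits)

lemma set_pmf_descend:
  assumes "t \<in> set_pmf (descend j k s)" "fst s \<ge> 1"
  shows "fst t \<ge> 1 \<and> snd s \<le> snd t \<and> snd t \<le> snd s + (k - j)"
  using assms
proof (induction k arbitrary: s)
  case (Suc k)
  show ?case
  proof (cases "Suc k \<le> j")
    case False
    then obtain u where u: "u \<in> set_pmf (step (Suc k) s)" "t \<in> set_pmf (descend j k u)"
      using Suc.prems by auto
    have "fst t \<ge> 1 \<and> snd u \<le> snd t \<and> snd t \<le> snd u + (k - j)"
      using Suc.IH[OF u(2)] set_pmf_step[OF u(1) Suc.prems(2)] by simp
    then show ?thesis using set_pmf_step[OF u(1) Suc.prems(2)] False by auto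
  qed (use Suc.prems in auto)
qed simp

lemma weight_ge_a: "k \<ge> 2 \<Longrightarrow> a \<le> weight k"
  using weight_gt[of k] by simp

lemma hits_mean_le:
  assumes "k \<ge> 2"
  shows "E (polya_count a (weight k) y) real \<le> real y / real k"
proof -
  have "a * real y / weight k \<le> a * real y / (a * real k)"
    using weight_ge[OF assms] weight_gt[OF assms] a_pos assms by (intro divide_left_mono mult_pos_pos) auto
  then show ?thesis using E_polya_count[OF a_pos weight_ge_a[OF assms], of y] a_pos by simp
qed

lemma hits_fact2_le:
  assumes "k \<ge> 2"
  shows "E (polya_count a (weight k) y) (\<lambda>z. real z * (real z - 1)) \<le> (a + 1) / a * ((real y)\<^sup>2 / (real k)\<^sup>2)"
proof -
  let ?w = "weight k"
  have w: "?w \<ge> a * real k" "a * real k > 0" using weight_ge[OF assms] a_pos assms by auto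
  have "real y * (real y - 1) * a * (a + 1) / (?w * (?w + 1)) \<le> (real y)\<^sup>2 * a * (a + 1) / ((a * real k)
      * (a * real k))"
  proof (rule frac_le)
    have "real y * (real y - 1) \<le> (real y)\<^sup>2" by (simp add: power2_eq_square algebra_simps)
    then show "real y * (real y - 1) * a * (a + 1) \<le> (real y)\<^sup>2 * a * (a + 1)"
      using a_pos by (intro mult_right_mono) auto
    show "(a * real k) * (a * real k) \<le> ?w * (?w + 1)" using w by (intro mult_mono) auto
  qed (use w a_pos in auto)
  also have "\<dots> = (a + 1) / a * ((real y)\<^sup>2 / (real k)\<^sup>2)"
    using a_pos by (simp add: power2_eq_square mult_ac)
  finally show ?thesis unfolding E_polya_count_fact2[OF a_pos weight_ge_a[OF assms]] .
qed

definition hit_prob :: "nat \<Rightarrow> nat \<Rightarrow> real" where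
  "hit_prob k y = E (polya_count a (weight k) y) (\<lambda>z. if z = 0 then 0 else 1)"

lemma hit_prob_le: "k \<ge> 2 \<Longrightarrow> hit_prob k y \<le> real y / real k"
proof -
  assume k: "k \<ge> 2"
  have "hit_prob k y \<le> E (polya_count a (weight k) y) real"
    unfolding hit_prob_def by (intro E_mono finite_polya_count) auto
  then show ?thesis using hits_mean_le[OF k, of y] by linarith
qed

lemma hit_prob_nonneg: "0 \<le> hit_prob k y"
  unfolding hit_prob_def by (intro E_nonneg) simp

text \<open>
  The eigenfunctions of the branching process in which every individual is replaced by \<open>m\<close> individuals; for
  \<open>s = 1\<close> this is \<open>y / (m - 1)\<close>.
\<close>

definition yule :: "real \<Rightarrow> nat \<Rightarrow> real" where
  "yule s y = gamma_ratio (real y / (real m - 1)) s"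

lemma m1_pos: "real m - 1 > 0" using m_ge_2 by simp

lemma yule_pos: "y \<ge> 1 \<Longrightarrow> s \<ge> 0 \<Longrightarrow> yule s y > 0"
  unfolding yule_def using m1_pos by (intro gamma_ratio_pos) auto

lemma yule_mono: "1 \<le> x \<Longrightarrow> x \<le> y \<Longrightarrow> s \<ge> 0 \<Longrightarrow> yule s x \<le> yule s y"
  unfolding yule_def using m1_pos by (intro gamma_ratio_mono) (auto simp: divide_right_mono)

text \<open>
  The eigenvalue equation. It follows from the functional equation of the Gamma function.
\<close>

lemma yule_increment:
  assumes "y \<ge> 1" "s \<ge> 0"
  shows "real y * (yule s (y + m - 1) - yule s y) = (real m - 1) * s * yule s y"
proof -
  let ?x = "real y / (real m - 1)"
  have x: "?x > 0" using assms m1_pos by simp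
  have "real (y + m - 1) = real y + (real m - 1)" using m_ge_2 by simp
  then have "real (y + m - 1) / (real m - 1) = ?x + 1" using m1_pos by (simp only: add_divide_distrib
      divide_self_if) simp
  then have "yule s (y + m - 1) = yule s y * ((?x + s) / ?x)"
    unfolding yule_def using gamma_ratio_shift[OF x assms(2)] by simp
  also have "(?x + s) / ?x = 1 + (real m - 1) * s / real y"
    using assms m1_pos by (simp add: field_simps)
  finally have "yule s (y + m - 1) - yule s y = yule s y * ((real m - 1) * s / real y)" by (simp add: algebra_simps)
  then show ?thesis using assms by simp
qed

text \<open>
  A hit by \<open>z\<close> edges at once is bounded by a single hit, multiplied by \<open>z\<close>. The mean of \<open>z\<close> is linear in \<open>y\<close>,
  so the eigenvalue equation applies without any error.
\<close>

lemma step_yule_upper: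
  assumes "k \<ge> 2" "y \<ge> 1" "s > 0"
  shows "E (step k (y, N)) (\<lambda>t. yule s (fst t)) \<le> (1 + chi * s / (real k - delta)) * yule s y"
proof -
  let ?P = "polya_count a (weight k) y" and ?D = "yule s (y + m - 1) - yule s y"
  have D0: "?D \<ge> 0" using yule_mono[of y "y + m - 1" s] assms m_ge_2 by simp
  have "E (step k (y, N)) (\<lambda>t. yule s (fst t)) \<le> E ?P (\<lambda>z. yule s y + ?D * real z)"
    unfolding E_step
  proof (rule E_mono[OF finite_polya_count])
    fix z assume "z \<in> set_pmf ?P"
    then have zy: "z \<le> y" by (rule set_pmf_polya_count)
    show "(if z = 0 then yule s (fst (y, N)) else yule s (fst (y - z + m, Suc N))) \<le> yule s y + ?D * real z"
    proof (cases "z = 0")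
      case False
      then have "yule s (y - z + m) \<le> yule s (y + m - 1)" using assms zy m_ge_2 by (intro yule_mono) auto
      also have "\<dots> \<le> yule s y + ?D * real z" using D0 False mult_left_mono[of 1 "real z" ?D] by simp
      finally show ?thesis using False by simp
    qed simp
  qed
  also have "\<dots> = yule s y + ?D * (a * real y / weight k)"
    by (simp add: E_add finite_polya_count E_polya_count[OF a_pos weight_ge_a[OF assms(1)]])
  also have "?D * (a * real y / weight k) = (real y * ?D) * a / weight k" by simp
  also have "\<dots> = chi * s / (real k - delta) * yule s y"
    unfolding yule_increment[OF assms(2) less_imp_le[OF assms(3)]] weight_eq' chi_def by simp
  finally show ?thesis by (simp add: algebra_simps)
qed

definition yule_err :: "real \<Rightarrow> real" where
  "yule_err s = (1 + (real m - 1) * s) * (real m - 1)\<^sup>2 * ((a + 1) / a)"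

lemma yule_err_pos: "s > 0 \<Longrightarrow> yule_err s > 0"
  unfolding yule_err_def using m1_pos a_pos by (intro mult_pos_pos add_pos_pos) auto

text \<open>
  Only hits by a single edge are counted. A hit by several edges has a probability of order \<open>y\<^sup>2 / k\<^sup>2\<close>, and
  \<open>y\<^sup>2\<close> raises the parameter of the eigenfunction by \<open>2\<close>.
\<close>

lemma step_yule_lower:
  assumes "k \<ge> 2" "y \<ge> 1" "s > 0"
  shows "E (step k (y, N)) (\<lambda>t. yule s (fst t)) \<ge> (1 + chi * s / (real k - delta)) * yule s y
     - yule_err s / (real k)\<^sup>2 * yule (s + 2) y"
proof -
  let ?P = "polya_count a (weight k) y" and ?D = "yule s (y + m - 1) - yule s y"
  let ?G = "yule s (y + m - 1)"
  have D0: "?D \<ge> 0" using yule_mono[of y "y + m - 1" s] assms m_ge_2 by simp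
  have g0: "yule s y > 0" using yule_pos assms by simp
  have "E ?P (\<lambda>z. yule s y + ?D * real z - ?G * (real z * (real z - 1))) \<le> E (step k (y, N)) (\<lambda>t. yule s (fst t))"
    unfolding E_step
  proof (rule E_mono[OF finite_polya_count])
    fix z assume "z \<in> set_pmf ?P"
    then have zy: "z \<le> y" by (rule set_pmf_polya_count)
    consider "z = 0" | "z = 1" | "z \<ge> 2" by linarith
    then show "yule s y + ?D * real z - ?G * (real z * (real z - 1)) \<le> (if z = 0 then yule s (fst (y,
        N)) else yule s (fst (y - z + m, Suc N)))"
    proof cases
      case 2
      have "y - 1 + m = y + m - 1" using assms by simp
      then show ?thesis using 2 by simp
    next
      case 3
      have z1: "real z * 1 \<le> real z * (real z - 1)" using 3 by (intro mult_left_mono) auto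
      have "yule s y + ?D * real z \<le> yule s y * real z + ?D * real z" using 3 g0 by simp
      also have "\<dots> = ?G * real z" by (simp add: algebra_simps)
      also have "\<dots> \<le> ?G * (real z * (real z - 1))" using z1 g0 D0 by (intro mult_left_mono) auto
      finally have "yule s y + ?D * real z - ?G * (real z * (real z - 1)) \<le> 0" by simp
      also have "0 \<le> yule s (y - z + m)" using yule_pos[of "y - z + m" s] m_ge_2 assms by simp
      finally show ?thesis using 3 by simp
    qed simp
  qed
  moreover have "E ?P (\<lambda>z. yule s y + ?D * real z - ?G * (real z * (real z - 1))) =
     yule s y + ?D * (a * real y / weight k) - ?G * E ?P (\<lambda>z. real z * (real z - 1))"
    by (simp add: E_add E_diff finite_polya_count E_polya_count[OF a_pos weight_ge_a[OF assms(1)]])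
  moreover have "?D * (a * real y / weight k) = chi * s / (real k - delta) * yule s y"
  proof -
    have "?D * (a * real y / weight k) = (real y * ?D) * a / weight k" by simp
    also have "\<dots> = chi * s / (real k - delta) * yule s y"
      unfolding yule_increment[OF assms(2) less_imp_le[OF assms(3)]] weight_eq' chi_def by simp
    finally show ?thesis .
  qed
  moreover have "?G * E ?P (\<lambda>z. real z * (real z - 1)) \<le> yule_err s / (real k)\<^sup>2 * yule (s + 2) y"
  proof -
    have "real y * ?D = (real m - 1) * s * yule s y" using yule_increment assms by simp
    moreover have "1 * ?D \<le> real y * ?D" using assms D0 by (intro mult_right_mono) auto
    ultimately have G: "?G \<le> (1 + (real m - 1) * s) * yule s y" by (simp add: algebra_simps)
    let ?x = "real y / (real m - 1)"
    have x: "?x > 0" using assms m1_pos by simp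
    have "yule (s + 2) y = (?x + (s + 1)) * ((?x + s) * yule s y)"
      unfolding yule_def using gamma_ratio_plus1[OF x, of s] gamma_ratio_plus1[OF x, of "s + 1"] assms
          by (simp add: add.assoc)
    moreover have "?x * (?x * yule s y) \<le> (?x + (s + 1)) * ((?x + s) * yule s y)"
      using x assms g0 m1_pos by (intro mult_mono) auto
    ultimately have "?x\<^sup>2 * yule s y \<le> yule (s + 2) y" by (simp add: power2_eq_square)
    then have Y: "(real y)\<^sup>2 * yule s y \<le> (real m - 1)\<^sup>2 * yule (s + 2) y"
      using m1_pos by (simp add: power_divide field_simps)
    have "?G * E ?P (\<lambda>z. real z * (real z - 1)) \<le> ((1 + (real m - 1) * s) * yule s y) * ((a + 1) / a *
        ((real y)\<^sup>2 / (real k)\<^sup>2))"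
    proof (rule mult_mono'[OF G hits_fact2_le[OF assms(1)]])
      show "0 \<le> ?G" using g0 D0 by simp
      show "0 \<le> E ?P (\<lambda>z. real z * (real z - 1))"
      proof (rule E_nonneg)
        fix z :: nat
        show "0 \<le> real z * (real z - 1)" by (cases z) auto
      qed
    qed
    also have "\<dots> = (1 + (real m - 1) * s) * ((a + 1) / a) / (real k)\<^sup>2 * ((real y)\<^sup>2 * yule s y)" by simp
    also have "\<dots> \<le> (1 + (real m - 1) * s) * ((a + 1) / a) / (real k)\<^sup>2 * ((real m - 1)\<^sup>2 * yule (s + 2) y)"
      using Y m1_pos a_pos assms by (intro mult_left_mono) auto
    finally show ?thesis by (simp add: yule_err_def mult_ac)
  qed
  ultimately show ?thesis by (simp add: algebra_simps)
qed

text \<open>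
  The inverse of the product of the growth factors \<open>1 + \<chi> s / (i - delta)\<close> in \<open>step_yule_upper\<close> over the vertices
  \<open>i\<close> revealed, up to a constant: \<open>growth s k\<close> times the expectation of \<open>yule s\<close> is nearly constant.
\<close>

definition growth :: "real \<Rightarrow> nat \<Rightarrow> real" where
  "growth s k = gamma_ratio (real k + 1 - delta) (chi * s)"

lemma growth_arg_pos: "k \<ge> 1 \<Longrightarrow> real k + 1 - delta > 0"
  using delta_bounds by simp

lemma growth_pos: "k \<ge> 1 \<Longrightarrow> s \<ge> 0 \<Longrightarrow> growth s k > 0"
  unfolding growth_def using growth_arg_pos chi_pos by (intro gamma_ratio_pos) auto

lemma growth_Suc:
  assumes "k \<ge> 1" "s \<ge> 0"
  shows "growth s (Suc k) = growth s k * (1 + chi * s / (real (Suc k) - delta))"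
proof -
  have x: "real k + 1 - delta > 0" using growth_arg_pos assms by simp
  have "growth s (Suc k) = growth s k * ((real k + 1 - delta + chi * s) / (real k + 1 - delta))"
  proof -
    have "real (Suc k) + 1 - delta = real k + 1 - delta + 1" by simp
    then show ?thesis unfolding growth_def using gamma_ratio_shift[OF x, of "chi * s"] chi_pos assms by
        (simp only: mult_nonneg_nonneg less_imp_le)
  qed
  also have "(real k + 1 - delta + chi * s) / (real k + 1 - delta) = 1 + chi * s / (real (Suc k) - delta)"
    using x by (simp add: field_simps)
  finally show ?thesis .
qed

lemma yule_descend_mono:
  assumes "1 \<le> j" "j < k" "y \<ge> 1" "s > 0"
  shows "growth s j * E (descend j k (y, N)) (\<lambda>t. yule s (fst t)) \<le> growth s (Suc j) * E (descend (Suc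
      j) k (y, N)) (\<lambda>t. yule s (fst t))"
proof -
  let ?c = "1 + chi * s / (real (Suc j) - delta)"
  have "E (descend j k (y, N)) (\<lambda>t. yule s (fst t)) \<le> E (descend (Suc j) k (y, N)) (\<lambda>t. ?c * yule s (fst t))"
    unfolding E_descend_last[OF assms(2)]
  proof (rule E_mono[OF finite_descend])
    fix t assume t: "t \<in> set_pmf (descend (Suc j) k (y, N))"
    then have "fst t \<ge> 1" using set_pmf_descend assms by fastforce
    then show "E (step (Suc j) t) (\<lambda>t. yule s (fst t)) \<le> ?c * yule s (fst t)"
      using step_yule_upper[of "Suc j" "fst t" s "snd t"] assms by simp
  qed
  then have "growth s j * E (descend j k (y, N)) (\<lambda>t. yule s (fst t)) \<le> growth s j * (?c * E (descend
      (Suc j) k (y, N)) (\<lambda>t. yule s (fst t)))"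
    using growth_pos[of j s] assms by (intro mult_left_mono) auto
  then show ?thesis using growth_Suc[of j s] assms by (simp add: mult.assoc)
qed

lemma yule_descend_upper:
  assumes "1 \<le> j" "j \<le> k" "y \<ge> 1" "s > 0"
  shows "growth s j * E (descend j k (y, N)) (\<lambda>t. yule s (fst t)) \<le> growth s k * yule s y"
  using assms(2,1)
proof (induction j rule: inc_induct)
  case base
  then show ?case by simp
next
  case (step j)
  then show ?case using yule_descend_mono[of j k y s N] assms by fastforce
qed

lemma yule_bounds:
  assumes "s > 0"
  shows "\<exists>c>0. \<exists>C>0. \<forall>y\<ge>1. c * real y powr s \<le> yule s y \<and> yule s y \<le> C * real y powr s"
proof -
  define x0 where "x0 = 1 / (real m - 1)"
  have x0: "x0 > 0" unfolding x0_def using m1_pos by simp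
  define c where "c = x0 / (x0 + s) * x0 powr s"
  define C where "C = ((x0 + s) / x0) powr s * x0 powr s"
  have *: "(real y / (real m - 1)) powr s = x0 powr s * real y powr s" for y
    unfolding x0_def using m1_pos by (simp flip: powr_mult)
  have y: "real y / (real m - 1) \<ge> x0" if "y \<ge> 1" for y unfolding x0_def using that m1_pos by (simp add:
      divide_right_mono)
  have "c > 0" "C > 0" unfolding c_def C_def using x0 assms m1_pos by (auto simp: add_pos_pos)
  moreover have "c * real y powr s \<le> yule s y" "yule s y \<le> C * real y powr s" if "y \<ge> 1" for y
    using gamma_ratio_two_sided[OF y[OF that] x0 assms] unfolding * yule_def c_def C_def by (simp_all
        only: mult.assoc)
  ultimately show ?thesis by blast
qed

lemma growth_bounds:
  assumes "s > 0"
  shows "\<exists>c>0. \<exists>C>0. \<forall>k\<ge>1. c * real k powr (chi * s) \<le> growth s k \<and> growth s k \<le> C * real k powr (chi * s)"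
proof -
  define b where "b = min 1 (2 - delta)"
  have b: "0 < b" "b \<le> 1" "b \<le> 2 - delta" using delta_bounds by (auto simp: b_def)
  let ?s = "chi * s"
  have s: "?s > 0" using assms chi_pos by simp
  have x: "b * real k \<le> real k + 1 - delta" "real k + 1 - delta \<le> 2 * real k" if "k \<ge> 1" for k
  proof -
    have "b * (real k - 1) \<le> 1 * (real k - 1)" using b that by (intro mult_right_mono) auto
    then show "b * real k \<le> real k + 1 - delta" using b by (simp add: algebra_simps)
    show "real k + 1 - delta \<le> 2 * real k" using delta_bounds that by simp
  qed
  have x0: "real k + 1 - delta \<ge> b" if "k \<ge> 1" for k
  proof -
    have "b * 1 \<le> b * real k" using that b by (intro mult_left_mono) auto
    then show ?thesis using x(1)[OF that] by linarith
  qed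
  define c where "c = b / (b + ?s) * b powr ?s"
  define C where "C = ((b + ?s) / b) powr ?s * 2 powr ?s"
  have "c > 0" "C > 0" unfolding c_def C_def using b s by (auto simp: add_pos_pos)
  moreover have "c * real k powr ?s \<le> growth s k" if "k \<ge> 1" for k
  proof -
    have "b powr ?s * real k powr ?s \<le> (real k + 1 - delta) powr ?s"
      using x(1)[OF that] b s by (subst powr_mult[symmetric]) (auto intro!: powr_mono2)
    then have "b / (b + ?s) * (b powr ?s * real k powr ?s) \<le> b / (b + ?s) * (real k + 1 - delta) powr ?s"
      using b s by (intro mult_left_mono) auto
    also have "\<dots> \<le> growth s k" unfolding growth_def by (rule gamma_ratio_two_sided(1)[OF x0[OF that] b(1) s])
    finally show ?thesis by (simp add: c_def)
  qed
  moreover have "growth s k \<le> C * real k powr ?s" if "k \<ge> 1" for k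
  proof -
    have "growth s k \<le> ((b + ?s) / b) powr ?s * (real k + 1 - delta) powr ?s"
      unfolding growth_def by (rule gamma_ratio_two_sided(2)[OF x0[OF that] b(1) s])
    also have "\<dots> \<le> ((b + ?s) / b) powr ?s * (2 * real k) powr ?s"
      using x(2)[OF that] x0[OF that] b s by (intro mult_left_mono powr_mono2) auto
    also have "\<dots> = C * real k powr ?s" by (simp add: C_def powr_mult)
    finally show ?thesis .
  qed
  ultimately show ?thesis by blast
qed

text \<open>
  All moments have the order of magnitude that the growth exponent suggests, down to \<open>j = 1\<close>. Beyond the branching
  regime this is only an upper bound.
\<close>

lemma moment_bound:
  assumes "s > 0"
  shows "\<exists>C>0. \<forall>j k y N. 1 \<le> j \<longrightarrow> j \<le> k \<longrightarrow> y \<ge> 1 \<longrightarrow>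
    E (descend j k (y, N)) (\<lambda>t. real (fst t) powr s) \<le> C * real y powr s * (real k / real j) powr (chi * s)"
proof -
  obtain c1 C1 where 1: "c1 > 0" "C1 > 0" "\<And>y. y \<ge> 1 \<Longrightarrow> c1 * real y powr s \<le> yule s y" "\<And>y. y \<ge> 1 \<Longrightarrow> yule
      s y \<le> C1 * real y powr s"
    using yule_bounds[OF assms] by metis
  obtain c2 C2 where 2: "c2 > 0" "C2 > 0" "\<And>k. k \<ge> 1 \<Longrightarrow> c2 * real k powr (chi * s) \<le> growth s k" "\<And>k. k \<ge>
      1 \<Longrightarrow> growth s k \<le> C2 * real k powr (chi * s)"
    using growth_bounds[OF assms] by metis
  show ?thesis
  proof (intro exI[of _ "C1 * C2 / (c1 * c2)"] conjI allI impI)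
    show "C1 * C2 / (c1 * c2) > 0" using 1 2 by simp
    fix j k y N :: nat assume jk: "1 \<le> j" "j \<le> k" "1 \<le> y"
    let ?E = "E (descend j k (y, N)) (\<lambda>t. real (fst t) powr s)"
    have "c1 * ?E = E (descend j k (y, N)) (\<lambda>t. c1 * real (fst t) powr s)" by simp
    also have "\<dots> \<le> E (descend j k (y, N)) (\<lambda>t. yule s (fst t))"
    proof (rule E_mono[OF finite_descend])
      fix t assume "t \<in> set_pmf (descend j k (y, N))"
      then have "fst t \<ge> 1" using set_pmf_descend jk by fastforce
      then show "c1 * real (fst t) powr s \<le> yule s (fst t)" by (rule 1)
    qed
    finally have e: "c1 * ?E \<le> E (descend j k (y, N)) (\<lambda>t. yule s (fst t))" .
    have E0: "?E \<ge> 0" by (intro E_nonneg) simp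
    have "(c2 * real j powr (chi * s)) * (c1 * ?E) \<le> growth s j * E (descend j k (y, N)) (\<lambda>t. yule s (fst t))"
      using 2(3)[OF jk(1)] 2(1) 1(1) E0 e growth_pos[OF jk(1), of s] assms by (intro mult_mono) auto
    also have "\<dots> \<le> growth s k * yule s y" by (rule yule_descend_upper) (use jk assms in auto)
    also have "\<dots> \<le> (C2 * real k powr (chi * s)) * (C1 * real y powr s)"
      using 2(4)[of k] 1(4)[of y] jk growth_pos[of k s] yule_pos[of y s] assms by (intro mult_mono) auto
    finally show "?E \<le> C1 * C2 / (c1 * c2) * real y powr s * (real k / real j) powr (chi * s)"
      using 1(1) 2(1) jk by (simp add: powr_divide field_simps)
  qed
qed

text \<open>
  The errors of \<open>step_yule_lower\<close> are summed by means of the upper bound for the parameter \<open>s + 2\<close>. The loss is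
  negligible as long as \<open>(k / j)\<^bsup>2\<chi>\<^esup>\<close> is small compared with \<open>j\<close>.
\<close>

lemma yule_descend_lower:
  assumes "s > 0"
  shows "\<exists>C>0. \<forall>j k y N. 1 \<le> j \<longrightarrow> j \<le> k \<longrightarrow> y \<ge> 1 \<longrightarrow>
    growth s k * yule s y - C * yule (s + 2) y * real k powr (chi * (s + 2)) * real j powr (- (1 + 2 * chi))
    \<le> growth s j * E (descend j k (y, N)) (\<lambda>t. yule s (fst t))"
proof -
  obtain c2 C2 where 2: "c2 > 0" "C2 > 0" "\<And>k. k \<ge> 1 \<Longrightarrow> c2 * real k powr (chi * s) \<le> growth s k" "\<And>k. k \<ge>
      1 \<Longrightarrow> growth s k \<le> C2 * real k powr (chi * s)"
    using growth_bounds[OF assms] by metis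
  have s2: "s + 2 > 0" using assms by simp
  obtain c3 C3 where 3: "c3 > 0" "C3 > 0" "\<And>k. k \<ge> 1 \<Longrightarrow> c3 * real k powr (chi * (s + 2)) \<le> growth (s + 2)
      k" "\<And>k. k \<ge> 1 \<Longrightarrow> growth (s + 2) k \<le> C3 * real k powr (chi * (s + 2))"
    using growth_bounds[OF s2] by metis
  define L where "L = yule_err s * C2 * C3 / c3"
  have L: "L > 0" unfolding L_def using yule_err_pos[OF assms] 2 3 by simp
  have main: "growth s k * yule s y - L * yule (s + 2) y * real k powr (chi * (s + 2)) * (\<Sum>i\<in>{j<..k}.
      real i powr (- 1 - (1 + 2 * chi)))
      \<le> growth s j * E (descend j k (y, N)) (\<lambda>t. yule s (fst t))"
    if "1 \<le> j" "j \<le> k" "y \<ge> 1" for j k y N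
    using that(2,1)
  proof (induction j rule: inc_induct)
    case base
    then show ?case by simp
  next
    case (step j)
    let ?p = "descend (Suc j) k (y, N)" and ?c = "1 + chi * s / (real (Suc j) - delta)"
    let ?x = "real (Suc j)"
    have "E ?p (\<lambda>t. ?c * yule s (fst t) - yule_err s / ?x\<^sup>2 * yule (s + 2) (fst t)) \<le> E (descend j k (y,
        N)) (\<lambda>t. yule s (fst t))"
      unfolding E_descend_last[OF step.hyps(2)]
    proof (rule E_mono[OF finite_descend])
      fix t assume "t \<in> set_pmf ?p"
      then have "fst t \<ge> 1" using set_pmf_descend that(3) by fastforce
      then show "?c * yule s (fst t) - yule_err s / ?x\<^sup>2 * yule (s + 2) (fst t) \<le> E (step (Suc j) t)
          (\<lambda>t. yule s (fst t))"
        using step_yule_lower[of "Suc j" "fst t" s "snd t"] step.prems assms by simp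
    qed
    then have "?c * E ?p (\<lambda>t. yule s (fst t)) - yule_err s / ?x\<^sup>2 * E ?p (\<lambda>t. yule (s + 2) (fst t)) \<le> E
        (descend j k (y, N)) (\<lambda>t. yule s (fst t))"
      by (simp add: E_diff finite_descend)
    then have "growth s j * (?c * E ?p (\<lambda>t. yule s (fst t)) - yule_err s / ?x\<^sup>2 * E ?p (\<lambda>t. yule (s + 2)
        (fst t))) \<le> growth s j * E (descend j k (y, N)) (\<lambda>t. yule s (fst t))"
      using growth_pos[of j s] step.prems assms by (intro mult_left_mono) auto
    then have A: "growth s (Suc j) * E ?p (\<lambda>t. yule s (fst t)) - growth s j * (yule_err s / ?x\<^sup>2 * E ?p
        (\<lambda>t. yule (s + 2) (fst t))) \<le> growth s j * E (descend j k (y, N)) (\<lambda>t. yule s (fst t))"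
      using growth_Suc[of j s] step.prems assms by (simp add: right_diff_distrib mult.assoc)
    have "growth s j * (yule_err s / ?x\<^sup>2 * E ?p (\<lambda>t. yule (s + 2) (fst t))) \<le> L * yule (s + 2) y * real
        k powr (chi * (s + 2)) * ?x powr (- 1 - (1 + 2 * chi))"
    proof -
      have e0: "E ?p (\<lambda>t. yule (s + 2) (fst t)) \<ge> 0"
      proof (rule E_nonneg)
        fix t assume "t \<in> set_pmf ?p"
        then have "fst t \<ge> 1" using set_pmf_descend that(3) by fastforce
        then show "0 \<le> yule (s + 2) (fst t)" using yule_pos[of "fst t" "s + 2"] assms by simp
      qed
      have "(c3 * ?x powr (chi * (s + 2))) * E ?p (\<lambda>t. yule (s + 2) (fst t)) \<le> growth (s + 2) (Suc j) *
          E ?p (\<lambda>t. yule (s + 2) (fst t))"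
        using 3(3)[of "Suc j"] e0 by (intro mult_right_mono) auto
      also have "\<dots> \<le> growth (s + 2) k * yule (s + 2) y"
        using step.hyps that(3) s2 by (intro yule_descend_upper) auto
      also have "\<dots> \<le> (C3 * real k powr (chi * (s + 2))) * yule (s + 2) y"
        using 3(4)[of k] yule_pos[of y "s + 2"] that assms by (intro mult_right_mono) auto
      finally have e: "E ?p (\<lambda>t. yule (s + 2) (fst t)) \<le> C3 / c3 * real k powr (chi * (s + 2)) * yule (s
          + 2) y / ?x powr (chi * (s + 2))"
        using 3(1) by (simp add: field_simps)
      have "growth s j \<le> growth s (Suc j)"
        unfolding growth_def using growth_arg_pos[of j] step.prems chi_pos assms by (intro gamma_ratio_mono) auto
      then have g: "growth s j \<le> C2 * ?x powr (chi * s)" using 2(4)[of "Suc j"] by simp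
      have "growth s j * (yule_err s / ?x\<^sup>2 * E ?p (\<lambda>t. yule (s + 2) (fst t))) \<le>
        (C2 * ?x powr (chi * s)) * (yule_err s / ?x\<^sup>2 * (C3 / c3 * real k powr (chi * (s + 2)) * yule (s
            + 2) y / ?x powr (chi * (s + 2))))"
        using g e e0 yule_err_pos[OF assms] 2(2) growth_pos[of j s] step.prems assms by (intro mult_mono
            mult_left_mono) auto
      also have "\<dots> = L * yule (s + 2) y * real k powr (chi * (s + 2)) * (?x powr (chi * s) / ?x\<^sup>2 / ?x
          powr (chi * (s + 2)))"
        by (simp add: L_def mult_ac)
      also have "?x powr (chi * s) / ?x\<^sup>2 / ?x powr (chi * (s + 2)) = ?x powr (- 1 - (1 + 2 * chi))"
      proof -
        have "?x powr (chi * s) / ?x\<^sup>2 / ?x powr (chi * (s + 2)) = ?x powr (chi * s - 2 - chi * (s + 2))"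
          by (simp only: powr_diff) (simp add: powr_numeral)
        then show ?thesis by (simp add: algebra_simps)
      qed
      finally show ?thesis .
    qed
    moreover have "{j<..k} = insert (Suc j) {Suc j<..k}" using step.hyps by auto
    ultimately show ?case using A step.IH step.prems by (simp add: distrib_left)
  qed
  show ?thesis
  proof (intro exI[of _ "L / (1 + 2 * chi)"] conjI allI impI)
    show "L / (1 + 2 * chi) > 0" using L chi_pos by simp
    fix j k y N :: nat assume jk: "1 \<le> j" "j \<le> k" "y \<ge> 1"
    have "(\<Sum>i\<in>{j<..k}. real i powr (- 1 - (1 + 2 * chi))) \<le> real j powr (- (1 + 2 * chi)) / (1 + 2 * chi)"
      using chi_pos jk by (intro sum_powr_tail_le) auto
    then have "L * yule (s + 2) y * real k powr (chi * (s + 2)) * (\<Sum>i\<in>{j<..k}. real i powr (- 1 - (1 + 2 * chi)))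
       \<le> L * yule (s + 2) y * real k powr (chi * (s + 2)) * (real j powr (- (1 + 2 * chi)) / (1 + 2 * chi))"
      using L yule_pos[of y "s + 2"] jk assms by (intro mult_left_mono) auto
    then show "growth s k * yule s y - L / (1 + 2 * chi) * yule (s + 2) y * real k powr (chi * (s + 2))
        * real j powr (- (1 + 2 * chi))
      \<le> growth s j * E (descend j k (y, N)) (\<lambda>t. yule s (fst t))"
      using main[OF jk, of N] by (simp add: mult_ac)
  qed
qed

lemma growth_asymp:
  assumes "s > 0"
  shows "(\<lambda>k. growth s k / real k powr (chi * s)) \<longlonglongrightarrow> 1"
proof -
  have t: "filterlim (\<lambda>k. real k + 1 - delta) at_top sequentially" by real_asymp
  have "(\<lambda>k. gamma_ratio (real k + 1 - delta) (chi * s) / (real k + 1 - delta) powr (chi * s)) \<longlonglongrightarrow> 1"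
    using filterlim_compose[OF gamma_ratio_asymp t] chi_pos assms by simp
  moreover have "(\<lambda>k. ((real k + 1 - delta) / real k) powr (chi * s)) \<longlonglongrightarrow> 1 powr (chi * s)"
    by (intro tendsto_powr) (real_asymp | simp)+
  ultimately have "(\<lambda>k. gamma_ratio (real k + 1 - delta) (chi * s) / (real k + 1 - delta) powr (chi * s) *
      ((real k + 1 - delta) / real k) powr (chi * s)) \<longlonglongrightarrow> 1 * 1 powr (chi * s)"
    by (intro tendsto_mult)
  moreover have "\<forall>\<^sub>F k in sequentially. gamma_ratio (real k + 1 - delta) (chi * s) / (real k + 1 -
      delta) powr (chi * s) *
      ((real k + 1 - delta) / real k) powr (chi * s) = growth s k / real k powr (chi * s)"
    using eventually_ge_at_top[of 1]
  proof eventually_elim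
    case (elim k)
    then have "real k + 1 - delta > 0" by (rule growth_arg_pos)
    then show ?case using elim by (simp add: growth_def powr_divide)
  qed
  ultimately show ?thesis by (simp add: filterlim_cong)
qed

lemma growth_asymp_pred:
  assumes "s > 0"
  shows "(\<lambda>n. growth s (n - 1) / real n powr (chi * s)) \<longlonglongrightarrow> 1"
proof -
  have "filterlim (\<lambda>n::nat. n - 1) at_top sequentially" by (rule filterlim_minus_const_nat_at_top)
  then have "(\<lambda>n. growth s (n - 1) / real (n - 1) powr (chi * s)) \<longlonglongrightarrow> 1"
    by (rule filterlim_compose[OF growth_asymp[OF assms]])
  moreover have "(\<lambda>n::nat. ((real n - 1) / real n) powr (chi * s)) \<longlonglongrightarrow> 1 powr (chi * s)"
    by (intro tendsto_powr) (real_asymp | simp)+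
  ultimately have "(\<lambda>n. growth s (n - 1) / real (n - 1) powr (chi * s) * ((real n - 1) / real n) powr
      (chi * s)) \<longlonglongrightarrow> 1 * 1 powr (chi * s)"
    by (intro tendsto_mult)
  moreover have "\<forall>\<^sub>F n in sequentially. growth s (n - 1) / real (n - 1) powr (chi * s) * ((real n - 1) /
      real n) powr (chi * s)
     = growth s (n - 1) / real n powr (chi * s)"
    using eventually_ge_at_top[of 2] by eventually_elim (simp add: powr_divide of_nat_diff)
  ultimately show ?thesis by (simp add: filterlim_cong)
qed

lemma yule_limit:
  fixes K :: "nat \<Rightarrow> nat"
  assumes s: "s > 0" and K: "filterlim K at_top sequentially" "\<forall>\<^sub>F n in sequentially. K n \<le> n - 1"
    and lim: "(\<lambda>n. real n powr (2 * chi) * real (K n) powr (- (1 + 2 * chi))) \<longlonglongrightarrow> 0"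
  shows "(\<lambda>n. E (descend (K n) (n - 1) (m, 1)) (\<lambda>t. yule s (fst t)) * (real (K n) / real n) powr (chi *
      s)) \<longlonglongrightarrow> yule s m"
proof -
  obtain C where C: "C > 0" "\<And>j k y N. 1 \<le> j \<Longrightarrow> j \<le> k \<Longrightarrow> y \<ge> 1 \<Longrightarrow>
    growth s k * yule s y - C * yule (s + 2) y * real k powr (chi * (s + 2)) * real j powr (- (1 + 2 * chi))
    \<le> growth s j * E (descend j k (y, N)) (\<lambda>t. yule s (fst t))"
    using yule_descend_lower[OF s] by metis
  define e where "e = (\<lambda>n. E (descend (K n) (n - 1) (m, 1)) (\<lambda>t. yule s (fst t)))"
  have m1: "m \<ge> 1" using m_ge_2 by simp
  have u: "(\<lambda>n. growth s (n - 1) * yule s m / real n powr (chi * s)) \<longlonglongrightarrow> yule s m"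
    using tendsto_mult[OF growth_asymp_pred[OF s] tendsto_const[of "yule s m"]] by simp
  have l: "(\<lambda>n. growth s (n - 1) * yule s m / real n powr (chi * s) - C * yule (s + 2) m * (real n powr
      (2 * chi) * real (K n) powr (- (1 + 2 * chi)))) \<longlonglongrightarrow> yule s m"
    using tendsto_diff[OF u tendsto_mult[OF tendsto_const[of "C * yule (s + 2) m"] lim]] by simp
  have K1: "\<forall>\<^sub>F n in sequentially. K n \<ge> 1" using K(1) by (simp add: filterlim_at_top)
  have ev: "\<forall>\<^sub>F n in sequentially. 1 \<le> K n \<and> K n \<le> n - 1 \<and> n \<ge> 2"
    using K1 K(2) eventually_ge_at_top[of 2] by eventually_elim simp
  have "(\<lambda>n. growth s (K n) * e n / real n powr (chi * s)) \<longlonglongrightarrow> yule s m"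
  proof (rule real_tendsto_sandwich[OF _ _ l u])
    show "\<forall>\<^sub>F n in sequentially. growth s (K n) * e n / real n powr (chi * s) \<le> growth s (n - 1) * yule
        s m / real n powr (chi * s)"
      using ev
    proof eventually_elim
      case (elim n)
      then show ?case unfolding e_def using yule_descend_upper[of "K n" "n - 1" m s 1] m1 s by (intro
          divide_right_mono) auto
    qed
    show "\<forall>\<^sub>F n in sequentially. growth s (n - 1) * yule s m / real n powr (chi * s) - C * yule (s + 2)
        m * (real n powr (2 * chi) * real (K n) powr (- (1 + 2 * chi)))
       \<le> growth s (K n) * e n / real n powr (chi * s)"
      using ev
    proof eventually_elim
      case (elim n)
      let ?R = "real (K n) powr (- (1 + 2 * chi))"
      have "real (n - 1) powr (chi * (s + 2)) \<le> real n powr (chi * (s + 2))" using chi_pos s by (intro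
          powr_mono2) auto
      then have "C * yule (s + 2) m * real (n - 1) powr (chi * (s + 2)) * ?R \<le> C * yule (s + 2) m * real
          n powr (chi * (s + 2)) * ?R"
        using C(1) yule_pos[OF m1, of "s + 2"] s by (intro mult_right_mono mult_left_mono) auto
      then have "growth s (n - 1) * yule s m - C * yule (s + 2) m * real n powr (chi * (s + 2)) * ?R \<le>
          growth s (K n) * e n"
        unfolding e_def using C(2)[of "K n" "n - 1" m 1] elim m1 by linarith
      then have "(growth s (n - 1) * yule s m - C * yule (s + 2) m * real n powr (chi * (s + 2)) * ?R) /
          real n powr (chi * s) \<le> growth s (K n) * e n / real n powr (chi * s)"
        by (intro divide_right_mono) auto
      moreover have "real n powr (chi * (s + 2)) = real n powr (chi * s) * real n powr (2 * chi)"
        by (simp flip: powr_add add: algebra_simps)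
      ultimately show ?case using elim by (simp add: diff_divide_distrib)
    qed
  qed
  moreover have "(\<lambda>n. growth s (K n) / real (K n) powr (chi * s)) \<longlonglongrightarrow> 1"
    by (rule filterlim_compose[OF growth_asymp[OF s] K(1)])
  ultimately have "(\<lambda>n. (growth s (K n) * e n / real n powr (chi * s)) / (growth s (K n) / real (K n)
      powr (chi * s))) \<longlonglongrightarrow> yule s m / 1"
    by (rule tendsto_divide) simp
  moreover have "\<forall>\<^sub>F n in sequentially. (growth s (K n) * e n / real n powr (chi * s)) / (growth s (K n)
      / real (K n) powr (chi * s)) =
     e n * (real (K n) / real n) powr (chi * s)"
    using ev
  proof eventually_elim
    case (elim n)
    have "growth s (K n) > 0" using growth_pos elim s by simp
    then show ?case by (simp add: powr_divide field_simps)
  qed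
  ultimately show ?thesis unfolding e_def by (simp add: filterlim_cong)
qed

lemma yule_powr_close:
  assumes "s > 0" "\<epsilon> > 0"
  shows "\<exists>C\<ge>0. \<forall>y\<ge>1. \<bar>real y powr s - (real m - 1) powr s * yule s y\<bar> \<le> \<epsilon> * real y powr s + C"
proof -
  have "filterlim (\<lambda>y::nat. real y / (real m - 1)) at_top sequentially"
    using m1_pos by real_asymp
  then have "(\<lambda>y::nat. gamma_ratio (real y / (real m - 1)) s / (real y / (real m - 1)) powr s) \<longlonglongrightarrow> 1"
    by (rule filterlim_compose[OF gamma_ratio_asymp[OF assms(1)]])
  then have "\<forall>\<^sub>F y in sequentially. dist (gamma_ratio (real y / (real m - 1)) s / (real y / (real m -
      1)) powr s) 1 < \<epsilon>"
    using assms(2) by (rule tendstoD)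
  then obtain M where M: "\<And>y. y \<ge> M \<Longrightarrow> \<bar>yule s y / (real y / (real m - 1)) powr s - 1\<bar> < \<epsilon>"
    unfolding eventually_sequentially dist_real_def yule_def by blast
  define f where "f = (\<lambda>y. \<bar>real y powr s - (real m - 1) powr s * yule s y\<bar>)"
  have "f y \<le> \<epsilon> * real y powr s + (\<Sum>i<M. f i)" if "y \<ge> 1" for y
  proof (cases "y < M")
    case True
    then have "f y \<le> (\<Sum>i<M. f i)" by (intro member_le_sum) (auto simp: f_def)
    moreover have "0 \<le> \<epsilon> * real y powr s" using assms by simp
    ultimately show ?thesis by linarith
  next
    case False
    have p: "(real y / (real m - 1)) powr s > 0" using that m1_pos by simp
    have "\<bar>yule s y - (real y / (real m - 1)) powr s\<bar> = \<bar>yule s y / (real y / (real m - 1)) powr s - 1\<bar>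
        * (real y / (real m - 1)) powr s"
    proof -
      have "g - P = (g / P - 1) * P" if "P > 0" for g P :: real using that by (simp add: field_simps)
      then show ?thesis using p by (metis abs_mult abs_of_pos)
    qed
    also have "\<dots> \<le> \<epsilon> * (real y / (real m - 1)) powr s" using M[of y] False p by (intro mult_right_mono) auto
    finally have "(real m - 1) powr s * \<bar>yule s y - (real y / (real m - 1)) powr s\<bar> \<le> (real m - 1) powr
        s * (\<epsilon> * (real y / (real m - 1)) powr s)"
      by (intro mult_left_mono) auto
    moreover have e: "(real m - 1) powr s * (real y / (real m - 1)) powr s = real y powr s"
      using m1_pos by (simp flip: powr_mult)
    moreover have "(real m - 1) powr s * \<bar>yule s y - (real y / (real m - 1)) powr s\<bar> = f y"
    proof -
      have "S * \<bar>g - P\<bar> = \<bar>S * P - S * g\<bar>" if "S \<ge> 0" for S g P :: real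
        using that by (metis abs_minus_commute abs_mult abs_of_nonneg right_diff_distrib)
      then show ?thesis unfolding f_def e[symmetric] by (metis powr_ge_zero)
    qed
    moreover have "0 \<le> (\<Sum>i<M. f i)" by (intro sum_nonneg) (simp add: f_def)
    ultimately show ?thesis by (simp add: mult.left_commute)
  qed
  moreover have "0 \<le> (\<Sum>i<M. f i)" by (intro sum_nonneg) (simp add: f_def)
  ultimately show ?thesis unfolding f_def by blast
qed

text \<open>
  The eigenfunctions are asymptotic to powers, and \<open>Y\<close> is large at time \<open>K n\<close> because \<open>K n / n\<close> tends to \<open>0\<close>.
\<close>

lemma branching_limit:
  fixes K :: "nat \<Rightarrow> nat"
  assumes s: "s > 0" and K: "filterlim K at_top sequentially" "\<forall>\<^sub>F n in sequentially. K n \<le> n - 1"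
    and lim: "(\<lambda>n. real n powr (2 * chi) * real (K n) powr (- (1 + 2 * chi))) \<longlonglongrightarrow> 0"
    and small: "(\<lambda>n. real (K n) / real n) \<longlonglongrightarrow> 0"
  shows "(\<lambda>n. E (descend (K n) (n - 1) (m, 1)) (\<lambda>t. real (fst t) powr s) * (real (K n) / real n) powr
      (chi * s)) \<longlonglongrightarrow> (real m - 1) powr s * yule s m"
proof -
  define w where "w = (\<lambda>n. (real (K n) / real n) powr (chi * s))"
  define p where "p = (\<lambda>n. descend (K n) (n - 1) (m, 1))"
  have m1: "m \<ge> 1" using m_ge_2 by simp
  have w0: "w \<longlonglongrightarrow> 0"
    unfolding w_def using small chi_pos s by (intro tendsto_zero_powrI[where b = "chi * s"]) auto
  obtain B where B: "B > 0" "\<And>j k y N. 1 \<le> j \<Longrightarrow> j \<le> k \<Longrightarrow> y \<ge> 1 \<Longrightarrow>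
    E (descend j k (y, N)) (\<lambda>t. real (fst t) powr s) \<le> B * real y powr s * (real k / real j) powr (chi * s)"
    using moment_bound[OF s] by metis
  have K1: "\<forall>\<^sub>F n in sequentially. K n \<ge> 1" using K(1) by (simp add: filterlim_at_top)
  have ev: "\<forall>\<^sub>F n in sequentially. 1 \<le> K n \<and> K n \<le> n - 1 \<and> n \<ge> 2"
    using K1 K(2) eventually_ge_at_top[of 2] by eventually_elim simp
  have bnd: "E (p n) (\<lambda>t. real (fst t) powr s) * w n \<le> B * real m powr s" if "1 \<le> K n \<and> K n \<le> n - 1 \<and> n \<ge> 2" for n
  proof -
    have "E (p n) (\<lambda>t. real (fst t) powr s) \<le> B * real m powr s * (real (n - 1) / real (K n)) powr (chi * s)"
      unfolding p_def using that m1 by (intro B(2)) auto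
    also have "\<dots> \<le> B * real m powr s * (real n / real (K n)) powr (chi * s)"
      using that B(1) chi_pos s by (intro mult_left_mono powr_mono2 divide_right_mono) auto
    finally have "E (p n) (\<lambda>t. real (fst t) powr s) * w n \<le> B * real m powr s * (real n / real (K n))
        powr (chi * s) * w n"
      by (intro mult_right_mono) (auto simp: w_def)
    also have "(real n / real (K n)) powr (chi * s) * w n = 1"
      unfolding w_def using that by (subst powr_mult[symmetric]) auto
    then have "B * real m powr s * (real n / real (K n)) powr (chi * s) * w n = B * real m powr s" by
        (simp add: mult.assoc)
    finally show ?thesis .
  qed
  have "(\<lambda>n. E (p n) (\<lambda>t. real (fst t) powr s) * w n - (real m - 1) powr s * (E (p n) (\<lambda>t. yule s (fst
      t)) * w n)) \<longlonglongrightarrow> 0"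
  proof (rule LIMSEQ_I)
    fix \<epsilon> :: real assume \<epsilon>: "\<epsilon> > 0"
    define \<delta> where "\<delta> = \<epsilon> / (2 * (B * real m powr s))"
    have Bm: "B * real m powr s > 0" using B(1) m_ge_2 by simp
    have d: "\<delta> > 0" unfolding \<delta>_def using \<epsilon> Bm by simp
    obtain C where C: "C \<ge> 0" "\<And>y. y \<ge> 1 \<Longrightarrow> \<bar>real y powr s - (real m - 1) powr s * yule s y\<bar> \<le> \<delta> * real y powr s + C"
      using yule_powr_close[OF s d] by blast
    have "(\<lambda>n. C * w n) \<longlonglongrightarrow> C * 0" by (intro tendsto_mult tendsto_const w0)
    then have "\<forall>\<^sub>F n in sequentially. C * w n < \<epsilon> / 2"
      using \<epsilon> by (intro order_tendstoD(2)[of _ "C * 0"]) auto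
    with ev have "\<forall>\<^sub>F n in sequentially. norm (E (p n) (\<lambda>t. real (fst t) powr s) * w n - (real m - 1)
        powr s * (E (p n) (\<lambda>t. yule s (fst t)) * w n) - 0) < \<epsilon>"
    proof eventually_elim
      case (elim n)
      have w: "w n \<ge> 0" by (simp add: w_def)
      have fin: "finite (set_pmf (p n))" unfolding p_def by (rule finite_descend)
      have "E (p n) (\<lambda>t. real (fst t) powr s) - (real m - 1) powr s * E (p n) (\<lambda>t. yule s (fst t)) =
        E (p n) (\<lambda>t. real (fst t) powr s - (real m - 1) powr s * yule s (fst t))" by (simp add: E_diff fin)
      also have "\<bar>\<dots>\<bar> \<le> E (p n) (\<lambda>t. \<bar>real (fst t) powr s - (real m - 1) powr s * yule s (fst t)\<bar>)" by
          (rule E_abs_le[OF fin])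
      also have "\<dots> \<le> E (p n) (\<lambda>t. \<delta> * real (fst t) powr s + C)"
      proof (rule E_mono[OF fin])
        fix t assume "t \<in> set_pmf (p n)"
        then have "fst t \<ge> 1" using set_pmf_descend m1 unfolding p_def by fastforce
        then show "\<bar>real (fst t) powr s - (real m - 1) powr s * yule s (fst t)\<bar> \<le> \<delta> * real (fst t) powr
            s + C" by (rule C)
      qed
      also have "\<dots> = \<delta> * E (p n) (\<lambda>t. real (fst t) powr s) + C" by (simp add: E_add fin)
      finally have "\<bar>E (p n) (\<lambda>t. real (fst t) powr s) - (real m - 1) powr s * E (p n) (\<lambda>t. yule s (fst
          t))\<bar> * w n \<le> (\<delta> * E (p n) (\<lambda>t. real (fst t) powr s) + C) * w n"
        using w by (intro mult_right_mono)
      also have "\<dots> = \<delta> * (E (p n) (\<lambda>t. real (fst t) powr s) * w n) + C * w n" by (simp add: algebra_simps)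
      also have "\<dots> \<le> \<delta> * (B * real m powr s) + C * w n"
        using bnd[of n] elim d by (intro add_right_mono mult_left_mono) auto
      also have "\<delta> * (B * real m powr s) = \<epsilon> / 2" 
      proof -
        have "\<epsilon> / (2 * X) * X = \<epsilon> / 2" if "X > 0" for X using that by simp
        then show ?thesis unfolding \<delta>_def using Bm by blast
      qed
      finally have "\<bar>E (p n) (\<lambda>t. real (fst t) powr s) - (real m - 1) powr s * E (p n) (\<lambda>t. yule s (fst
          t))\<bar> * w n < \<epsilon>"
        using elim by linarith
      moreover have "E (p n) (\<lambda>t. real (fst t) powr s) * w n - (real m - 1) powr s * (E (p n) (\<lambda>t. yule
          s (fst t)) * w n) =
         (E (p n) (\<lambda>t. real (fst t) powr s) - (real m - 1) powr s * E (p n) (\<lambda>t. yule s (fst t))) * w n"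
             by (simp add: algebra_simps)
      ultimately show ?case using w by (simp add: abs_mult)
    qed
    then show "\<exists>no. \<forall>n\<ge>no. norm (E (p n) (\<lambda>t. real (fst t) powr s) * w n - (real m - 1) powr s * (E (p
        n) (\<lambda>t. yule s (fst t)) * w n) - 0) < \<epsilon>"
      by (simp add: eventually_sequentially)
  qed
  moreover have "(\<lambda>n. (real m - 1) powr s * (E (p n) (\<lambda>t. yule s (fst t)) * w n)) \<longlonglongrightarrow> (real m - 1) powr s * yule s m"
    unfolding p_def w_def by (intro tendsto_mult tendsto_const yule_limit assms)
  ultimately have "(\<lambda>n. (E (p n) (\<lambda>t. real (fst t) powr s) * w n - (real m - 1) powr s * (E (p n) (\<lambda>t.
      yule s (fst t)) * w n)) +
     (real m - 1) powr s * (E (p n) (\<lambda>t. yule s (fst t)) * w n)) \<longlonglongrightarrow> 0 + (real m - 1) powr s * yule s m"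
    by (rule tendsto_add)
  then show ?thesis unfolding p_def w_def by simp
qed

lemma E_step_hits_power_le:
  assumes "k \<ge> 2" "N \<ge> 1" "q \<ge> 1"
  shows "E (step k (y, N)) (\<lambda>t. real (snd t) ^ q) \<le> real N ^ q + real y / real k * (real q * 2 ^ (q - 1)
      * real N ^ (q - 1))"
proof -
  let ?d = "real (Suc N) ^ q - real N ^ q"
  have d: "?d \<le> real q * 2 ^ (q - 1) * real N ^ (q - 1)"
  proof -
    have "?d = (real (Suc N) - real N) * (\<Sum>i<q. real N ^ (q - Suc i) * real (Suc N) ^ i)"
      by (rule power_diff_sumr2)
    also have "\<dots> = (\<Sum>i<q. real N ^ (q - Suc i) * real (Suc N) ^ i)" by simp
    also have "\<dots> \<le> (\<Sum>i<q. real (Suc N) ^ (q - 1))"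
    proof (rule sum_mono)
      fix i assume i: "i \<in> {..<q}"
      have "real N ^ (q - Suc i) * real (Suc N) ^ i \<le> real (Suc N) ^ (q - Suc i) * real (Suc N) ^ i"
        by (intro mult_right_mono power_mono) auto
      also have "\<dots> = real (Suc N) ^ (q - 1)" using i by (simp flip: power_add)
      finally show "real N ^ (q - Suc i) * real (Suc N) ^ i \<le> real (Suc N) ^ (q - 1)" .
    qed
    also have "\<dots> = real q * real (Suc N) ^ (q - 1)" by simp
    also have "\<dots> \<le> real q * (2 * real N) ^ (q - 1)" using assms by (intro mult_left_mono power_mono) auto
    finally show ?thesis by (simp add: power_mult_distrib)
  qed
  have "E (step k (y, N)) (\<lambda>t. real (snd t) ^ q) = E (polya_count a (weight k) y) (\<lambda>z. real N ^ q + ?d *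
      (if z = 0 then 0 else 1))"
    unfolding E_step by (intro E_cong) auto
  also have "\<dots> = real N ^ q + ?d * hit_prob k y" by (simp add: E_add finite_polya_count hit_prob_def)
  also have "?d * hit_prob k y \<le> (real q * 2 ^ (q - 1) * real N ^ (q - 1)) * (real y / real k)"
    using d hit_prob_le[OF assms(1)] hit_prob_nonneg by (intro mult_mono) auto
  finally show ?thesis by (simp add: mult_ac)
qed

text \<open>
  Downward induction on \<open>j\<close>. The number of hits grows by one with probability at most \<open>Y / k\<close>; Young's inequality
  separates the resulting mixed moment of \<open>N\<close> and \<open>Y\<close>, with a weight chosen such that the term with \<open>N\<close> takes up half
  of the growth of the claimed bound.
\<close>

lemma hits_moment_bound:
  assumes q: "q \<ge> 1"
  shows "\<exists>B>0. \<forall>j k. 1 \<le> j \<longrightarrow> j \<le> k \<longrightarrow> E (descend j k (m, 1)) (\<lambda>t. real (snd t) ^ q) \<le> B * (real k / real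
      j) powr (chi * real q)"
proof -
  have q0: "real q > 0" using q by simp
  obtain C where C: "C > 0" "\<And>j k y N. 1 \<le> j \<Longrightarrow> j \<le> k \<Longrightarrow> y \<ge> 1 \<Longrightarrow>
    E (descend j k (y, N)) (\<lambda>t. real (fst t) powr real q) \<le> C * real y powr real q * (real k / real j)
        powr (chi * real q)"
    using moment_bound[OF q0] by metis
  have m1: "m \<ge> 1" using m_ge_2 by simp
  define c where "c = real q * 2 ^ (q - 1)"
  have c: "c > 0" using q by (simp add: c_def)
  \<comment> \<open>this choice lets the term with \<open>N\<close> use up half of the factor \<open>1 + \<chi> q / (j + 1)\<close>; \<open>B\<close> is so large
      that the term with \<open>Y\<close> fits into the other half\<close>
  define \<tau> where "\<tau> = chi * real q / (2 * c)"
  have \<tau>: "\<tau> > 0" unfolding \<tau>_def using chi_pos q0 c by simp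
  define D where "D = (1 / \<tau>) ^ (q - 1) * (C * real m powr real q)"
  have D: "D > 0" unfolding D_def using \<tau> C(1) m1 by simp
  define B where "B = max 1 (2 * c * D / (chi * real q))"
  have B: "B \<ge> 1" "B \<ge> 2 * c * D / (chi * real q)" by (auto simp: B_def)
  have "E (descend j k (m, 1)) (\<lambda>t. real (snd t) ^ q) \<le> B * (real k / real j) powr (chi * real q)" if "1
      \<le> j" "j \<le> k" for j k
    using that(2,1)
  proof (induction j rule: inc_induct)
    case base
    then show ?case using B by simp
  next
    case (step j)
    let ?p = "descend (Suc j) k (m, 1)" and ?x = "real (Suc j)"
    let ?h = "(real k / ?x) powr (chi * real q)"
    have fin: "finite (set_pmf ?p)" by (rule finite_descend)
    have "E (descend j k (m, 1)) (\<lambda>t. real (snd t) ^ q) \<le> E ?p (\<lambda>t. real (snd t) ^ q + c / ?x * (\<tau> *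
        real (snd t) ^ q + (1 / \<tau>) ^ (q - 1) * real (fst t) powr real q))"
      unfolding E_descend_last[OF step.hyps(2)]
    proof (rule E_mono[OF fin])
      fix t assume t: "t \<in> set_pmf ?p"
      then have t1: "snd t \<ge> 1" "fst t \<ge> 1" using set_pmf_descend[OF t] m1 by auto
      have "E (step (Suc j) t) (\<lambda>t. real (snd t) ^ q) \<le> real (snd t) ^ q + real (fst t) / ?x * (c * real
          (snd t) ^ (q - 1))"
        using E_step_hits_power_le[of "Suc j" "snd t" q "fst t"] t1 q step.prems by (simp add: c_def)
      also have "\<dots> = real (snd t) ^ q + c / ?x * (real (snd t) ^ (q - 1) * real (fst t))" by simp
      also have "\<dots> \<le> real (snd t) ^ q + c / ?x * (\<tau> * real (snd t) ^ q + (1 / \<tau>) ^ (q - 1) * real (fst t) ^ q)"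
        using c \<tau> q by (intro add_left_mono mult_left_mono young_power) auto
      also have "real (fst t) ^ q = real (fst t) powr real q" using t1 by (simp add: powr_realpow)
      finally show "E (step (Suc j) t) (\<lambda>t. real (snd t) ^ q) \<le> real (snd t) ^ q + c / ?x * (\<tau> * real
          (snd t) ^ q + (1 / \<tau>) ^ (q - 1) * real (fst t) powr real q)" .
    qed
    also have "\<dots> = E ?p (\<lambda>t. real (snd t) ^ q) + c / ?x * (\<tau> * E ?p (\<lambda>t. real (snd t) ^ q) + (1 / \<tau>) ^
        (q - 1) * E ?p (\<lambda>t. real (fst t) powr real q))"
    proof -
      have "E ?p (\<lambda>t. f t + u * (v * f t + w * g t)) = E ?p f + u * (v * E ?p f + w * E ?p g)" for f g u v w
        by (simp add: E_add finite_descend)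
      then show ?thesis .
    qed
    also have "\<dots> \<le> B * ?h + c / ?x * (\<tau> * (B * ?h) + (1 / \<tau>) ^ (q - 1) * (C * real m powr real q * ?h))"
      using step.IH step.prems step.hyps c \<tau> m1 C(2)[of "Suc j" k m 1]
      by (intro add_mono mult_left_mono) auto
    also have "\<dots> = ?h * (B + (c * \<tau> * B + c * D) / ?x)" by (simp add: D_def algebra_simps add_divide_distrib)
    also have "\<dots> \<le> ?h * (B + (chi * real q * B) / ?x)"
    proof -
      have "c * \<tau> * B = chi * real q * B / 2" using c by (simp add: \<tau>_def)
      moreover have "c * D \<le> chi * real q * B / 2" using B(2) chi_pos q0 by (simp add: field_simps)
      ultimately have "c * \<tau> * B + c * D \<le> chi * real q * B" by linarith
      then show ?thesis by (intro mult_left_mono add_left_mono divide_right_mono) auto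
    qed
    also have "\<dots> = B * (?h * (1 + chi * real q / ?x))" by (simp add: algebra_simps)
    also have "?h * (1 + chi * real q / ?x) \<le> (real k / real j) powr (chi * real q)"
    proof -
      have j: "real j > 0" using step.prems by simp
      have "(1 - 1 / ?x) powr (chi * real q) \<le> 1 / (1 + chi * real q / ?x)"
        using chi_pos q0 by (intro powr_shrink_le) auto
      moreover have "1 - 1 / ?x = real j / ?x" by (simp add: field_simps)
      moreover have "1 + chi * real q / ?x > 0" using chi_pos q0 by (intro add_pos_nonneg) auto
      ultimately have "(real j / ?x) powr (chi * real q) * (1 + chi * real q / ?x) \<le> 1"
        using pos_le_divide_eq[of "1 + chi * real q / ?x" "(real j / ?x) powr (chi * real q)" 1] by metis
      then have "(real k / real j) powr (chi * real q) * ((real j / ?x) powr (chi * real q) * (1 + chi *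
          real q / ?x)) \<le> (real k / real j) powr (chi * real q) * 1"
        by (intro mult_left_mono) auto
      moreover have "(real k / real j) powr (chi * real q) * (real j / ?x) powr (chi * real q) = ?h"
        using j by (subst powr_mult[symmetric]) auto
      ultimately show ?thesis by (simp add: mult.assoc[symmetric])
    qed
    finally show ?case using B(1) by (simp add: mult_left_mono)
  qed
  then show ?thesis using B(1) by (intro exI[of _ B]) auto
qed

text \<open>
  The exponent \<open>\<nu>\<close> of the theorem. At \<open>k = n\<^sup>\<nu>\<close> the number \<open>(n / k)\<^sup>\<chi>\<close> of edges becomes comparable with \<open>k\<close>.
\<close>

definition nu :: real where "nu = chi / fluid_exp"

lemma fluid_exp_gt_1: "fluid_exp > 1" using chi_pos fluid_exp_eq by simp

lemma nu_bounds: "0 < nu" "nu < 1"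
  using chi_pos fluid_exp_eq by (simp_all add: nu_def)

lemma one_minus_nu: "1 - nu = 1 / fluid_exp"
  using fluid_exp_gt_1 fluid_exp_eq by (simp add: nu_def field_simps)

lemma chi_one_minus_nu: "chi * (1 - nu) = nu"
  unfolding one_minus_nu by (simp add: nu_def)

text \<open>
  Above \<open>n\<^sup>\<nu>\<close> the previous bound is used; below there are only \<open>n\<^sup>\<nu>\<close> vertices.
\<close>

lemma descendants_moment_bound:
  assumes q: "q \<ge> 1"
  shows "\<exists>B>0. \<forall>n\<ge>3. E (descend 1 (n - 1) (m, 1)) (\<lambda>t. real (Suc (snd t)) ^ q) \<le> B * real n powr (nu * real q)"
proof -
  obtain B where B: "B > 0" "\<And>j k. 1 \<le> j \<Longrightarrow> j \<le> k \<Longrightarrow> E (descend j k (m, 1)) (\<lambda>t. real (snd t) ^ q) \<le> B *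
      (real k / real j) powr (chi * real q)"
    using hits_moment_bound[OF q] by metis
  have "E (descend 1 (n - 1) (m, 1)) (\<lambda>t. real (Suc (snd t)) ^ q) \<le> 2 ^ q * (B + 2 ^ q) * real n powr
      (nu * real q)" if n: "n \<ge> 3" for n
  proof -
    have n1: "real n powr nu \<ge> 1" using n nu_bounds by (intro ge_one_powr_ge_zero) auto
    define J where "J = nat \<lceil>real n powr nu\<rceil>"
    have J: "real n powr nu \<le> real J" "real J \<le> real n powr nu + 1" "J \<ge> 1" unfolding J_def using n1 by linarith+
    define j where "j = min J (n - 1)"
    have j: "1 \<le> j" "j \<le> n - 1" "j \<le> J" using J n by (auto simp: j_def)
    have "E (descend 1 (n - 1) (m, 1)) (\<lambda>t. real (Suc (snd t)) ^ q) = E (descend j (n - 1) (m, 1)) (\<lambda>u.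
        E (descend 1 j u) (\<lambda>t. real (Suc (snd t)) ^ q))"
      unfolding descend_split[OF j(1,2)] by (intro E_bind finite_descend)
    also have "\<dots> \<le> E (descend j (n - 1) (m, 1)) (\<lambda>u. 2 ^ q * (real (snd u) ^ q + real J ^ q))"
    proof (rule E_mono[OF finite_descend])
      fix u assume u: "u \<in> set_pmf (descend j (n - 1) (m, 1))"
      have u1: "fst u \<ge> 1" using set_pmf_descend[OF u] m_ge_2 by simp
      have "E (descend 1 j u) (\<lambda>t. real (Suc (snd t)) ^ q) \<le> E (descend 1 j u) (\<lambda>t. 2 ^ q * (real (snd
          u) ^ q + real J ^ q))"
      proof (rule E_mono[OF finite_descend])
        fix t assume "t \<in> set_pmf (descend 1 j u)"
        then have "snd t \<le> snd u + (j - 1)" using set_pmf_descend u1 by blast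
        then have "real (Suc (snd t)) \<le> 2 * max (real (snd u)) (real J)" using j by simp
        then have "real (Suc (snd t)) ^ q \<le> (2 * max (real (snd u)) (real J)) ^ q" by (intro power_mono) auto
        also have "\<dots> \<le> 2 ^ q * (real (snd u) ^ q + real J ^ q)"
          unfolding power_mult_distrib by (intro mult_left_mono) (auto simp: max_def)
        finally show "real (Suc (snd t)) ^ q \<le> 2 ^ q * (real (snd u) ^ q + real J ^ q)" .
      qed
      then show "E (descend 1 j u) (\<lambda>t. real (Suc (snd t)) ^ q) \<le> 2 ^ q * (real (snd u) ^ q + real J ^ q)" by simp
    qed
    also have "\<dots> = 2 ^ q * (E (descend j (n - 1) (m, 1)) (\<lambda>u. real (snd u) ^ q) + real J ^ q)"
      by (simp add: E_add finite_descend)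
    also have "\<dots> \<le> 2 ^ q * (B * real n powr (nu * real q) + 2 ^ q * real n powr (nu * real q))"
    proof (intro mult_left_mono add_mono)
      have "E (descend j (n - 1) (m, 1)) (\<lambda>u. real (snd u) ^ q) \<le> B * (real (n - 1) / real j) powr (chi * real q)"
        using B(2) j by blast
      also have "\<dots> \<le> B * (real n powr (1 - nu)) powr (chi * real q)"
      proof -
        have "real (n - 1) / real j \<le> real n powr (1 - nu)"
        proof (cases "j = J")
          case True
          have "real (n - 1) / real j \<le> real n / real n powr nu"
            using True J n n1 by (intro frac_le) auto
          then show ?thesis using n by (simp add: powr_diff)
        next
          case False
          then have "j = n - 1" by (auto simp: j_def)
          then show ?thesis using n nu_bounds ge_one_powr_ge_zero[of "real n" "1 - nu"] by simp
        qed
        then show ?thesis using B(1) chi_pos by (intro mult_left_mono powr_mono2) auto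
      qed
      also have "(real n powr (1 - nu)) powr (chi * real q) = real n powr (nu * real q)"
        using chi_one_minus_nu by (simp add: powr_powr mult.assoc[symmetric] mult.commute[of "1 - nu"])
      finally show "E (descend j (n - 1) (m, 1)) (\<lambda>u. real (snd u) ^ q) \<le> B * real n powr (nu * real q)" .
      have "real J ^ q \<le> (2 * real n powr nu) ^ q" using J n1 by (intro power_mono) auto
      also have "\<dots> = 2 ^ q * real n powr (nu * real q)"
        using n by (simp add: power_mult_distrib powr_powr flip: powr_realpow)
      finally show "real J ^ q \<le> 2 ^ q * real n powr (nu * real q)" .
    qed auto
    finally show ?thesis by (simp add: algebra_simps)
  qed
  moreover have "2 ^ q * (B + 2 ^ q) > 0" using B(1) by (simp add: add_pos_pos)
  ultimately show ?thesis by blast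
qed

section \<open>The fluid regime of the chain\<close>

definition hit_err :: real where
  "hit_err = (a + a\<^sup>2) / \<theta>\<^sup>2 + (2 * real m + 1) / \<theta>"

lemma hit_err_pos: "hit_err > 0"
  unfolding hit_err_def using a_pos \<theta>_pos m_ge_2 by (intro add_pos_pos divide_pos_pos) auto

lemma hit_prob_approx:
  assumes k: "k \<ge> 2"
  shows "\<bar>hit_prob k y - hit_fun a (real y / (\<theta> * real k))\<bar> \<le> hit_err * (real y / (real k)\<^sup>2)"
proof -
  let ?w = "weight k" and ?x = "\<theta> * real k"
  have x1: "?x > 1"
  proof -
    have "2 * 2 \<le> \<theta> * real k" using \<theta>_gt m_ge_2 k by (intro mult_mono) auto
    then show ?thesis by simp
  qed
  have w: "a \<le> ?w" "?w \<le> ?x" "a * real k \<le> ?w" using weight_ge_a[OF k] weight_ge[OF k] by (auto simp: weight_eq)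
  have "hit_prob k y = E (polya_count a ?w y) (\<lambda>z. 1 - (if z = 0 then 1 else 0))"
    unfolding hit_prob_def by (intro E_cong) auto
  also have "\<dots> = 1 - (\<Prod>i<y. 1 - a / (?w + real i))"
    by (simp add: E_diff finite_polya_count E_polya_count_miss[OF a_pos w(1)])
  finally have "hit_prob k y - hit_fun a (real y / ?x) = - ((\<Prod>i<y. 1 - a / (?w + real i)) - (1 + real y
      / ?x) powr (- a))"
    by (simp add: hit_fun_def)
  then have "\<bar>hit_prob k y - hit_fun a (real y / ?x)\<bar> \<le> real y * ((a + a\<^sup>2) / ?x\<^sup>2 + a * (?x + 1 - ?w) / (?w * ?x))"
    using urn_miss_prob_approx[OF a_pos w(1) x1 w(2), of y] by simp
  also have "a * (?x + 1 - ?w) / (?w * ?x) \<le> a * (2 * real m + 1) / ((a * real k) * ?x)"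
  proof -
    have "?x + 1 - ?w = 2 * real m + 1" by (simp add: weight_eq)
    moreover have "0 < a * real k" using a_pos k by simp
    ultimately show ?thesis using w a_pos x1 k \<theta>_pos by (simp only:) (intro divide_left_mono
        mult_right_mono mult_pos_pos, auto)
  qed
  also have "a * (2 * real m + 1) / ((a * real k) * ?x) = (2 * real m + 1) / \<theta> / (real k)\<^sup>2"
    using a_pos by (simp add: power2_eq_square)
  also have "(a + a\<^sup>2) / ?x\<^sup>2 = (a + a\<^sup>2) / \<theta>\<^sup>2 / (real k)\<^sup>2" by (simp add: power_mult_distrib)
  also have "real y * ((a + a\<^sup>2) / \<theta>\<^sup>2 / (real k)\<^sup>2 + (2 * real m + 1) / \<theta> / (real k)\<^sup>2) = hit_err *
      (real y / (real k)\<^sup>2)"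
    by (simp only: hit_err_def add_divide_distrib[symmetric] times_divide_eq_right times_divide_eq_left mult.commute)
  finally show ?thesis by (simp add: mult_left_mono)
qed

lemma E_step_fst:
  assumes k: "k \<ge> 2"
  shows "E (step k (y, N)) (\<lambda>t. real (fst t)) = real y - a * real y / weight k + real m * hit_prob k y"
proof -
  have "E (step k (y, N)) (\<lambda>t. real (fst t)) = E (polya_count a (weight k) y) (\<lambda>z. real y - real z +
      real m * (if z = 0 then 0 else 1))"
    unfolding E_step
  proof (rule E_cong)
    fix z assume "z \<in> set_pmf (polya_count a (weight k) y)"
    then have "z \<le> y" by (rule set_pmf_polya_count)
    then show "(if z = 0 then real (fst (y, N)) else real (fst (y - z + m, Suc N))) = real y - real z +
        real m * (if z = 0 then 0 else 1)"
      by (simp add: of_nat_diff)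
  qed
  then show ?thesis
    by (simp add: E_add E_diff finite_polya_count E_polya_count[OF a_pos weight_ge_a[OF k]] hit_prob_def)
qed

definition drift_err :: real where "drift_err = 2 * real m / \<theta> + real m * hit_err"

lemma drift_err_pos: "drift_err > 0"
  unfolding drift_err_def using \<theta>_pos m_ge_2 hit_err_pos by (intro add_pos_nonneg) auto

lemma E_step_fst_approx:
  assumes k: "k \<ge> 2"
  shows "\<bar>E (step k (y, N)) (\<lambda>t. real (fst t)) - drift_map a (real m) (\<theta> * real k) (real y)\<bar> \<le> drift_err
      * (real y / (real k)\<^sup>2)"
proof -
  let ?w = "weight k" and ?x = "\<theta> * real k"
  have k0: "real k > 0" using k by simp
  have x: "?x > 0" using \<theta>_pos k0 by simp
  have w: "a * real k \<le> ?w" "?w > 0" using weight_ge[OF k] weight_gt[OF k] a_pos by auto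
  have "a * real y / ?w - a * real y / ?x = a * real y * (2 * real m) / (?w * ?x)"
  proof -
    have "c / w - c / x = c * (x - w) / (w * x)" if "w > 0" "x > 0" for c w x :: real
      using that by (simp add: field_simps)
    moreover have "?x - ?w = 2 * real m" by (simp add: weight_eq)
    ultimately show ?thesis using w(2) x by metis
  qed
  moreover have "0 \<le> a * real y * (2 * real m) / (?w * ?x)" using w x a_pos by simp
  moreover have "a * real y * (2 * real m) / (?w * ?x) \<le> a * real y * (2 * real m) / ((a * real k) * ?x)"
    using w x a_pos k0 \<theta>_pos by (intro divide_left_mono mult_right_mono mult_pos_pos) auto
  moreover have "a * real y * (2 * real m) / ((a * real k) * ?x) = 2 * real m / \<theta> * (real y / (real k)\<^sup>2)"
    using a_pos by (simp add: power2_eq_square mult_ac)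
  ultimately have 1: "\<bar>a * real y / ?w - a * real y / ?x\<bar> \<le> 2 * real m / \<theta> * (real y / (real k)\<^sup>2)" by linarith
  have "\<bar>real m * (hit_prob k y - hit_fun a (real y / ?x))\<bar> \<le> real m * (hit_err * (real y / (real k)\<^sup>2))"
    unfolding abs_mult using hit_prob_approx[OF k, of y] by (intro mult_mono) auto
  moreover have "E (step k (y, N)) (\<lambda>t. real (fst t)) - drift_map a (real m) ?x (real y) =
     - (a * real y / ?w - a * real y / ?x) + real m * (hit_prob k y - hit_fun a (real y / ?x))"
    unfolding E_step_fst[OF k] drift_map_def by (simp add: algebra_simps)
  ultimately show ?thesis using 1 unfolding drift_err_def distrib_right mult.assoc by linarith
qed

lemma E_step_fst_var:
  assumes k: "k \<ge> 2"
  shows "E (step k (y, N)) (\<lambda>t. (real (fst t) - real y)\<^sup>2) \<le> (real m - 1)\<^sup>2 * ((a + 1) / a * ((real y)\<^sup>2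
      / (real k)\<^sup>2) + real y / real k)"
proof -
  let ?P = "polya_count a (weight k) y"
  have "E (step k (y, N)) (\<lambda>t. (real (fst t) - real y)\<^sup>2) \<le> E ?P (\<lambda>z. (real m - 1)\<^sup>2 * (real z * (real z
      - 1) + real z))"
    unfolding E_step
  proof (rule E_mono[OF finite_polya_count])
    fix z assume "z \<in> set_pmf ?P"
    then have zy: "z \<le> y" by (rule set_pmf_polya_count)
    show "(if z = 0 then (real (fst (y, N)) - real y)\<^sup>2 else (real (fst (y - z + m, Suc N)) - real y)\<^sup>2)
        \<le> (real m - 1)\<^sup>2 * (real z * (real z - 1) + real z)"
    proof (cases "z = 0")
      case False
      have "real m * 1 \<le> real m * real z" using False by (intro mult_left_mono) auto
      moreover have "1 * real z \<le> (real m - 1) * real z" using m_ge_2 by (intro mult_right_mono) auto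
      ultimately have "\<bar>real m - real z\<bar> \<le> (real m - 1) * real z" by (simp add: algebra_simps abs_le_iff)
      then have "(real m - real z)\<^sup>2 \<le> ((real m - 1) * real z)\<^sup>2" by (metis abs_ge_zero power2_abs power_mono)
      also have "\<dots> = (real m - 1)\<^sup>2 * (real z * (real z - 1) + real z)" by (simp add: power2_eq_square algebra_simps)
      finally show ?thesis using False zy by (simp add: of_nat_diff)
    qed simp
  qed
  also have "\<dots> = (real m - 1)\<^sup>2 * (E ?P (\<lambda>z. real z * (real z - 1)) + E ?P real)"
    by (simp add: E_add finite_polya_count)
  also have "\<dots> \<le> (real m - 1)\<^sup>2 * ((a + 1) / a * ((real y)\<^sup>2 / (real k)\<^sup>2) + real y / real k)"
    by (intro mult_left_mono add_mono hits_fact2_le[OF k] hits_mean_le[OF k]) simp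
  finally show ?thesis .
qed

text \<open>
  The constant \<open>A\<close> of the flow that starts with \<open>y\<close> edges at time \<open>K\<close>, linearised for \<open>y\<close> small compared with
  \<open>K\<close>. Being linear in \<open>y\<close>, it inherits the limiting moments of \<open>y\<close>.
\<close>

definition limit_const :: "nat \<Rightarrow> nat \<Rightarrow> real" where
  "limit_const y K = (a + 1) / \<theta> * real y * real K powr chi"

lemma limit_const_nonneg: "limit_const y K \<ge> 0"
  unfolding limit_const_def using a_pos \<theta>_pos by simp

text \<open>
  The number of edges at time \<open>k\<close> predicted by the flow.
\<close>

definition fluid_path :: "nat \<Rightarrow> nat \<Rightarrow> nat \<Rightarrow> real" where
  "fluid_path y K k = \<theta> * real k * profile a fluid_exp (limit_const y K) (real k)"

lemma fluid_path_nonneg: "fluid_path y K k \<ge> 0"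
  unfolding fluid_path_def using \<theta>_pos profile_bounds(1)[OF a_pos limit_const_nonneg] by simp

definition step_const :: real where
  "step_const = (a + real m * a) * ((real m / \<theta>) * 2 powr (fluid_exp + 1)) * ((a + 1) / \<theta>)"

lemma step_const_nonneg: "step_const \<ge> 0"
  unfolding step_const_def using a_pos \<theta>_pos by simp

lemma fluid_path_consistent:
  assumes "k \<ge> 2"
  shows "\<bar>drift_map a (real m) (\<theta> * real k) (fluid_path y K k) - fluid_path y K (k - 1)\<bar>
     \<le> step_const * (real y * real K powr chi * real k powr (- chi - 2))"
proof -
  have "real (k - 1) = real k - 1" using assms by simp
  then have "\<bar>drift_map a (real m) (\<theta> * real k) (fluid_path y K k) - fluid_path y K (k - 1)\<bar>
     \<le> (a + real m * a) * ((real m / \<theta>) * 2 powr (fluid_exp + 1) * (limit_const y K * real k powr (- fluid_exp - 1)))"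
    unfolding fluid_path_def using profile_consistency[OF _ limit_const_nonneg, of "real k" y K] assms by simp
  also have "- fluid_exp - 1 = - chi - 2" by (simp add: fluid_exp_eq)
  finally show ?thesis by (simp add: step_const_def limit_const_def mult_ac)
qed

text \<open>
  The price of the linearisation in \<open>limit_const\<close>.
\<close>

lemma fluid_path_start:
  assumes "K \<ge> 1"
  shows "\<bar>real y - fluid_path y K K\<bar> \<le> (a + 1)\<^sup>2 / \<theta> * ((real y)\<^sup>2 / real K)"
proof -
  let ?s = "1 / (a + 1)"
  define B where "B = (a + 1) * real y / (\<theta> * real K)"
  have K: "real K > 0" using assms by simp
  have B0: "B \<ge> 0" unfolding B_def using a_pos \<theta>_pos by simp
  have "real K powr chi * real K powr (- fluid_exp) = 1 / real K"
    using K by (simp add: fluid_exp_eq powr_minus_divide flip: powr_add)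
  then have "limit_const y K * real K powr (- fluid_exp) = B"
    unfolding limit_const_def B_def by (simp add: mult.assoc)
  then have f: "fluid_path y K K = \<theta> * real K * ((1 + B) powr ?s - 1)" by (simp add: fluid_path_def profile_def)
  have "\<theta> * real K * (?s * B) = real y" using K \<theta>_pos a_pos by (simp add: B_def)
  then have "\<bar>real y - fluid_path y K K\<bar> = \<theta> * real K * \<bar>(1 + B) powr ?s - 1 - ?s * B\<bar>"
    using K \<theta>_pos unfolding f by (metis abs_minus_commute abs_mult abs_of_pos mult_pos_pos right_diff_distrib)
  also have "\<dots> \<le> \<theta> * real K * B\<^sup>2"
    using powr_one_plus_approx[OF B0, of ?s] a_pos \<theta>_pos K by (intro mult_left_mono) auto
  also have "\<dots> = (a + 1)\<^sup>2 / \<theta> * ((real y)\<^sup>2 / real K)"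
    using K \<theta>_pos by (simp add: B_def power2_eq_square)
  finally show ?thesis .
qed

text \<open>
  The three terms on the right stem from the linearisation of the initial state, from the discretisation and the
  fluctuations of order \<open>Y / k\<close>, and from the fluctuations of order \<open>sqrt (Y / k)\<close>, in relative terms. Multiplying by
  \<open>j\<^sup>\<chi>\<close> absorbs the expansion of the flow.
\<close>

lemma fluid_tracking:
  "\<exists>C>0. \<forall>j K y N. 1 \<le> j \<longrightarrow> j \<le> K \<longrightarrow> y \<ge> 1 \<longrightarrow>
     real j powr chi * norm2 (descend j K (y, N)) (\<lambda>t. real (fst t) - fluid_path y K j)
     \<le> C * (real y * real K powr chi * (real y / real K + 1 / sqrt (real j) + 1 / sqrt (real y)))"
proof -
  obtain M1 where M1: "M1 > 0" "\<And>j k y N. 1 \<le> j \<Longrightarrow> j \<le> k \<Longrightarrow> y \<ge> 1 \<Longrightarrow>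
    E (descend j k (y, N)) (\<lambda>t. real (fst t) powr 1) \<le> M1 * real y powr 1 * (real k / real j) powr (chi * 1)"
    using moment_bound[of 1] by auto
  obtain M2 where M2: "M2 > 0" "\<And>j k y N. 1 \<le> j \<Longrightarrow> j \<le> k \<Longrightarrow> y \<ge> 1 \<Longrightarrow>
    E (descend j k (y, N)) (\<lambda>t. real (fst t) powr 2) \<le> M2 * real y powr 2 * (real k / real j) powr (chi * 2)"
    using moment_bound[of 2] by auto
  define C3 where "C3 = drift_err * sqrt M2 + step_const"
  define C4 where "C4 = (real m - 1)\<^sup>2 * max ((a + 1) / a * M2) M1"
  define C5 where "C5 = (a + 1)\<^sup>2 / \<theta>"
  have C3: "C3 > 0" unfolding C3_def using drift_err_pos step_const_nonneg M2(1) by (intro add_pos_nonneg) auto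
  have C4: "C4 > 0" unfolding C4_def using m1_pos M1(1) by (intro mult_pos_pos) auto
  have C5: "C5 > 0" unfolding C5_def using \<theta>_pos a_pos by simp
  define C where "C = C5 + C3 + sqrt C4 + sqrt (C4 * ((1 + chi) / chi))"
  have C0: "C > 0" unfolding C_def using C3 C4 C5 chi_pos by (intro add_pos_nonneg) auto
  have "real j powr chi * norm2 (descend j K (y, N)) (\<lambda>t. real (fst t) - fluid_path y K j)
     \<le> C * (real y * real K powr chi * (real y / real K + 1 / sqrt (real j) + 1 / sqrt (real y)))"
    if jK: "1 \<le> j" "j \<le> K" and y: "y \<ge> 1" for j K y N
  proof -
    let ?p = "\<lambda>k. descend k K (y, N)"
    define x where "x = (\<lambda>k. real k powr chi * norm2 (?p k) (\<lambda>t. real (fst t) - fluid_path y K k))"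
    define Q where "Q = real y * real K powr chi"
    \<comment> \<open>per-step bias and variance of \<open>x\<close>; by the moment bounds \<open>Q\<close> is the order of magnitude of \<open>k\<^sup>\<chi> Y\<close>\<close>
    define d where "d = (\<lambda>k. C3 * Q / (real k)\<^sup>2)"
    define v where "v = (\<lambda>k. C4 * (Q\<^sup>2 / (real k)\<^sup>2 + Q * real k powr (chi - 1)))"
    have Q0: "Q > 0" using y jK by (simp add: Q_def)
    have mom1: "E (?p k) (\<lambda>t. real (fst t)) * real k powr chi \<le> M1 * Q" if "1 \<le> k" "k \<le> K" for k
    proof -
      have "E (?p k) (\<lambda>t. real (fst t)) \<le> M1 * real y * (real K / real k) powr chi"
        using M1(2)[OF that y, of N] by simp
      then have "E (?p k) (\<lambda>t. real (fst t)) * real k powr chi \<le> M1 * real y * (real K / real k) powr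
          chi * real k powr chi"
        by (intro mult_right_mono) auto
      also have "\<dots> = M1 * Q" using that by (simp add: Q_def powr_divide)
      finally show ?thesis .
    qed
    have mom2: "E (?p k) (\<lambda>t. (real (fst t))\<^sup>2) * (real k powr chi)\<^sup>2 \<le> M2 * Q\<^sup>2" if "1 \<le> k" "k \<le> K" for k
    proof -
      have "E (?p k) (\<lambda>t. (real (fst t))\<^sup>2) \<le> M2 * (real y)\<^sup>2 * (real K / real k) powr (chi * 2)"
        using M2(2)[OF that y, of N] by simp
      also have "(real K / real k) powr (chi * 2) = ((real K / real k) powr chi)\<^sup>2"
        by (simp only: power2_eq_square mult_2_right flip: powr_add)
      finally have "E (?p k) (\<lambda>t. (real (fst t))\<^sup>2) * (real k powr chi)\<^sup>2 \<le> M2 * (real y)\<^sup>2 * ((real K /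
          real k) powr chi)\<^sup>2 * (real k powr chi)\<^sup>2"
        by (intro mult_right_mono) auto
      also have "\<dots> = M2 * Q\<^sup>2" using that by (simp add: Q_def powr_divide power_mult_distrib power_divide)
      finally show ?thesis .
    qed
    have rec: "x (k - 1) \<le> sqrt ((x k + d k)\<^sup>2 + v k)" if k: "1 < k" "k \<le> K" for k
    proof -
      have k2: "k \<ge> 2" "1 \<le> k" using k by auto
      have k0: "real k > 0" using k by simp
      let ?g = "\<lambda>t. (1 + chi / real k) * \<bar>real (fst t) - fluid_path y K k\<bar> + (drift_err / (real k)\<^sup>2 *
          real (fst t) + step_const * (Q * real k powr (- chi - 2)))"
      let ?v = "\<lambda>t. (real m - 1)\<^sup>2 * ((a + 1) / a / (real k)\<^sup>2 * (real (fst t))\<^sup>2 + 1 / real k * real (fst t))"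
      let ?n = "norm2 (?p k) (\<lambda>t. real (fst t) - fluid_path y K k)"
      have fin: "finite (set_pmf (?p k))" by (rule finite_descend)
      have last: "?p (k - 1) = bind_pmf (?p k) (step k)" using descend_last[of "k - 1" K "(y, N)"] k by simp
      have "norm2 (?p (k - 1)) (\<lambda>t. real (fst t) - fluid_path y K (k - 1)) \<le> sqrt ((norm2 (?p k) ?g)\<^sup>2 + E (?p k) ?v)"
        unfolding last
      proof (rule norm2_bind_le[where c = "\<lambda>t. real (fst t)", OF fin finite_step])
        fix t assume "t \<in> set_pmf (?p k)"
        show "E (step k t) (\<lambda>u. (real (fst u) - real (fst t))\<^sup>2) \<le> ?v t"
          using E_step_fst_var[OF k2(1), of "fst t" "snd t"] by (simp add: mult_ac)
        have "\<bar>drift_map a (real m) (\<theta> * real k) (real (fst t)) - drift_map a (real m) (\<theta> * real k)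
            (fluid_path y K k)\<bar> \<le> (1 + chi / real k) * \<bar>real (fst t) - fluid_path y K k\<bar>"
        proof -
          have "a * 1 \<le> \<theta> * real k" using k0 k a_pos \<theta>_pos by (intro mult_mono) (auto simp: \<theta>_def)
          moreover have "(real m - 1) * a / (\<theta> * real k) = chi / real k" by (simp add: chi_def)
          ultimately show ?thesis using drift_map_Lipschitz[of a "real m" "\<theta> * real k" "real (fst t)"
              "fluid_path y K k"] a_pos m_ge_2 fluid_path_nonneg by simp
        qed
        moreover have "\<bar>E (step k t) (\<lambda>t. real (fst t)) - drift_map a (real m) (\<theta> * real k) (real (fst
            t))\<bar> \<le> drift_err / (real k)\<^sup>2 * real (fst t)"
          using E_step_fst_approx[OF k2(1), of "fst t" "snd t"] by simp
        moreover have "\<bar>drift_map a (real m) (\<theta> * real k) (fluid_path y K k) - fluid_path y K (k - 1)\<bar> \<le>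
            step_const * (Q * real k powr (- chi - 2))"
          using fluid_path_consistent[OF k2(1), of y K] unfolding Q_def .
        ultimately show "\<bar>E (step k t) (\<lambda>t. real (fst t)) - fluid_path y K (k - 1)\<bar> \<le> ?g t" by linarith
      qed
      then have "x (k - 1) \<le> real (k - 1) powr chi * sqrt ((norm2 (?p k) ?g)\<^sup>2 + E (?p k) ?v)"
        unfolding x_def by (intro mult_left_mono) auto
      also have "\<dots> = sqrt ((real (k - 1) powr chi * norm2 (?p k) ?g)\<^sup>2 + (real (k - 1) powr chi)\<^sup>2 * E (?p k) ?v)"
      proof -
        have "P * sqrt (G\<^sup>2 + W) = sqrt ((P * G)\<^sup>2 + P\<^sup>2 * W)" if "P \<ge> 0" for P G W :: real
        proof -
          have "sqrt ((P * G)\<^sup>2 + P\<^sup>2 * W) = sqrt (P\<^sup>2 * (G\<^sup>2 + W))" by (simp add: power_mult_distrib distrib_left)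
          then show ?thesis using that by (simp add: real_sqrt_mult)
        qed
        then show ?thesis by simp
      qed
      also have "\<dots> \<le> sqrt ((x k + d k)\<^sup>2 + v k)"
      proof -
        have tri: "norm2 (?p k) ?g \<le> (1 + chi / real k) * ?n + (drift_err / (real k)\<^sup>2 * norm2 (?p k)
            (\<lambda>t. real (fst t)) + step_const * (Q * real k powr (- chi - 2)))"
        proof -
          have "norm2 (?p k) ?g \<le> norm2 (?p k) (\<lambda>t. (1 + chi / real k) * \<bar>real (fst t) - fluid_path y K
              k\<bar>) + norm2 (?p k) (\<lambda>t. drift_err / (real k)\<^sup>2 * real (fst t) + step_const * (Q * real k
              powr (- chi - 2)))"
            by (rule norm2_triangle[OF fin])
          also have "\<dots> \<le> norm2 (?p k) (\<lambda>t. (1 + chi / real k) * \<bar>real (fst t) - fluid_path y K k\<bar>) +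
              (norm2 (?p k) (\<lambda>t. drift_err / (real k)\<^sup>2 * real (fst t)) + norm2 (?p k) (\<lambda>t. step_const *
              (Q * real k powr (- chi - 2))))"
            by (intro add_left_mono norm2_triangle[OF fin])
          also have "\<dots> = (1 + chi / real k) * ?n + (drift_err / (real k)\<^sup>2 * norm2 (?p k) (\<lambda>t. real (fst
              t)) + step_const * (Q * real k powr (- chi - 2)))"
            unfolding norm2_cmult norm2_const norm2_abs using chi_pos k0 drift_err_pos step_const_nonneg Q0 by simp
          finally show ?thesis .
        qed
        \<comment> \<open>the expansion \<open>1 + \<chi> / k\<close> of the drift is absorbed by the weight\<close>
        have shrink: "real (k - 1) powr chi * (1 + chi / real k) \<le> real k powr chi"
        proof -
          have "(1 - 1 / real k) powr chi \<le> 1 / (1 + chi / real k)" using k chi_pos by (intro powr_shrink_le) auto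
          moreover have "1 + chi / real k > 0" using chi_pos k0 by (intro add_pos_nonneg) auto
          ultimately have "(1 - 1 / real k) powr chi * (1 + chi / real k) \<le> 1"
            using pos_le_divide_eq[of "1 + chi / real k" "(1 - 1 / real k) powr chi" 1] by metis
          then have "real k powr chi * ((1 - 1 / real k) powr chi * (1 + chi / real k)) \<le> real k powr
              chi * 1" by (intro mult_left_mono) auto
          moreover have "real k powr chi * (1 - 1 / real k) powr chi = real (k - 1) powr chi"
          proof -
            have "real (k - 1) = real k * (1 - 1 / real k)" using k by (simp add: of_nat_diff right_diff_distrib)
            then show ?thesis by (simp only: powr_mult)
          qed
          ultimately show ?thesis by (simp add: mult.assoc[symmetric])
        qed
        have le: "real (k - 1) powr chi \<le> real k powr chi" using chi_pos by (intro powr_mono2) auto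
        have n2: "real k powr chi * norm2 (?p k) (\<lambda>t. real (fst t)) \<le> sqrt M2 * Q"
        proof -
          have "(real k powr chi * norm2 (?p k) (\<lambda>t. real (fst t)))\<^sup>2 = E (?p k) (\<lambda>t. (real (fst t))\<^sup>2)
              * (real k powr chi)\<^sup>2"
            by (simp add: power_mult_distrib norm2_power2 mult.commute)
          also have "\<dots> \<le> M2 * Q\<^sup>2" by (rule mom2[OF k2(2) k(2)])
          also have "\<dots> = (sqrt M2 * Q)\<^sup>2" using M2(1) by (simp add: power_mult_distrib)
          finally show ?thesis by (rule power2_le_imp_le) (use M2(1) Q0 in simp)
        qed
        have "real (k - 1) powr chi * norm2 (?p k) ?g \<le> real (k - 1) powr chi * ((1 + chi / real k) * ?n
            + (drift_err / (real k)\<^sup>2 * norm2 (?p k) (\<lambda>t. real (fst t)) + step_const * (Q * real k powr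
            (- chi - 2))))"
          using tri by (intro mult_left_mono) auto
        also have "\<dots> = real (k - 1) powr chi * (1 + chi / real k) * ?n + real (k - 1) powr chi *
            (drift_err / (real k)\<^sup>2 * norm2 (?p k) (\<lambda>t. real (fst t)) + step_const * (Q * real k powr (-
            chi - 2)))"
        proof -
          have "P * (c * n + R) = P * c * n + P * R" for P c n R :: real by (simp add: algebra_simps)
          then show ?thesis .
        qed
        also have "\<dots> \<le> real k powr chi * ?n + real k powr chi * (drift_err / (real k)\<^sup>2 * norm2 (?p k)
            (\<lambda>t. real (fst t)) + step_const * (Q * real k powr (- chi - 2)))"
          using shrink le norm2_nonneg drift_err_pos step_const_nonneg Q0
          by (intro add_mono mult_right_mono add_nonneg_nonneg mult_nonneg_nonneg) auto
        also have "real k powr chi * (drift_err / (real k)\<^sup>2 * norm2 (?p k) (\<lambda>t. real (fst t)) +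
            step_const * (Q * real k powr (- chi - 2))) =
            drift_err / (real k)\<^sup>2 * (real k powr chi * norm2 (?p k) (\<lambda>t. real (fst t))) + step_const *
                Q * (real k powr chi * real k powr (- chi - 2))"
          by (simp add: algebra_simps)
        also have "real k powr chi * real k powr (- chi - 2) = 1 / (real k)\<^sup>2"
          using k0 by (simp add: powr_minus_divide powr_numeral flip: powr_add)
        also have "drift_err / (real k)\<^sup>2 * (real k powr chi * norm2 (?p k) (\<lambda>t. real (fst t))) \<le>
            drift_err / (real k)\<^sup>2 * (sqrt M2 * Q)"
          using n2 drift_err_pos by (intro mult_left_mono) auto
        finally have drift: "real (k - 1) powr chi * norm2 (?p k) ?g \<le> x k + d k"
          unfolding x_def d_def C3_def by (simp add: algebra_simps add_divide_distrib)
        have drift0: "0 \<le> real (k - 1) powr chi * norm2 (?p k) ?g" by (intro mult_nonneg_nonneg norm2_nonneg) simp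
        have EV0: "E (?p k) ?v \<ge> 0" using a_pos by (intro E_nonneg) auto
        have EV: "E (?p k) ?v = (real m - 1)\<^sup>2 * ((a + 1) / a / (real k)\<^sup>2 * E (?p k) (\<lambda>t. (real (fst
            t))\<^sup>2) + 1 / real k * E (?p k) (\<lambda>t. real (fst t)))"
          by (simp add: E_add finite_descend)
        have "(real (k - 1) powr chi)\<^sup>2 * E (?p k) ?v \<le> (real k powr chi)\<^sup>2 * E (?p k) ?v"
          using le EV0 by (intro mult_right_mono power_mono) auto
        also have "(real k powr chi)\<^sup>2 * E (?p k) ?v = (real m - 1)\<^sup>2 * ((a + 1) / a / (real k)\<^sup>2 * (E
            (?p k) (\<lambda>t. (real (fst t))\<^sup>2) * (real k powr chi)\<^sup>2)
            + real k powr chi / real k * (E (?p k) (\<lambda>t. real (fst t)) * real k powr chi))"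
          unfolding EV by (simp add: power2_eq_square algebra_simps)
        also have "\<dots> \<le> (real m - 1)\<^sup>2 * ((a + 1) / a / (real k)\<^sup>2 * (M2 * Q\<^sup>2) + real k powr chi / real k * (M1 * Q))"
          using mom1[OF k2(2) k(2)] mom2[OF k2(2) k(2)] a_pos by (intro mult_left_mono add_mono) auto
        also have "\<dots> = (real m - 1)\<^sup>2 * (((a + 1) / a * M2) * (Q\<^sup>2 / (real k)\<^sup>2) + M1 * (Q * real k powr (chi - 1)))"
          using k0 by (simp add: powr_diff mult_ac)
        also have "\<dots> \<le> (real m - 1)\<^sup>2 * (max ((a + 1) / a * M2) M1 * (Q\<^sup>2 / (real k)\<^sup>2) + max ((a + 1) /
            a * M2) M1 * (Q * real k powr (chi - 1)))"
          using Q0 by (intro mult_left_mono add_mono mult_right_mono) auto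
        also have "\<dots> = v k" unfolding v_def C4_def by (simp add: algebra_simps)
        finally have "(real (k - 1) powr chi)\<^sup>2 * E (?p k) ?v \<le> v k" .
        then show ?thesis by (intro real_sqrt_le_mono add_mono power_mono[OF drift drift0])
      qed
      finally show ?thesis .
    qed
    have d0: "d k \<ge> 0" and v0: "v k \<ge> 0" for k unfolding d_def v_def using C3 C4 Q0 by simp_all
    have x0: "x k \<ge> 0" for k unfolding x_def by (intro mult_nonneg_nonneg norm2_nonneg) simp
    have "x j \<le> x K + (\<Sum>k\<in>{j<..K}. d k) + sqrt (\<Sum>k\<in>{j<..K}. v k)"
      by (rule sqrt_recursion_bound[where J = 1 and x = x and d = d and v = v, OF rec]) (use d0 v0 x0 jK in auto)
    moreover have "x K \<le> C5 * (Q * (real y / real K))"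
    proof -
      have "x K = real K powr chi * \<bar>real y - fluid_path y K K\<bar>" unfolding x_def by (simp add: norm2_def)
      also have "\<dots> \<le> real K powr chi * (C5 * ((real y)\<^sup>2 / real K))"
        unfolding C5_def using fluid_path_start[of K y] jK by (intro mult_left_mono) auto
      finally show ?thesis by (simp add: Q_def power2_eq_square mult_ac)
    qed
    moreover have "(\<Sum>k\<in>{j<..K}. d k) \<le> C3 * (Q * (1 / sqrt (real j)))"
    proof -
      have "(\<Sum>k\<in>{j<..K}. d k) = C3 * Q * (\<Sum>k\<in>{j<..K}. 1 / (real k)\<^sup>2)" by (simp add: d_def sum_distrib_left)
      also have "\<dots> \<le> C3 * Q * (1 / real j)"
        using sum_inverse_square_tail_le[of j K] jK C3 Q0 by (intro mult_left_mono) auto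
      also have "\<dots> \<le> C3 * Q * (1 / sqrt (real j))"
      proof -
        have "sqrt (real j) \<le> real j" using jK by (intro real_le_lsqrt) (auto simp: power2_eq_square)
        then have "1 / real j \<le> 1 / sqrt (real j)" using jK by (intro divide_left_mono) auto
        then show ?thesis using C3 Q0 by (intro mult_left_mono) auto
      qed
      finally show ?thesis by (simp add: mult.assoc)
    qed
    moreover have "sqrt (\<Sum>k\<in>{j<..K}. v k) \<le> sqrt C4 * (Q * (1 / sqrt (real j))) + sqrt (C4 * ((1 + chi)
        / chi)) * (Q * (1 / sqrt (real y)))"
    proof -
      have "(\<Sum>k\<in>{j<..K}. v k) = C4 * Q\<^sup>2 * (\<Sum>k\<in>{j<..K}. 1 / (real k)\<^sup>2) + C4 * Q * (\<Sum>k\<in>{j<..K}. real k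
          powr (chi - 1))"
        by (simp add: v_def sum.distrib sum_distrib_left algebra_simps)
      also have "\<dots> \<le> C4 * Q\<^sup>2 * (1 / real j) + C4 * Q * ((1 + chi) / chi * real K powr chi)"
        using sum_inverse_square_tail_le[of j K] sum_powr_le[OF chi_pos, of j K] jK C4 Q0 by (intro
            add_mono mult_left_mono) auto
      also have "real K powr chi = Q / real y" using y by (simp add: Q_def)
      finally have "sqrt (\<Sum>k\<in>{j<..K}. v k) \<le> sqrt (C4 * Q\<^sup>2 * (1 / real j) + C4 * Q * ((1 + chi) / chi *
          (Q / real y)))"
        by (rule real_sqrt_le_mono)
      also have "\<dots> \<le> sqrt (C4 * Q\<^sup>2 * (1 / real j)) + sqrt (C4 * Q * ((1 + chi) / chi * (Q / real y)))"
        using C4 Q0 chi_pos by (intro sqrt_add_le_add_sqrt) auto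
      also have "sqrt (C4 * Q\<^sup>2 * (1 / real j)) = sqrt C4 * (Q * (1 / sqrt (real j)))"
        using Q0 by (simp add: real_sqrt_mult real_sqrt_divide)
      also have "C4 * Q * ((1 + chi) / chi * (Q / real y)) = (C4 * ((1 + chi) / chi)) * (Q\<^sup>2 * (1 / real y))"
        by (simp add: power2_eq_square mult_ac)
      also have "sqrt \<dots> = sqrt (C4 * ((1 + chi) / chi)) * (Q * (1 / sqrt (real y)))"
        unfolding real_sqrt_mult[of "C4 * ((1 + chi) / chi)"] using Q0 by (simp add: real_sqrt_mult real_sqrt_divide)
      finally show ?thesis by simp
    qed
    ultimately have "x j \<le> C5 * (Q * (real y / real K)) + (C3 + sqrt C4) * (Q * (1 / sqrt (real j))) +
        sqrt (C4 * ((1 + chi) / chi)) * (Q * (1 / sqrt (real y)))"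
      by (simp only: distrib_right)
    also have "\<dots> \<le> C * (Q * (real y / real K)) + C * (Q * (1 / sqrt (real j))) + C * (Q * (1 / sqrt (real y)))"
    proof -
      have "0 \<le> sqrt C4" "0 \<le> sqrt (C4 * ((1 + chi) / chi))" using C4 chi_pos by simp_all
      then have "C5 \<le> C" "C3 + sqrt C4 \<le> C" "sqrt (C4 * ((1 + chi) / chi)) \<le> C"
        using C3 C5 unfolding C_def by linarith+
      then show ?thesis using Q0 by (intro add_mono mult_right_mono) auto
    qed
    also have "\<dots> = C * (Q * (real y / real K + 1 / sqrt (real j) + 1 / sqrt (real y)))" by (simp only: distrib_left)
    finally show ?thesis unfolding x_def Q_def .
  qed
  then show ?thesis using C0 by blast
qed

text \<open>
  The number of descendants among the vertices in \<open>{j<..K}\<close> predicted by the flow.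
\<close>

definition fluid_hits :: "nat \<Rightarrow> nat \<Rightarrow> nat \<Rightarrow> real" where
  "fluid_hits y K j = (\<Sum>k\<in>{j<..K}. hit_fun (a / (a + 1)) (limit_const y K * real k powr (- fluid_exp)))"

lemma hit_fun_fluid_path:
  assumes "k \<ge> 1"
  shows "hit_fun a (fluid_path y K k / (\<theta> * real k)) = hit_fun (a / (a + 1)) (limit_const y K * real k
      powr (- fluid_exp))"
  using hit_fun_profile[OF a_pos limit_const_nonneg, of fluid_exp y K "real k"] assms \<theta>_pos by (simp
      add: fluid_path_def)

lemma E_step_snd: "E (step k (y, N)) (\<lambda>t. real (snd t)) = real N + hit_prob k y"
proof -
  have "E (step k (y, N)) (\<lambda>t. real (snd t)) = E (polya_count a (weight k) y) (\<lambda>z. real N + (if z = 0 then 0 else 1))"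
    unfolding E_step by (rule E_cong) simp
  then show ?thesis by (simp add: E_add finite_polya_count hit_prob_def)
qed

lemma E_step_snd_var: "E (step k (y, N)) (\<lambda>t. (real (snd t) - real N)\<^sup>2) = hit_prob k y"
  unfolding E_step hit_prob_def by (rule E_cong) simp

text \<open>
  The same argument for the number of descendants. The hits of different vertices are centred given the past, so only the
  sum of their variances, which is at most the expected number of hits, enters under the square root.
\<close>

lemma hits_tracking:
  "\<exists>C>0. \<forall>J K y N. 1 \<le> J \<longrightarrow> J \<le> K \<longrightarrow> y \<ge> 1 \<longrightarrow>
     norm2 (descend J K (y, N)) (\<lambda>t. real (snd t) - (real N + fluid_hits y K J))
     \<le> C * (real y * real K powr chi * real J powr (- chi) * (real y / real K + 1 / sqrt (real J) + 1 / sqrt (real y))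
          + sqrt (real y * real K powr chi * real J powr (- chi)))"
proof -
  obtain M1 where M1: "M1 > 0" "\<And>j k y N. 1 \<le> j \<Longrightarrow> j \<le> k \<Longrightarrow> y \<ge> 1 \<Longrightarrow>
    E (descend j k (y, N)) (\<lambda>t. real (fst t) powr 1) \<le> M1 * real y powr 1 * (real k / real j) powr (chi * 1)"
    using moment_bound[of 1] by auto
  obtain M2 where M2: "M2 > 0" "\<And>j k y N. 1 \<le> j \<Longrightarrow> j \<le> k \<Longrightarrow> y \<ge> 1 \<Longrightarrow>
    E (descend j k (y, N)) (\<lambda>t. real (fst t) powr 2) \<le> M2 * real y powr 2 * (real k / real j) powr (chi * 2)"
    using moment_bound[of 2] by auto
  obtain T where T: "T > 0" "\<And>j K y N. 1 \<le> j \<Longrightarrow> j \<le> K \<Longrightarrow> y \<ge> 1 \<Longrightarrow>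
     real j powr chi * norm2 (descend j K (y, N)) (\<lambda>t. real (fst t) - fluid_path y K j)
     \<le> T * (real y * real K powr chi * (real y / real K + 1 / sqrt (real j) + 1 / sqrt (real y)))"
    using fluid_tracking by metis
  define D where "D = hit_err * sqrt M2 + a / \<theta> * T"
  have D0: "D > 0" unfolding D_def using hit_err_pos M2(1) a_pos \<theta>_pos T(1) by (intro add_pos_pos mult_pos_pos) auto
  define C where "C = D / chi + sqrt (M1 / chi)"
  have C0: "C > 0" unfolding C_def using D0 chi_pos M1(1) by (intro add_pos_pos) auto
  have "norm2 (descend J K (y, N)) (\<lambda>t. real (snd t) - (real N + fluid_hits y K J))
     \<le> C * (real y * real K powr chi * real J powr (- chi) * (real y / real K + 1 / sqrt (real J) + 1 / sqrt (real y))
          + sqrt (real y * real K powr chi * real J powr (- chi)))"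
    if JK: "1 \<le> J" "J \<le> K" and y: "y \<ge> 1" for J K y N
  proof -
    let ?p = "\<lambda>k. descend k K (y, N)"
    define x where "x = (\<lambda>k. norm2 (?p k) (\<lambda>t. real (snd t) - (real N + fluid_hits y K k)))"
    define Q where "Q = real y * real K powr chi"
    define R where "R = real y / real K + 1 / sqrt (real J) + 1 / sqrt (real y)"
    define d where "d = (\<lambda>k. D * Q * R * real k powr (- 1 - chi))"
    define v where "v = (\<lambda>k. M1 * Q * real k powr (- 1 - chi))"
    have Q0: "Q > 0" using y JK by (simp add: Q_def)
    have R0: "R \<ge> 0" "1 / sqrt (real J) \<le> R" unfolding R_def by simp_all
    have rec: "x (k - 1) \<le> sqrt ((x k + d k)\<^sup>2 + v k)" if k: "J < k" "k \<le> K" for k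
    proof -
      have k2: "k \<ge> 2" "1 \<le> k" using k JK by auto
      have k0: "real k > 0" using k by simp
      let ?L = "fluid_hits y K"
      let ?g = "\<lambda>t. \<bar>real (snd t) - (real N + ?L k)\<bar> + (hit_err / (real k)\<^sup>2 * real (fst t) + a / (\<theta> *
          real k) * \<bar>real (fst t) - fluid_path y K k\<bar>)"
      let ?v = "\<lambda>t. 1 / real k * real (fst t)"
      let ?n = "norm2 (?p k) (\<lambda>t. real (fst t) - fluid_path y K k)"
      have fin: "finite (set_pmf (?p k))" by (rule finite_descend)
      have last: "?p (k - 1) = bind_pmf (?p k) (step k)" using descend_last[of "k - 1" K "(y, N)"] k by simp
      have L: "?L (k - 1) = ?L k + hit_fun a (fluid_path y K k / (\<theta> * real k))"
      proof -
        have "{k - 1<..K} = insert k {k<..K}" using k by auto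
        then show ?thesis unfolding fluid_hits_def hit_fun_fluid_path[OF k2(2)] by simp
      qed
      have "x (k - 1) \<le> sqrt ((norm2 (?p k) ?g)\<^sup>2 + E (?p k) ?v)"
        unfolding x_def last
      proof (rule norm2_bind_le[where c = "\<lambda>t. real (snd t)", OF fin finite_step])
        fix t assume "t \<in> set_pmf (?p k)"
        show "E (step k t) (\<lambda>u. (real (snd u) - real (snd t))\<^sup>2) \<le> ?v t"
          using E_step_snd_var[of k "fst t" "snd t"] hit_prob_le[OF k2(1), of "fst t"] by simp
        have "\<bar>hit_fun a (real (fst t) / (\<theta> * real k)) - hit_fun a (fluid_path y K k / (\<theta> * real k))\<bar> \<le>
            a * \<bar>real (fst t) / (\<theta> * real k) - fluid_path y K k / (\<theta> * real k)\<bar>"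
          using k0 \<theta>_pos fluid_path_nonneg by (intro hit_fun_Lipschitz_abs a_pos) auto
        also have "\<dots> = a / (\<theta> * real k) * \<bar>real (fst t) - fluid_path y K k\<bar>"
          using k0 \<theta>_pos by (simp add: diff_divide_distrib[symmetric])
        finally have "\<bar>hit_fun a (real (fst t) / (\<theta> * real k)) - hit_fun a (fluid_path y K k / (\<theta> * real
            k))\<bar> \<le> a / (\<theta> * real k) * \<bar>real (fst t) - fluid_path y K k\<bar>" .
        moreover have "\<bar>hit_prob k (fst t) - hit_fun a (real (fst t) / (\<theta> * real k))\<bar> \<le> hit_err / (real
            k)\<^sup>2 * real (fst t)"
          using hit_prob_approx[OF k2(1), of "fst t"] by simp
        moreover have "E (step k t) (\<lambda>u. real (snd u)) = real (snd t) + hit_prob k (fst t)"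
          using E_step_snd[of k "fst t" "snd t"] by simp
        ultimately show "\<bar>E (step k t) (\<lambda>u. real (snd u)) - (real N + ?L (k - 1))\<bar> \<le> ?g t"
          unfolding L by linarith
      qed
      also have "\<dots> \<le> sqrt ((x k + d k)\<^sup>2 + v k)"
      proof -
        have tri: "norm2 (?p k) ?g \<le> x k + (hit_err / (real k)\<^sup>2 * norm2 (?p k) (\<lambda>t. real (fst t)) + a /
            (\<theta> * real k) * ?n)"
        proof -
          have "norm2 (?p k) ?g \<le> norm2 (?p k) (\<lambda>t. \<bar>real (snd t) - (real N + ?L k)\<bar>) + norm2 (?p k)
              (\<lambda>t. hit_err / (real k)\<^sup>2 * real (fst t) + a / (\<theta> * real k) * \<bar>real (fst t) - fluid_path y K k\<bar>)"
            by (rule norm2_triangle[OF fin])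
          also have "\<dots> \<le> norm2 (?p k) (\<lambda>t. \<bar>real (snd t) - (real N + ?L k)\<bar>) + (norm2 (?p k) (\<lambda>t.
              hit_err / (real k)\<^sup>2 * real (fst t)) + norm2 (?p k) (\<lambda>t. a / (\<theta> * real k) * \<bar>real (fst t)
              - fluid_path y K k\<bar>))"
            by (intro add_left_mono norm2_triangle[OF fin])
          also have "\<dots> = x k + (hit_err / (real k)\<^sup>2 * norm2 (?p k) (\<lambda>t. real (fst t)) + a / (\<theta> * real k) * ?n)"
            unfolding norm2_cmult norm2_abs x_def using k0 hit_err_pos a_pos \<theta>_pos by simp
          finally show ?thesis .
        qed
        have kk: "1 / real k \<le> R" "1 / sqrt (real k) \<le> 1 / sqrt (real J)"
        proof -
          have "sqrt (real k) \<le> real k" using k by (intro real_le_lsqrt) (auto simp: power2_eq_square)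
          then have "1 / real k \<le> 1 / sqrt (real k)" using k by (intro divide_left_mono) auto
          moreover show "1 / sqrt (real k) \<le> 1 / sqrt (real J)" using k JK by (intro divide_left_mono) auto
          ultimately show "1 / real k \<le> R" using R0(2) by linarith
        qed
        have n2: "norm2 (?p k) (\<lambda>t. real (fst t)) \<le> sqrt M2 * Q * real k powr (- chi)"
        proof -
          have "E (?p k) (\<lambda>t. (real (fst t))\<^sup>2) \<le> M2 * (real y)\<^sup>2 * (real K / real k) powr (chi * 2)"
            using M2(2)[OF k2(2) k(2) y, of N] by simp
          also have "(real K / real k) powr (chi * 2) = ((real K / real k) powr chi)\<^sup>2"
            by (simp only: power2_eq_square mult_2_right flip: powr_add)
          also have "(real K / real k) powr chi = real K powr chi * real k powr (- chi)"
            by (simp add: powr_divide powr_minus_divide)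
          also have "M2 * (real y)\<^sup>2 * (real K powr chi * real k powr (- chi))\<^sup>2 = (sqrt M2 * Q * real k
              powr (- chi))\<^sup>2"
            using M2(1) by (simp add: Q_def power_mult_distrib)
          finally have "(norm2 (?p k) (\<lambda>t. real (fst t)))\<^sup>2 \<le> (sqrt M2 * Q * real k powr (- chi))\<^sup>2"
              unfolding norm2_power2 .
          then show ?thesis by (rule power2_le_imp_le) (use M2(1) Q0 in simp)
        qed
        have n3: "?n \<le> T * Q * R * real k powr (- chi)"
        proof -
          have "real k powr chi * ?n \<le> T * (Q * (real y / real K + 1 / sqrt (real k) + 1 / sqrt (real y)))"
            using T(2)[OF k2(2) k(2) y, of N] unfolding Q_def .
          also have "\<dots> \<le> T * (Q * R)"
            using kk(2) T(1) Q0 unfolding R_def by (intro mult_left_mono) auto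
          finally have "real k powr (- chi) * (real k powr chi * ?n) \<le> real k powr (- chi) * (T * (Q *
              R))" by (intro mult_left_mono) auto
          moreover have "real k powr (- chi) * (real k powr chi * ?n) = ?n"
          proof -
            have "real k powr (- chi) * real k powr chi = 1" using k0 by (simp flip: powr_add)
            then show ?thesis by (simp only: mult.assoc[symmetric] mult_1)
          qed
          ultimately have "?n \<le> real k powr (- chi) * (T * (Q * R))" by (simp only:)
          then show ?thesis by (simp only: mult_ac)
        qed
        have pw: "real k powr (- 1 - chi) = 1 / real k * real k powr (- chi)" using k0 by (simp add:
            powr_diff powr_minus_divide)
        have "hit_err / (real k)\<^sup>2 * norm2 (?p k) (\<lambda>t. real (fst t)) \<le> hit_err / (real k)\<^sup>2 * (sqrt M2 *
            Q * real k powr (- chi))"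
          using n2 hit_err_pos by (intro mult_left_mono) auto
        also have "\<dots> = (hit_err * sqrt M2 * Q * real k powr (- 1 - chi)) * (1 / real k)"
          unfolding pw by (simp add: power2_eq_square)
        also have "\<dots> \<le> (hit_err * sqrt M2 * Q * real k powr (- 1 - chi)) * R"
          using kk(1) hit_err_pos M2(1) Q0 by (intro mult_left_mono) auto
        finally have 1: "hit_err / (real k)\<^sup>2 * norm2 (?p k) (\<lambda>t. real (fst t)) \<le> hit_err * sqrt M2 * (Q
            * R * real k powr (- 1 - chi))" by (simp add: mult_ac)
        have "a / (\<theta> * real k) * ?n \<le> a / (\<theta> * real k) * (T * Q * R * real k powr (- chi))"
          using n3 a_pos \<theta>_pos by (intro mult_left_mono) auto
        also have "\<dots> = a / \<theta> * T * (Q * R * real k powr (- 1 - chi))" unfolding pw by simp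
        finally have 2: "a / (\<theta> * real k) * ?n \<le> a / \<theta> * T * (Q * R * real k powr (- 1 - chi))" .
        have "d k = hit_err * sqrt M2 * (Q * R * real k powr (- 1 - chi)) + a / \<theta> * T * (Q * R * real k
            powr (- 1 - chi))"
          unfolding d_def D_def by (simp add: algebra_simps)
        then have drift: "norm2 (?p k) ?g \<le> x k + d k" using tri 1 2 by linarith
        have "E (?p k) ?v = 1 / real k * E (?p k) (\<lambda>t. real (fst t))" by simp
        also have "\<dots> \<le> 1 / real k * (M1 * real y * (real K / real k) powr chi)"
          using M1(2)[OF k2(2) k(2) y, of N] by (intro mult_left_mono) auto
        also have "\<dots> = v k" unfolding v_def pw Q_def by (simp add: powr_divide powr_minus_divide)
        finally have "E (?p k) ?v \<le> v k" .
        then show ?thesis by (intro real_sqrt_le_mono add_mono power_mono[OF drift norm2_nonneg])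
      qed
      finally show ?thesis .
    qed
    have d0: "d k \<ge> 0" and v0: "v k \<ge> 0" for k unfolding d_def v_def using D0 M1(1) Q0 R0 by simp_all
    have "x J \<le> x K + (\<Sum>k\<in>{J<..K}. d k) + sqrt (\<Sum>k\<in>{J<..K}. v k)"
      by (rule sqrt_recursion_bound[where J = J and x = x and d = d and v = v, OF rec]) (use d0 v0 JK
          norm2_nonneg in \<open>auto simp: x_def\<close>)
    moreover have "x K = 0" by (simp add: x_def norm2_def fluid_hits_def)
    moreover have tail: "(\<Sum>k\<in>{J<..K}. real k powr (- 1 - chi)) \<le> real J powr (- chi) / chi"
      by (rule sum_powr_tail_le[OF chi_pos JK(1)])
    moreover have "(\<Sum>k\<in>{J<..K}. d k) \<le> D / chi * (Q * real J powr (- chi) * R)"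
    proof -
      have "(\<Sum>k\<in>{J<..K}. d k) = D * Q * R * (\<Sum>k\<in>{J<..K}. real k powr (- 1 - chi))" by (simp add: d_def
          sum_distrib_left)
      also have "\<dots> \<le> D * Q * R * (real J powr (- chi) / chi)" using tail D0 Q0 R0 by (intro mult_left_mono) auto
      finally show ?thesis by (simp add: mult_ac)
    qed
    moreover have "sqrt (\<Sum>k\<in>{J<..K}. v k) \<le> sqrt (M1 / chi) * sqrt (Q * real J powr (- chi))"
    proof -
      have "(\<Sum>k\<in>{J<..K}. v k) = M1 * Q * (\<Sum>k\<in>{J<..K}. real k powr (- 1 - chi))" by (simp add: v_def sum_distrib_left)
      also have "\<dots> \<le> M1 * Q * (real J powr (- chi) / chi)" using tail M1(1) Q0 by (intro mult_left_mono) auto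
      also have "\<dots> = M1 / chi * (Q * real J powr (- chi))" by simp
      finally have "sqrt (\<Sum>k\<in>{J<..K}. v k) \<le> sqrt (M1 / chi * (Q * real J powr (- chi)))" by (rule real_sqrt_le_mono)
      then show ?thesis by (simp only: real_sqrt_mult)
    qed
    ultimately have "x J \<le> D / chi * (Q * real J powr (- chi) * R) + sqrt (M1 / chi) * sqrt (Q * real J
        powr (- chi))" by linarith
    also have "\<dots> \<le> C * (Q * real J powr (- chi) * R) + C * sqrt (Q * real J powr (- chi))"
    proof -
      have "0 \<le> sqrt (M1 / chi)" "0 \<le> D / chi" using M1(1) chi_pos D0 by simp_all
      then have "D / chi \<le> C" "sqrt (M1 / chi) \<le> C" unfolding C_def by linarith+
      then show ?thesis using Q0 R0 by (intro add_mono mult_right_mono) auto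
    qed
    also have "\<dots> = C * (Q * real J powr (- chi) * R + sqrt (Q * real J powr (- chi)))" by (simp only: distrib_left)
    finally show ?thesis unfolding x_def Q_def R_def .
  qed
  then show ?thesis using C0 by blast
qed

definition fluid_const :: real where
  "fluid_const = Gamma (1 - 1 / fluid_exp) * Gamma (a / (a + 1) + 1 / fluid_exp) / Gamma (a / (a + 1))"

lemma fluid_const_pos: "fluid_const > 0"
  unfolding fluid_const_def using fluid_exp_gt_1 a_pos by (intro divide_pos_pos mult_pos_pos
      Gamma_real_pos add_pos_pos) auto

lemma limit_const_pos: "y \<ge> 1 \<Longrightarrow> K \<ge> 1 \<Longrightarrow> limit_const y K > 0"
  unfolding limit_const_def using a_pos \<theta>_pos by simp

lemma fluid_hits_approx:
  assumes "1 \<le> J" "J \<le> K" "y \<ge> 1"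
  shows "\<bar>fluid_hits y K J - fluid_const * limit_const y K powr (1 / fluid_exp)\<bar> \<le> 1 + real J + (a / \<theta> /
      chi) * real y"
proof -
  let ?f = "\<lambda>k. hit_fun (a / (a + 1)) (limit_const y K * real k powr (- fluid_exp))"
  have c: "a / (a + 1) > 0" using a_pos by simp
  have r1: "fluid_exp - 1 = chi" using fluid_exp_eq by simp
  have "\<bar>(\<Sum>k\<in>{0<..K}. ?f k) - fluid_const * limit_const y K powr (1 / fluid_exp)\<bar> \<le> 1 + a / (a + 1) *
      limit_const y K / (fluid_exp - 1) * real K powr (- (fluid_exp - 1))"
    unfolding fluid_const_def using assms by (intro sum_hit_fun_riemann limit_const_pos c fluid_exp_gt_1) auto
  also have "a / (a + 1) * limit_const y K / (fluid_exp - 1) * real K powr (- (fluid_exp - 1)) = (a / \<theta>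
      / chi) * real y"
    unfolding r1 limit_const_def using assms a_pos by (simp add: powr_minus_divide)
  finally have 1: "\<bar>(\<Sum>k\<in>{0<..K}. ?f k) - fluid_const * limit_const y K powr (1 / fluid_exp)\<bar> \<le> 1 + (a /
      \<theta> / chi) * real y" .
  have f: "0 \<le> ?f k" "?f k \<le> 1" for k using hit_fun_bounds(1,2)[OF c] limit_const_nonneg by simp_all
  have "{0<..K} = {0<..J} \<union> {J<..K}" using assms by auto
  then have "(\<Sum>k\<in>{0<..K}. ?f k) = (\<Sum>k\<in>{0<..J}. ?f k) + fluid_hits y K J"
    unfolding fluid_hits_def by (simp add: sum.union_disjoint ivl_disj_int)
  moreover have "(\<Sum>k\<in>{0<..J}. ?f k) \<le> real J" using sum_mono[of "{0<..J}" ?f "\<lambda>_. 1"] f by simp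
  moreover have "0 \<le> (\<Sum>k\<in>{0<..J}. ?f k)" using f by (intro sum_nonneg) auto
  ultimately show ?thesis using 1 by linarith
qed

text \<open>
  The tracking estimates are used down to vertex \<open>J\<close>; the vertices below contribute at most \<open>J\<close>.
\<close>

lemma descendants_given_state:
  "\<exists>C>0. \<forall>J K y N. 1 \<le> J \<longrightarrow> J \<le> K \<longrightarrow> y \<ge> 1 \<longrightarrow>
     E (descend 1 K (y, N)) (\<lambda>t. \<bar>real (Suc (snd t)) - fluid_const * limit_const y K powr (1 / fluid_exp)\<bar>)
     \<le> C * (real y * real K powr chi * real J powr (- chi) * (real y / real K + 1 / sqrt (real J) + 1 / sqrt (real y))
          + sqrt (real y * real K powr chi * real J powr (- chi)) + 1 + real J + real N + real y)"
proof -
  obtain T where T: "T > 0" "\<And>J K y N. 1 \<le> J \<Longrightarrow> J \<le> K \<Longrightarrow> y \<ge> 1 \<Longrightarrow>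
     norm2 (descend J K (y, N)) (\<lambda>t. real (snd t) - (real N + fluid_hits y K J))
     \<le> T * (real y * real K powr chi * real J powr (- chi) * (real y / real K + 1 / sqrt (real J) + 1 / sqrt (real y))
          + sqrt (real y * real K powr chi * real J powr (- chi)))"
    using hits_tracking by metis
  define C where "C = T + 2 + a / \<theta> / chi"
  have h: "a / \<theta> / chi \<ge> 0" using a_pos \<theta>_pos chi_pos by simp
  have "E (descend 1 K (y, N)) (\<lambda>t. \<bar>real (Suc (snd t)) - fluid_const * limit_const y K powr (1 / fluid_exp)\<bar>)
     \<le> C * (real y * real K powr chi * real J powr (- chi) * (real y / real K + 1 / sqrt (real J) + 1 / sqrt (real y))
          + sqrt (real y * real K powr chi * real J powr (- chi)) + 1 + real J + real N + real y)"
    if JK: "1 \<le> J" "J \<le> K" and y: "y \<ge> 1" for J K y N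
  proof -
    define S where "S = real y * real K powr chi * real J powr (- chi) * (real y / real K + 1 / sqrt
        (real J) + 1 / sqrt (real y))
          + sqrt (real y * real K powr chi * real J powr (- chi))"
    have S0: "S \<ge> 0" unfolding S_def by (intro add_nonneg_nonneg mult_nonneg_nonneg) auto
    let ?G = "fluid_const * limit_const y K powr (1 / fluid_exp)"
    let ?p = "descend J K (y, N)"
    have fin: "finite (set_pmf ?p)" by (rule finite_descend)
    have "E (descend 1 K (y, N)) (\<lambda>t. \<bar>real (Suc (snd t)) - ?G\<bar>) = E ?p (\<lambda>u. E (descend 1 J u) (\<lambda>t.
        \<bar>real (Suc (snd t)) - ?G\<bar>))"
      unfolding descend_split[OF JK] by (intro E_bind finite_descend)
    also have "\<dots> \<le> E ?p (\<lambda>u. \<bar>real (snd u) - (real N + fluid_hits y K J)\<bar> + (2 + 2 * real J + real N + a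
        / \<theta> / chi * real y))"
    proof (rule E_mono[OF fin])
      fix u assume u: "u \<in> set_pmf ?p"
      have u1: "fst u \<ge> 1" using set_pmf_descend[OF u] y by simp
      have "E (descend 1 J u) (\<lambda>t. \<bar>real (Suc (snd t)) - ?G\<bar>) \<le> E (descend 1 J u) (\<lambda>t. \<bar>real (snd u) -
          (real N + fluid_hits y K J)\<bar> + (2 + 2 * real J + real N + a / \<theta> / chi * real y))"
      proof (rule E_mono[OF finite_descend])
        fix t assume "t \<in> set_pmf (descend 1 J u)"
        then have "snd u \<le> snd t" "snd t \<le> snd u + (J - 1)" using set_pmf_descend u1 by blast+
        then have "real (snd u) \<le> real (snd t)" "real (snd t) \<le> real (snd u) + real J" by linarith+
        then show "\<bar>real (Suc (snd t)) - ?G\<bar> \<le> \<bar>real (snd u) - (real N + fluid_hits y K J)\<bar> + (2 + 2 *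
            real J + real N + a / \<theta> / chi * real y)"
          using fluid_hits_approx[OF JK y] by simp
      qed
      then show "E (descend 1 J u) (\<lambda>t. \<bar>real (Suc (snd t)) - ?G\<bar>) \<le> \<bar>real (snd u) - (real N +
          fluid_hits y K J)\<bar> + (2 + 2 * real J + real N + a / \<theta> / chi * real y)"
        by simp
    qed
    also have "\<dots> = E ?p (\<lambda>u. \<bar>real (snd u) - (real N + fluid_hits y K J)\<bar>) + (2 + 2 * real J + real N +
        a / \<theta> / chi * real y)"
      by (simp add: E_add finite_descend)
    also have "E ?p (\<lambda>u. \<bar>real (snd u) - (real N + fluid_hits y K J)\<bar>) \<le> T * S"
      using E_abs_le_norm2[OF fin] T(2)[OF JK y, of N] unfolding S_def by (rule order_trans)
    also have "T * S + (2 + 2 * real J + real N + a / \<theta> / chi * real y) \<le> C * S + (C + C * real J + C *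
        real N + C * real y)"
    proof -
      have C: "T \<le> C" "2 \<le> C" "1 \<le> C" "a / \<theta> / chi \<le> C" unfolding C_def using T(1) h by linarith+
      have "T * S \<le> C * S" "2 * real J \<le> C * real J" "1 * real N \<le> C * real N" "a / \<theta> / chi * real y \<le> C * real y"
        using C S0 by (intro mult_right_mono; simp)+
      then show ?thesis using C(2) by linarith
    qed
    also have "\<dots> = C * (S + 1 + real J + real N + real y)" by (simp add: algebra_simps)
    finally show ?thesis unfolding S_def by simp
  qed
  moreover have "C > 0" unfolding C_def using T(1) h by linarith
  ultimately show ?thesis by blast
qed

section \<open>Convergence of all moments\<close>

definition switch_exp :: real where "switch_exp = (1 + nu) / 2"
definition eta :: real where "eta = nu * (1 - nu) / 4"

text \<open>
  The time at which the branching regime is left and the fluid regime is used. Its exponent lies halfway between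
  \<open>\<nu>\<close> and \<open>1\<close>.
\<close>

definition switch :: "nat \<Rightarrow> nat" where "switch n = nat \<lceil>real n powr switch_exp\<rceil>"

text \<open>
  The vertices up to the cutoff are too few to matter, so that the fluid regime is only needed above it, where its
  relative errors are small. The value of \<open>eta\<close> makes every error term at most \<open>n\<^bsup>\<nu>-eta\<^esup>\<close>.
\<close>

definition cutoff :: "nat \<Rightarrow> nat" where "cutoff n = nat \<lceil>real n powr (nu - eta)\<rceil>"

lemma exponents:
  "0 < eta" "eta < nu" "0 < switch_exp" "switch_exp < 1" "nu - eta \<le> switch_exp" "chi * eta = nu\<^sup>2 / 4"
      "chi * (1 - switch_exp) = nu / 2" "chi * (1 - nu) = nu"
proof -
  show "0 < eta" unfolding eta_def using nu_bounds by simp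
  have "nu * (1 - nu) < nu * 4" using nu_bounds by (intro mult_strict_left_mono) auto
  then show "eta < nu" by (simp add: eta_def)
  show "0 < switch_exp" "switch_exp < 1" using nu_bounds by (simp_all add: switch_exp_def)
  show "nu - eta \<le> switch_exp" using \<open>0 < eta\<close> nu_bounds by (simp add: switch_exp_def)
  show c: "chi * (1 - nu) = nu" by (rule chi_one_minus_nu)
  have "chi * eta = nu * (chi * (1 - nu)) / 4" by (simp add: eta_def)
  then show "chi * eta = nu\<^sup>2 / 4" unfolding c by (simp add: power2_eq_square)
  have "chi * (1 - switch_exp) = chi * (1 - nu) / 2" by (simp add: switch_exp_def field_simps)
  then show "chi * (1 - switch_exp) = nu / 2" unfolding c .
qed

lemma ceiling_powr_bounds:
  assumes "n \<ge> 1" "e \<ge> 0"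
  shows "real n powr e \<le> real (nat \<lceil>real n powr e\<rceil>)" "real (nat \<lceil>real n powr e\<rceil>) \<le> 2 * real n powr e" "1
      \<le> nat \<lceil>real n powr e\<rceil>"
proof -
  have "real n powr e \<ge> 1" using assms by (intro ge_one_powr_ge_zero) auto
  then show "real n powr e \<le> real (nat \<lceil>real n powr e\<rceil>)" "real (nat \<lceil>real n powr e\<rceil>) \<le> 2 * real n powr
      e" "1 \<le> nat \<lceil>real n powr e\<rceil>"
    by linarith+
qed

lemma switch_bounds:
  assumes "n \<ge> 1"
  shows "real n powr switch_exp \<le> real (switch n)" "real (switch n) \<le> 2 * real n powr switch_exp" "1 \<le> switch n"
  unfolding switch_def using ceiling_powr_bounds[OF assms, of switch_exp] exponents by auto

lemma cutoff_bounds: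
  assumes "n \<ge> 1"
  shows "real n powr (nu - eta) \<le> real (cutoff n)" "real (cutoff n) \<le> 2 * real n powr (nu - eta)" "1 \<le> cutoff n"
  unfolding cutoff_def using ceiling_powr_bounds[OF assms, of "nu - eta"] exponents by auto

lemma cutoff_le_switch: "n \<ge> 1 \<Longrightarrow> cutoff n \<le> switch n"
  unfolding cutoff_def switch_def using exponents by (intro nat_mono ceiling_mono powr_mono) auto

lemma switch_ratio:
  assumes "n \<ge> 1"
  shows "real n / real (switch n) \<le> real n powr (1 - switch_exp)" "real n powr (1 - switch_exp) \<le> 2 *
      (real n / real (switch n))"
proof -
  have n: "real n > 0" "real n powr switch_exp > 0" "real (switch n) > 0" using assms
      switch_bounds(3)[OF assms] by auto
  have e: "real n powr (1 - switch_exp) = real n / real n powr switch_exp" using n by (simp add: powr_diff)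
  show "real n / real (switch n) \<le> real n powr (1 - switch_exp)"
    unfolding e using switch_bounds(1)[OF assms] n by (intro divide_left_mono) auto
  have "real n / real n powr switch_exp = 2 * real n / (2 * real n powr switch_exp)" by simp
  also have "\<dots> \<le> 2 * real n / real (switch n)" using switch_bounds(2)[OF assms] n by (intro divide_left_mono) auto
  finally show "real n powr (1 - switch_exp) \<le> 2 * (real n / real (switch n))" unfolding e by simp
qed

lemma switch_div_tendsto: "(\<lambda>n. real (switch n) / real n) \<longlonglongrightarrow> 0"
proof (rule tendsto_sandwich[OF _ _ tendsto_const])
  show "\<forall>\<^sub>F n in sequentially. 0 \<le> real (switch n) / real n" by simp
  show "\<forall>\<^sub>F n in sequentially. real (switch n) / real n \<le> 2 * real n powr (switch_exp - 1)"
    using eventually_ge_at_top[of 1]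
  proof eventually_elim
    case (elim n)
    have "real (switch n) / real n \<le> 2 * real n powr switch_exp / real n"
      using switch_bounds(2)[OF elim] by (intro divide_right_mono) auto
    then show ?case using elim by (simp add: powr_diff)
  qed
  have "(\<lambda>n. 2 * real n powr (switch_exp - 1)) \<longlonglongrightarrow> 2 * 0"
    using exponents by (intro tendsto_mult tendsto_const tendsto_neg_powr filterlim_real_sequentially) auto
  then show "(\<lambda>n. 2 * real n powr (switch_exp - 1)) \<longlonglongrightarrow> 0" by simp
qed

lemma switch_eventually: "\<forall>\<^sub>F n in sequentially. switch n \<le> n - 1"
proof -
  have "\<forall>\<^sub>F n in sequentially. real (switch n) / real n < 1/2"
    using order_tendstoD(2)[OF switch_div_tendsto, of "1/2"] by simp
  then show ?thesis using eventually_ge_at_top[of 2]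
  proof eventually_elim
    case (elim n)
    then have "2 * real (switch n) < real n" by (simp add: field_simps)
    then show ?case using elim(2) by linarith
  qed
qed

lemma switch_at_top: "filterlim switch at_top sequentially"
proof -
  have "filterlim (\<lambda>n. real n powr switch_exp) at_top sequentially"
    using exponents by real_asymp
  then have "filterlim (\<lambda>n. real (switch n)) at_top sequentially"
  proof (rule filterlim_at_top_mono)
    show "\<forall>\<^sub>F n in sequentially. real n powr switch_exp \<le> real (switch n)"
      using eventually_ge_at_top[of 1] by eventually_elim (rule switch_bounds(1))
  qed
  then show ?thesis by (simp add: filterlim_sequentially_iff_filterlim_real)
qed

lemma switch_after_branching: "(\<lambda>n. real n powr (2 * chi) * real (switch n) powr (- (1 + 2 * chi))) \<longlonglongrightarrow> 0"
proof (rule tendsto_sandwich[OF _ _ tendsto_const])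
  show "\<forall>\<^sub>F n in sequentially. 0 \<le> real n powr (2 * chi) * real (switch n) powr (- (1 + 2 * chi))" by simp
  show "\<forall>\<^sub>F n in sequentially. real n powr (2 * chi) * real (switch n) powr (- (1 + 2 * chi)) \<le> real n
      powr (nu - switch_exp)"
    using eventually_ge_at_top[of 1]
  proof eventually_elim
    case (elim n)
    have "real (switch n) powr (- (1 + 2 * chi)) \<le> (real n powr switch_exp) powr (- (1 + 2 * chi))"
      using switch_bounds(1)[OF elim] elim chi_pos by (intro powr_mono2') auto
    then have "real n powr (2 * chi) * real (switch n) powr (- (1 + 2 * chi)) \<le> real n powr (2 * chi) *
        (real n powr switch_exp) powr (- (1 + 2 * chi))"
      by (intro mult_left_mono) auto
    also have "\<dots> = real n powr (2 * (chi * (1 - switch_exp)) - switch_exp)"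
      by (simp add: powr_powr algebra_simps flip: powr_add)
    also have "2 * (chi * (1 - switch_exp)) - switch_exp = nu - switch_exp" unfolding exponents by simp
    finally show ?case .
  qed
  show "(\<lambda>n. real n powr (nu - switch_exp)) \<longlonglongrightarrow> 0"
    using nu_bounds by (intro tendsto_neg_powr filterlim_real_sequentially) (simp add: switch_exp_def)
qed

text \<open>
  The states of the chain at the time \<open>switch n\<close> and at the end.
\<close>

definition joint :: "nat \<Rightarrow> ((nat \<times> nat) \<times> (nat \<times> nat)) pmf" where
  "joint n = bind_pmf (descend (switch n) (n - 1) (m, 1)) (\<lambda>u. map_pmf (Pair u) (descend 1 (switch n) u))"

lemma finite_joint: "finite (set_pmf (joint n))"
  by (simp add: joint_def finite_descend)

lemma joint_snd:
  assumes "n \<ge> 1" "switch n \<le> n - 1"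
  shows "map_pmf snd (joint n) = descend 1 (n - 1) (m, 1)"
  unfolding descend_split[OF switch_bounds(3)[OF assms(1)] assms(2)] joint_def
  by (simp add: map_bind_pmf pmf.map_comp o_def)

lemma joint_fst: "map_pmf fst (joint n) = descend (switch n) (n - 1) (m, 1)"
  unfolding joint_def by (simp add: map_bind_pmf pmf.map_comp o_def map_pmf_const bind_return_pmf')

lemma E_joint: "E (joint n) f = E (descend (switch n) (n - 1) (m, 1)) (\<lambda>u. E (descend 1 (switch n) u) (\<lambda>t. f (u, t)))"
  unfolding joint_def by (subst E_bind) (simp_all add: finite_descend)

lemma E_joint_fst: "E (joint n) (\<lambda>x. f (fst x)) = E (descend (switch n) (n - 1) (m, 1)) f"
  using integral_map_pmf[of fst "joint n" f] joint_fst by simp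

lemma E_joint_snd:
  assumes "n \<ge> 1" "switch n \<le> n - 1"
  shows "E (joint n) (\<lambda>x. f (snd x)) = E (descend 1 (n - 1) (m, 1)) f"
  using integral_map_pmf[of snd "joint n" f] joint_snd[OF assms] by simp

lemma moment_bound_switch:
  assumes "s > 0"
  shows "\<exists>C>0. \<forall>n\<ge>1. switch n \<le> n - 1 \<longrightarrow> E (descend (switch n) (n - 1) (m, 1)) (\<lambda>u. real (fst u) powr s)
      \<le> C * (real n / real (switch n)) powr (chi * s)"
proof -
  obtain M where M: "M > 0" "\<And>j k y N. 1 \<le> j \<Longrightarrow> j \<le> k \<Longrightarrow> y \<ge> 1 \<Longrightarrow>
    E (descend j k (y, N)) (\<lambda>t. real (fst t) powr s) \<le> M * real y powr s * (real k / real j) powr (chi * s)"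
    using moment_bound[OF assms] by metis
  have "E (descend (switch n) (n - 1) (m, 1)) (\<lambda>u. real (fst u) powr s) \<le> (M * real m powr s) * (real n
      / real (switch n)) powr (chi * s)"
    if n: "n \<ge> 1" "switch n \<le> n - 1" for n
  proof -
    have "E (descend (switch n) (n - 1) (m, 1)) (\<lambda>u. real (fst u) powr s) \<le> M * real m powr s * (real (n
        - 1) / real (switch n)) powr (chi * s)"
      using M(2)[OF switch_bounds(3)[OF n(1)] n(2)] m_ge_2 by simp
    also have "\<dots> \<le> M * real m powr s * (real n / real (switch n)) powr (chi * s)"
      using M(1) chi_pos assms by (intro mult_left_mono powr_mono2 divide_right_mono) auto
    finally show ?thesis .
  qed
  moreover have "M * real m powr s > 0" using M(1) m_ge_2 by simp
  ultimately show ?thesis by blast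
qed

text \<open>
  The bound of \<open>descendants_given_state\<close> is integrated with the help of the moment bounds at time \<open>switch n\<close>.
\<close>

lemma descendants_L1:
  "\<exists>C>0. \<forall>\<^sub>F n in sequentially. E (joint n) (\<lambda>x. \<bar>real (Suc (snd (snd x))) - fluid_const * limit_const
      (fst (fst x)) (switch n) powr (1 / fluid_exp)\<bar>)
      \<le> C * real n powr (nu - eta)"
proof -
  obtain C where C: "C > 0" "\<And>J K y N. 1 \<le> J \<Longrightarrow> J \<le> K \<Longrightarrow> y \<ge> 1 \<Longrightarrow>
     E (descend 1 K (y, N)) (\<lambda>t. \<bar>real (Suc (snd t)) - fluid_const * limit_const y K powr (1 / fluid_exp)\<bar>)
     \<le> C * (real y * real K powr chi * real J powr (- chi) * (real y / real K + 1 / sqrt (real J) + 1 / sqrt (real y))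
          + sqrt (real y * real K powr chi * real J powr (- chi)) + 1 + real J + real N + real y)"
    using descendants_given_state by metis
  obtain A1 where A1: "A1 > 0" "\<And>n. n \<ge> 1 \<Longrightarrow> switch n \<le> n - 1 \<Longrightarrow> E (descend (switch n) (n - 1) (m, 1))
      (\<lambda>u. real (fst u) powr 1) \<le> A1 * (real n / real (switch n)) powr (chi * 1)"
    using moment_bound_switch[of 1] by auto
  obtain A2 where A2: "A2 > 0" "\<And>n. n \<ge> 1 \<Longrightarrow> switch n \<le> n - 1 \<Longrightarrow> E (descend (switch n) (n - 1) (m, 1))
      (\<lambda>u. real (fst u) powr 2) \<le> A2 * (real n / real (switch n)) powr (chi * 2)"
    using moment_bound_switch[of 2] by auto
  obtain A3 where A3: "A3 > 0" "\<And>n. n \<ge> 1 \<Longrightarrow> switch n \<le> n - 1 \<Longrightarrow> E (descend (switch n) (n - 1) (m, 1))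
      (\<lambda>u. real (fst u) powr (1/2)) \<le> A3 * (real n / real (switch n)) powr (chi * (1/2))"
    using moment_bound_switch[of "1/2"] by auto
  obtain B where B: "B > 0" "\<And>j k. 1 \<le> j \<Longrightarrow> j \<le> k \<Longrightarrow> E (descend j k (m, 1)) (\<lambda>t. real (snd t) ^ 1) \<le> B *
      (real k / real j) powr (chi * real 1)"
    using hits_moment_bound[of 1] by auto
  define D where "D = C * (A2 + A1 + A3 * 2 powr (chi / 2) + A3 + 1 + 2 + B + A1)"
  have D: "D > 0" unfolding D_def using C(1) A1(1) A2(1) A3(1) B(1) by (intro mult_pos_pos add_pos_pos) auto
  have "E (joint n) (\<lambda>x. \<bar>real (Suc (snd (snd x))) - fluid_const * limit_const (fst (fst x)) (switch n)
      powr (1 / fluid_exp)\<bar>) \<le> D * real n powr (nu - eta)"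
    if n: "n \<ge> 1" "switch n \<le> n - 1" for n
  proof -
    let ?p = "descend (switch n) (n - 1) (m, 1)"
    define J where "J = real (cutoff n)"
    define K where "K = real (switch n)"
    define w where "w = real n / K"
    define Z where "Z = real n powr (nu - eta)"
    have J: "1 \<le> J" "J > 0" "real n powr (nu - eta) \<le> J" "J \<le> 2 * Z" unfolding J_def Z_def using
        cutoff_bounds[OF n(1)] by auto
    have K: "1 \<le> K" "K > 0" "real n powr switch_exp \<le> K" unfolding K_def using switch_bounds[OF n(1)] by auto
    have n0: "real n > 0" "real n \<ge> 1" using n by auto
    have w0: "w > 0" unfolding w_def using K n0 by simp
    have w: "w \<le> real n powr (1 - switch_exp)" "real n powr (1 - switch_exp) \<le> 2 * w" unfolding w_def
        K_def using switch_ratio[OF n(1)] by auto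
    have fin: "finite (set_pmf ?p)" by (rule finite_descend)
    have Ey: "E ?p (\<lambda>u. real (fst u)) \<le> A1 * w powr chi" using A1(2)[OF n] by (simp add: w_def K_def)
    have Ey2: "E ?p (\<lambda>u. (real (fst u))\<^sup>2) \<le> A2 * (w powr chi)\<^sup>2"
    proof -
      have "w powr (chi * 2) = (w powr chi)\<^sup>2" by (simp only: power2_eq_square mult_2_right powr_add)
      then show ?thesis using A2(2)[OF n] by (simp add: w_def K_def)
    qed
    have Es: "E ?p (\<lambda>u. sqrt (real (fst u))) \<le> A3 * w powr (chi / 2)" using A3(2)[OF n] by (simp add:
        w_def K_def powr_half_sqrt)
    have EN: "E ?p (\<lambda>u. real (snd u)) \<le> B * w powr chi"
    proof -
      have "E ?p (\<lambda>u. real (snd u)) \<le> B * (real (n - 1) / K) powr chi" using B(2)[OF switch_bounds(3)[OF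
          n(1)] n(2)] by (simp add: K_def)
      also have "\<dots> \<le> B * w powr chi" unfolding w_def using B(1) K chi_pos by (intro mult_left_mono
          powr_mono2 divide_right_mono) auto
      finally show ?thesis .
    qed
    define P where "P = K powr chi * J powr (- chi)"
    have P0: "P > 0" unfolding P_def using K J by simp
    have "E (joint n) (\<lambda>x. \<bar>real (Suc (snd (snd x))) - fluid_const * limit_const (fst (fst x)) (switch
        n) powr (1 / fluid_exp)\<bar>) \<le>
      E ?p (\<lambda>u. C * (P / K * (real (fst u))\<^sup>2 + P / sqrt J * real (fst u) + P * sqrt (real (fst u)) +
          sqrt P * sqrt (real (fst u)) + 1 + J + real (snd u) + real (fst u)))"
      unfolding E_joint fst_conv snd_conv
    proof (rule E_mono[OF fin])
      fix u assume u: "u \<in> set_pmf ?p"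
      then have y: "fst u \<ge> 1" using set_pmf_descend[OF u] m_ge_2 by simp
      have "E (descend 1 (switch n) u) (\<lambda>t. \<bar>real (Suc (snd t)) - fluid_const * limit_const (fst u)
          (switch n) powr (1 / fluid_exp)\<bar>) \<le>
        C * (real (fst u) * K powr chi * J powr (- chi) * (real (fst u) / K + 1 / sqrt J + 1 / sqrt (real (fst u)))
          + sqrt (real (fst u) * K powr chi * J powr (- chi)) + 1 + J + real (snd u) + real (fst u))"
        using C(2)[OF cutoff_bounds(3)[OF n(1)] cutoff_le_switch[OF n(1)] y, of "snd u"] by (simp add: K_def J_def)
      also have "real (fst u) * K powr chi * J powr (- chi) * (real (fst u) / K + 1 / sqrt J + 1 / sqrt
          (real (fst u))) =
          P / K * (real (fst u))\<^sup>2 + P / sqrt J * real (fst u) + P * sqrt (real (fst u))"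
      proof -
        have "y * (1 / sqrt y) = sqrt y" if "y > 0" for y :: real using that by (simp add: real_div_sqrt)
        then have "real (fst u) * (1 / sqrt (real (fst u))) = sqrt (real (fst u))" using y by simp
        moreover have "y * K powr chi * J powr (- chi) * (y / K + 1 / sqrt J + 1 / sqrt y) = P / K * y\<^sup>2
            + P / sqrt J * y + P * (y * (1 / sqrt y))" for y
          unfolding P_def by (simp add: distrib_left power2_eq_square mult_ac)
        ultimately show ?thesis by (simp only:)
      qed
      also have "sqrt (real (fst u) * K powr chi * J powr (- chi)) = sqrt P * sqrt (real (fst u))"
        unfolding P_def by (simp add: real_sqrt_mult mult_ac)
      finally show "E (descend 1 (switch n) u) (\<lambda>t. \<bar>real (Suc (snd t)) - fluid_const * limit_const (fst
          u) (switch n) powr (1 / fluid_exp)\<bar>) \<le>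
        C * (P / K * (real (fst u))\<^sup>2 + P / sqrt J * real (fst u) + P * sqrt (real (fst u)) + sqrt P *
            sqrt (real (fst u)) + 1 + J + real (snd u) + real (fst u))" .
    qed
    also have "\<dots> = C * (P / K * E ?p (\<lambda>u. (real (fst u))\<^sup>2) + P / sqrt J * E ?p (\<lambda>u. real (fst u)) + P *
        E ?p (\<lambda>u. sqrt (real (fst u))) + sqrt P * E ?p (\<lambda>u. sqrt (real (fst u))) + 1 + J + E ?p (\<lambda>u.
        real (snd u)) + E ?p (\<lambda>u. real (fst u)))"
    proof -
      have "E ?p (\<lambda>u. C * (k1 * f1 u + k2 * f2 u + k3 * f3 u + k4 * f3 u + k5 + k6 + f4 u + f2 u)) =
        C * (k1 * E ?p f1 + k2 * E ?p f2 + k3 * E ?p f3 + k4 * E ?p f3 + k5 + k6 + E ?p f4 + E ?p f2)"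
            for k1 k2 k3 k4 k5 k6 f1 f2 f3 f4
        by (simp add: E_add finite_descend)
      then show ?thesis .
    qed
    also have "\<dots> \<le> C * (A2 * Z + A1 * Z + (A3 * 2 powr (chi / 2)) * Z + A3 * Z + 1 * Z + 2 * Z + B * Z + A1 * Z)"
    proof -
      \<comment> \<open>\<open>w\<^sup>\<chi>\<close> is the order of magnitude of \<open>Y\<close> at the time \<open>switch n\<close>; the two bounds below reduce each
          error term to a comparison of exponents of \<open>n\<close>\<close>
      have Pw: "P * w powr chi \<le> real n powr (nu + nu\<^sup>2 / 4)"
      proof -
        have "P * w powr chi = real n powr chi * J powr (- chi)" unfolding P_def w_def using K n0 by
            (simp add: powr_divide)
        also have "\<dots> \<le> real n powr chi * (real n powr (nu - eta)) powr (- chi)"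
          using J n0 chi_pos by (intro mult_left_mono powr_mono2') auto
        also have "\<dots> = real n powr (chi * (1 - nu) + chi * eta)" using n0 by (simp add: powr_powr
            algebra_simps flip: powr_add)
        finally show ?thesis unfolding exponents .
      qed
      have wchi: "w powr chi \<le> real n powr (nu / 2)"
      proof -
        have "w powr chi \<le> (real n powr (1 - switch_exp)) powr chi" using w w0 chi_pos by (intro powr_mono2) auto
        also have "\<dots> = real n powr (chi * (1 - switch_exp))" by (simp add: powr_powr mult.commute)
        finally show ?thesis unfolding exponents .
      qed
      have mono: "real n powr e \<le> Z" if "e \<le> nu - eta" for e unfolding Z_def using that n0 by (intro powr_mono) auto
      have t1: "P / K * E ?p (\<lambda>u. (real (fst u))\<^sup>2) \<le> A2 * Z"
      proof -
        have "P / K * E ?p (\<lambda>u. (real (fst u))\<^sup>2) \<le> P / K * (A2 * (w powr chi)\<^sup>2)" using Ey2 P0 K by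
            (intro mult_left_mono) auto
        also have "\<dots> = A2 * ((P * w powr chi) * w powr chi * (1 / K))" by (simp add: power2_eq_square)
        also have "\<dots> \<le> A2 * (real n powr (nu + nu\<^sup>2 / 4) * real n powr (nu / 2) * (1 / real n powr switch_exp))"
          using Pw wchi K n0 A2(1) P0 by (intro mult_left_mono mult_mono divide_left_mono) auto
        also have "real n powr (nu + nu\<^sup>2 / 4) * real n powr (nu / 2) * (1 / real n powr switch_exp) =
            real n powr (nu + nu\<^sup>2 / 4 + nu / 2 - switch_exp)"
          by (simp only: powr_add powr_diff times_divide_eq_right mult_1_right)
        also have "\<dots> \<le> Z"
        proof (rule mono)
          have "nu\<^sup>2 / 4 + nu / 2 - switch_exp + eta \<le> 0" using nu_bounds by (simp add: switch_exp_def
              eta_def power2_eq_square field_simps)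
          then show "nu + nu\<^sup>2 / 4 + nu / 2 - switch_exp \<le> nu - eta" by linarith
        qed
        finally show ?thesis using A2(1) by simp
      qed
      have t2: "P / sqrt J * E ?p (\<lambda>u. real (fst u)) \<le> A1 * Z"
      proof -
        have "P / sqrt J * E ?p (\<lambda>u. real (fst u)) \<le> P / sqrt J * (A1 * w powr chi)" using Ey P0 J by
            (intro mult_left_mono) auto
        also have "\<dots> = A1 * ((P * w powr chi) * (1 / sqrt J))" by simp
        also have "\<dots> \<le> A1 * (real n powr (nu + nu\<^sup>2 / 4) * (1 / sqrt (real n powr (nu - eta))))"
          using Pw J n0 A1(1) P0 by (intro mult_left_mono mult_mono divide_left_mono) auto
        also have "sqrt (real n powr (nu - eta)) = real n powr ((nu - eta) / 2)" by (simp add: powr_powr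
            flip: powr_half_sqrt)
        also have "real n powr (nu + nu\<^sup>2 / 4) * (1 / real n powr ((nu - eta) / 2)) = real n powr (nu +
            nu\<^sup>2 / 4 - (nu - eta) / 2)"
          by (simp only: powr_diff times_divide_eq_right mult_1_right)
        also have "\<dots> \<le> Z"
        proof (rule mono)
          have "eta = nu / 4 - nu\<^sup>2 / 4" by (simp add: eta_def power2_eq_square field_simps)
          moreover have "0 \<le> nu\<^sup>2" by simp
          ultimately show "nu + nu\<^sup>2 / 4 - (nu - eta) / 2 \<le> nu - eta" using nu_bounds by argo
        qed
        finally show ?thesis using A1(1) by simp
      qed
      have t3: "P * E ?p (\<lambda>u. sqrt (real (fst u))) \<le> (A3 * 2 powr (chi / 2)) * Z"
      proof -
        have "P * E ?p (\<lambda>u. sqrt (real (fst u))) \<le> P * (A3 * w powr (chi / 2))" using Es P0 by (intro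
            mult_left_mono) auto
        also have "w powr (chi / 2) = w powr chi * w powr (- (chi / 2))" using w0 by (simp flip: powr_add)
        also have "P * (A3 * (w powr chi * w powr (- (chi / 2)))) = A3 * ((P * w powr chi) * w powr (-
            (chi / 2)))" by simp
        also have "\<dots> \<le> A3 * (real n powr (nu + nu\<^sup>2 / 4) * (2 powr (chi / 2) * real n powr (- (nu / 4))))"
        proof (intro mult_left_mono mult_mono)
          have "w powr (- (chi / 2)) \<le> (real n powr (1 - switch_exp) / 2) powr (- (chi / 2))"
            using w w0 n0 chi_pos by (intro powr_mono2') auto
          also have "\<dots> = 2 powr (chi / 2) * real n powr (- (chi * (1 - switch_exp) / 2))"
            using n0 by (simp add: powr_divide powr_powr powr_minus_divide mult.commute)
          finally show "w powr (- (chi / 2)) \<le> 2 powr (chi / 2) * real n powr (- (nu / 4))" unfolding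
              exponents by simp
        qed (use Pw A3(1) P0 in auto)
        also have "\<dots> = A3 * 2 powr (chi / 2) * (real n powr (nu + nu\<^sup>2 / 4) * real n powr (- (nu / 4)))" by simp
        also have "real n powr (nu + nu\<^sup>2 / 4) * real n powr (- (nu / 4)) = real n powr (nu + nu\<^sup>2 / 4 +
            - (nu / 4))" by (simp only: powr_add)
        also have "\<dots> \<le> Z" by (rule mono) (simp add: eta_def power2_eq_square field_simps)
        finally show ?thesis using A3(1) by simp
      qed
      have t4: "sqrt P * E ?p (\<lambda>u. sqrt (real (fst u))) \<le> A3 * Z"
      proof -
        have "sqrt P * E ?p (\<lambda>u. sqrt (real (fst u))) \<le> sqrt P * (A3 * w powr (chi / 2))" using Es P0 by
            (intro mult_left_mono) auto
        also have "w powr (chi / 2) = sqrt (w powr chi)" by (simp add: powr_powr flip: powr_half_sqrt)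
        also have "sqrt P * (A3 * sqrt (w powr chi)) = A3 * sqrt (P * w powr chi)" by (simp add: real_sqrt_mult)
        also have "\<dots> \<le> A3 * sqrt (real n powr (nu + nu\<^sup>2 / 4))" using Pw A3(1) by (intro mult_left_mono
            real_sqrt_le_mono) auto
        also have "sqrt (real n powr (nu + nu\<^sup>2 / 4)) = real n powr ((nu + nu\<^sup>2 / 4) / 2)" by (simp add:
            powr_powr flip: powr_half_sqrt)
        also have "\<dots> \<le> Z"
        proof (rule mono)
          have "eta = nu / 4 - nu\<^sup>2 / 4" by (simp add: eta_def power2_eq_square field_simps)
          moreover have "0 \<le> nu\<^sup>2" by simp
          ultimately show "(nu + nu\<^sup>2 / 4) / 2 \<le> nu - eta" using nu_bounds by argo
        qed
        finally show ?thesis using A3(1) by simp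
      qed
      have t5: "1 \<le> 1 * Z" using mono[of 0] exponents n0 by simp
      have "w powr chi \<le> Z"
      proof -
        have "nu / 2 \<le> nu - eta"
        proof -
          have "nu * (1 - nu) \<le> nu * 1" using nu_bounds by (intro mult_left_mono) auto
          then show ?thesis unfolding eta_def using nu_bounds by linarith
        qed
        then show ?thesis using wchi mono[of "nu / 2"] by linarith
      qed
      then have t6: "E ?p (\<lambda>u. real (snd u)) \<le> B * Z" "E ?p (\<lambda>u. real (fst u)) \<le> A1 * Z"
        using EN Ey A1(1) B(1) by (auto intro: order_trans mult_left_mono)
      show ?thesis using t1 t2 t3 t4 t5 t6 J(4) C(1) by (intro mult_left_mono) linarith+
    qed
    also have "\<dots> = D * Z" unfolding D_def by (simp add: algebra_simps)
    finally show ?thesis unfolding Z_def .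
  qed
  note bound = this
  have "\<forall>\<^sub>F n in sequentially. E (joint n) (\<lambda>x. \<bar>real (Suc (snd (snd x))) - fluid_const * limit_const
      (fst (fst x)) (switch n) powr (1 / fluid_exp)\<bar>) \<le> D * real n powr (nu - eta)"
    using switch_eventually eventually_ge_at_top[of 1] by eventually_elim (rule bound)
  then show ?thesis using D by blast
qed

end

text \<open>
  This turns convergence in mean together with bounded moments of order \<open>2 p\<close> into convergence of the moments of order
  \<open>p\<close>: on a compact interval the power function is uniformly continuous, and large values are absorbed by the
  moments of order \<open>2 p\<close>.
\<close>

lemma powr_diff_le_linear:
  fixes p \<epsilon> :: real
  assumes p: "p > 0" and \<epsilon>: "\<epsilon> > 0"
  shows "\<exists>C\<ge>0. \<forall>x\<ge>0. \<forall>y\<ge>0. \<bar>x powr p - y powr p\<bar> \<le> \<epsilon> * (1 + x powr (2 * p) + y powr (2 * p)) + C * \<bar>x - y\<bar>"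
proof -
  \<comment> \<open>beyond \<open>M\<close> the power \<open>z\<^sup>p\<close> is at most \<open>\<epsilon> z\<^bsup>2p\<^esup>\<close>\<close>
  define M where "M = (1 / \<epsilon>) powr (1 / p)"
  have M0: "M > 0" unfolding M_def using \<epsilon> by simp
  have Mp: "M powr p = 1 / \<epsilon>" unfolding M_def using \<epsilon> p by (simp add: powr_powr)
  have "continuous_on {0..M} (\<lambda>x. x powr p)"
    using p by (intro continuous_on_powr' continuous_intros) auto
  then have "uniformly_continuous_on {0..M} (\<lambda>x. x powr p)"
    by (rule compact_uniformly_continuous) simp
  then obtain d where d: "d > 0" "\<And>x y. x \<in> {0..M} \<Longrightarrow> y \<in> {0..M} \<Longrightarrow> \<bar>y - x\<bar> < d \<Longrightarrow> \<bar>y powr p - x powr p\<bar> < \<epsilon>"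
    using \<epsilon> unfolding uniformly_continuous_on_def dist_real_def by metis
  define C where "C = M powr p / d"
  have C0: "C \<ge> 0" unfolding C_def using d by simp
  have big: "z powr p \<le> \<epsilon> * z powr (2 * p)" if "z > M" for z
  proof -
    have "M powr p \<le> z powr p" using that M0 p by (intro powr_mono2) auto
    then have "1 \<le> \<epsilon> * z powr p" unfolding Mp using \<epsilon> by (simp add: field_simps)
    then have "1 * z powr p \<le> \<epsilon> * z powr p * z powr p" by (intro mult_right_mono) auto
    also have "\<dots> = \<epsilon> * z powr (2 * p)" by (simp only: mult.assoc powr_add[symmetric] mult_2)
    finally show ?thesis by simp
  qed
  have "\<bar>x powr p - y powr p\<bar> \<le> \<epsilon> * (1 + x powr (2 * p) + y powr (2 * p)) + C * \<bar>x - y\<bar>"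
    if xy: "x \<ge> 0" "y \<ge> 0" for x y
  proof -
    have n: "0 \<le> \<epsilon> * x powr (2 * p)" "0 \<le> \<epsilon> * y powr (2 * p)" "0 \<le> C * \<bar>x - y\<bar>" using \<epsilon> C0 by auto
    have e: "\<epsilon> * (1 + x powr (2 * p) + y powr (2 * p)) = \<epsilon> + \<epsilon> * x powr (2 * p) + \<epsilon> * y powr (2 * p)" by
        (simp add: algebra_simps)
    consider "x \<le> M \<and> y \<le> M \<and> \<bar>x - y\<bar> < d" | "x \<le> M \<and> y \<le> M \<and> \<bar>x - y\<bar> \<ge> d" | "max x y > M" by linarith
    then show ?thesis
    proof cases
      case 1
      then have "\<bar>x powr p - y powr p\<bar> < \<epsilon>" using d(2)[of y x] xy by auto
      then show ?thesis unfolding e using n by linarith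
    next
      case 2
      have "x powr p \<le> M powr p" "y powr p \<le> M powr p" using 2 xy p by (auto intro: powr_mono2)
      then have "\<bar>x powr p - y powr p\<bar> \<le> M powr p" using powr_ge_zero[of x p] powr_ge_zero[of y p] by linarith
      also have "M powr p = C * d" unfolding C_def using d by simp
      also have "\<dots> \<le> C * \<bar>x - y\<bar>" using 2 C0 by (intro mult_left_mono) auto
      finally show ?thesis unfolding e using n \<epsilon> by linarith
    next
      case 3
      have "\<bar>x powr p - y powr p\<bar> \<le> (max x y) powr p"
      proof -
        have "x powr p \<le> (max x y) powr p" "y powr p \<le> (max x y) powr p" using xy p by (auto intro: powr_mono2)
        then show ?thesis using powr_ge_zero[of x p] powr_ge_zero[of y p] by linarith
      qed
      also have "\<dots> \<le> \<epsilon> * (max x y) powr (2 * p)" using 3 by (rule big)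
      also have "\<dots> \<le> \<epsilon> * x powr (2 * p) + \<epsilon> * y powr (2 * p)" using n by (cases "x \<le> y") (simp_all add: max_def)
      finally show ?thesis unfolding e using n \<epsilon> by linarith
    qed
  qed
  then show ?thesis using C0 by blast
qed

context pa_model begin

definition approx_const :: real where
  "approx_const = fluid_const * ((a + 1) / \<theta>) powr (1 / fluid_exp)"

lemma approx_const_pos: "approx_const > 0"
  unfolding approx_const_def using fluid_const_pos a_pos \<theta>_pos by simp

lemma normalised_limit_const:
  assumes "n \<ge> 1"
  shows "fluid_const * limit_const y (switch n) powr (1 / fluid_exp) / real n powr nu = approx_const *
      (real y * (real (switch n) / real n) powr chi) powr (1 / fluid_exp)"
proof -
  have "limit_const y (switch n) powr (1 / fluid_exp) = ((a + 1) / \<theta>) powr (1 / fluid_exp) * real y powr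
      (1 / fluid_exp) * (real (switch n) powr chi) powr (1 / fluid_exp)"
    unfolding limit_const_def using a_pos \<theta>_pos by (simp only: powr_mult)
  moreover have "real n powr nu = (real n powr chi) powr (1 / fluid_exp)" by (simp add: powr_powr nu_def)
  ultimately show ?thesis
    unfolding approx_const_def powr_mult by (simp add: powr_divide)
qed

text \<open>
  The normalised number of descendants and its prediction are close in mean and have bounded moments, so their moments
  have the same limits; those of the prediction are given by \<open>branching_limit\<close> with \<open>s = p (1 - \<nu>)\<close>.
\<close>

lemma num_descendants_moment_limit:
  assumes p: "p > 0"
  shows "(\<lambda>n. E (descend 1 (n - 1) (m, 1)) (\<lambda>t. real (Suc (snd t)) powr p) / real n powr (p * nu))
     \<longlonglongrightarrow> approx_const powr p * ((real m - 1) powr (p / fluid_exp) * yule (p / fluid_exp) m)"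
proof -
  define U where "U = (\<lambda>n (x :: (nat \<times> nat) \<times> (nat \<times> nat)). real (Suc (snd (snd x))) / real n powr nu)"
  define V where "V = (\<lambda>n (x :: (nat \<times> nat) \<times> (nat \<times> nat)). approx_const * (real (fst (fst x)) * (real
      (switch n) / real n) powr chi) powr (1 / fluid_exp))"
  have rr0: "fluid_exp > 0" using fluid_exp_gt_1 by simp
  have UV0: "U n x \<ge> 0" "V n x \<ge> 0" for n x unfolding U_def V_def using approx_const_pos by simp_all
  have Vp: "E (joint n) (\<lambda>x. V n x powr s) = approx_const powr s * (E (descend (switch n) (n - 1) (m,
      1)) (\<lambda>u. real (fst u) powr (s / fluid_exp)) * (real (switch n) / real n) powr (chi * (s / fluid_exp)))"
    if "s > 0" for s n
  proof -
    have "V n x powr s = approx_const powr s * (real (switch n) / real n) powr (chi * (s / fluid_exp)) *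
        real (fst (fst x)) powr (s / fluid_exp)" for x
      unfolding V_def using approx_const_pos by (simp add: powr_mult powr_powr mult_ac)
    then show ?thesis using E_joint_fst[of n "\<lambda>u. approx_const powr s * (real (switch n) / real n) powr
        (chi * (s / fluid_exp)) * real (fst u) powr (s / fluid_exp)"]
      by (simp add: mult_ac)
  qed
  have ev: "\<forall>\<^sub>F n in sequentially. n \<ge> 3 \<and> switch n \<le> n - 1"
    using eventually_ge_at_top[of 3] switch_eventually by eventually_elim simp
  obtain BV where BV: "BV > 0" "\<And>n. n \<ge> 3 \<Longrightarrow> switch n \<le> n - 1 \<Longrightarrow> E (joint n) (\<lambda>x. V n x powr (2 * p)) \<le> BV"
  proof -
    have s: "2 * p / fluid_exp > 0" using p rr0 by simp
    obtain A where A: "A > 0" "\<And>n. n \<ge> 1 \<Longrightarrow> switch n \<le> n - 1 \<Longrightarrow> E (descend (switch n) (n - 1) (m, 1)) (\<lambda>u.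
        real (fst u) powr (2 * p / fluid_exp)) \<le> A * (real n / real (switch n)) powr (chi * (2 * p /
        fluid_exp))"
      using moment_bound_switch[OF s] by blast
    have "E (joint n) (\<lambda>x. V n x powr (2 * p)) \<le> approx_const powr (2 * p) * A" if n: "n \<ge> 3" "switch n \<le> n - 1" for n
    proof -
      let ?e = "chi * (2 * p / fluid_exp)"
      have n1: "n \<ge> 1" using n by simp
      have "E (descend (switch n) (n - 1) (m, 1)) (\<lambda>u. real (fst u) powr (2 * p / fluid_exp)) * (real
          (switch n) / real n) powr ?e \<le> A * (real n / real (switch n)) powr ?e * (real (switch n) /
          real n) powr ?e"
        using A(2)[OF n1 n(2)] by (intro mult_right_mono) auto
      also have "\<dots> = A * ((real n / real (switch n)) powr ?e * (real (switch n) / real n) powr ?e)" by simp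
      also have "(real n / real (switch n)) powr ?e * (real (switch n) / real n) powr ?e = 1"
        using n1 switch_bounds(3)[OF n1] by (subst powr_mult[symmetric]) auto
      finally have "E (descend (switch n) (n - 1) (m, 1)) (\<lambda>u. real (fst u) powr (2 * p / fluid_exp)) *
          (real (switch n) / real n) powr ?e \<le> A" by simp
      then show ?thesis using Vp[of "2 * p" n] p by (simp add: mult_left_mono)
    qed
    moreover have "approx_const powr (2 * p) * A > 0" using A(1) approx_const_pos by simp
    ultimately show ?thesis using that by blast
  qed
  obtain BU where BU: "BU > 0" "\<And>n. n \<ge> 3 \<Longrightarrow> switch n \<le> n - 1 \<Longrightarrow> E (joint n) (\<lambda>x. U n x powr (2 * p)) \<le> BU"
  proof -
    define q where "q = nat \<lceil>2 * p\<rceil>"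
    have q: "q \<ge> 1" "2 * p \<le> real q" unfolding q_def using p by linarith+
    obtain B where B: "B > 0" "\<And>n. n \<ge> 3 \<Longrightarrow> E (descend 1 (n - 1) (m, 1)) (\<lambda>t. real (Suc (snd t)) ^ q) \<le> B
        * real n powr (nu * real q)"
      using descendants_moment_bound[OF q(1)] by blast
    have "E (joint n) (\<lambda>x. U n x powr (2 * p)) \<le> 1 + B" if n: "n \<ge> 3" "switch n \<le> n - 1" for n
    proof -
      have pow: "z powr (2 * p) \<le> 1 + z ^ q" if "z \<ge> 0" for z :: real
      proof (cases "z \<le> 1")
        case True
        then have "z powr (2 * p) \<le> 1 powr (2 * p)" using that p by (intro powr_mono2) auto
        then show ?thesis using that by (simp add: add_increasing2)
      next
        case False
        then have "z powr (2 * p) \<le> z powr real q" using q by (intro powr_mono) auto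
        then show ?thesis using False by (simp add: powr_realpow)
      qed
      have "E (joint n) (\<lambda>x. U n x powr (2 * p)) \<le> E (joint n) (\<lambda>x. 1 + U n x ^ q)"
        using pow UV0 by (intro E_mono finite_joint) auto
      also have "\<dots> = 1 + E (joint n) (\<lambda>x. U n x ^ q)" by (simp add: E_add finite_joint)
      also have "E (joint n) (\<lambda>x. U n x ^ q) = E (descend 1 (n - 1) (m, 1)) (\<lambda>t. real (Suc (snd t)) ^ q)
          / real n powr (nu * real q)"
      proof -
        have "(real n powr nu) ^ q = real n powr (nu * real q)" using n by (simp add: powr_powr flip: powr_realpow)
        then have "U n x ^ q = real (Suc (snd (snd x))) ^ q / real n powr (nu * real q)" for x
          unfolding U_def by (simp only: power_divide)
        then show ?thesis using E_joint_snd[of n "\<lambda>t. real (Suc (snd t)) ^ q / real n powr (nu * real q)"] n by simp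
      qed
      also have "\<dots> \<le> B" using B(2)[OF n(1)] n by (simp add: divide_le_eq)
      finally show ?thesis by simp
    qed
    then show ?thesis using that[of "1 + B"] B(1) by simp
  qed
  obtain CL where CL: "CL > 0" "\<forall>\<^sub>F n in sequentially. E (joint n) (\<lambda>x. \<bar>real (Suc (snd (snd x))) -
      fluid_const * limit_const (fst (fst x)) (switch n) powr (1 / fluid_exp)\<bar>) \<le> CL * real n powr (nu - eta)"
    using descendants_L1 by blast
  have L1: "\<forall>\<^sub>F n in sequentially. E (joint n) (\<lambda>x. \<bar>U n x - V n x\<bar>) \<le> CL * real n powr (- eta)"
    using CL(2) eventually_ge_at_top[of 1]
  proof eventually_elim
    case (elim n)
    have "\<bar>U n x - V n x\<bar> = \<bar>real (Suc (snd (snd x))) - fluid_const * limit_const (fst (fst x)) (switch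
        n) powr (1 / fluid_exp)\<bar> / real n powr nu" for x
      unfolding U_def V_def normalised_limit_const[OF elim(2), symmetric] by (simp add:
          diff_divide_distrib[symmetric])
    then have "E (joint n) (\<lambda>x. \<bar>U n x - V n x\<bar>) = E (joint n) (\<lambda>x. \<bar>real (Suc (snd (snd x))) -
        fluid_const * limit_const (fst (fst x)) (switch n) powr (1 / fluid_exp)\<bar>) / real n powr nu"
      by simp
    also have "\<dots> \<le> CL * real n powr (nu - eta) / real n powr nu" using elim by (intro divide_right_mono) auto
    also have "\<dots> = CL * real n powr (- eta)" using elim by (simp add: powr_diff powr_minus_divide)
    finally show ?case .
  qed
  have "(\<lambda>n. E (joint n) (\<lambda>x. U n x powr p) - E (joint n) (\<lambda>x. V n x powr p)) \<longlonglongrightarrow> 0"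
  proof (rule LIMSEQ_I)
    fix e :: real assume e: "e > 0"
    define \<epsilon> where "\<epsilon> = e / (2 * (1 + BU + BV))"
    have s0: "1 + BU + BV > 0" using BU(1) BV(1) by simp
    have \<epsilon>: "\<epsilon> > 0" unfolding \<epsilon>_def using e s0 by simp
    obtain C where C: "C \<ge> 0" "\<And>x y. x \<ge> 0 \<Longrightarrow> y \<ge> 0 \<Longrightarrow> \<bar>x powr p - y powr p\<bar> \<le> \<epsilon> * (1 + x powr (2 * p) + y
        powr (2 * p)) + C * \<bar>x - y\<bar>"
      using powr_diff_le_linear[OF p \<epsilon>] by blast
    have "(\<lambda>n. C * (CL * real n powr (- eta))) \<longlonglongrightarrow> C * (CL * 0)"
      using exponents by (intro tendsto_mult tendsto_const tendsto_neg_powr filterlim_real_sequentially) auto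
    then have "\<forall>\<^sub>F n in sequentially. C * (CL * real n powr (- eta)) < e / 2"
      using e by (intro order_tendstoD(2)) auto
    with L1 ev have "\<forall>\<^sub>F n in sequentially. norm (E (joint n) (\<lambda>x. U n x powr p) - E (joint n) (\<lambda>x. V n
        x powr p) - 0) < e"
    proof eventually_elim
      case (elim n)
      have fin: "finite (set_pmf (joint n))" by (rule finite_joint)
      have "E (joint n) (\<lambda>x. U n x powr p) - E (joint n) (\<lambda>x. V n x powr p) = E (joint n) (\<lambda>x. U n x
          powr p - V n x powr p)" by (simp add: E_diff fin)
      also have "\<bar>\<dots>\<bar> \<le> E (joint n) (\<lambda>x. \<bar>U n x powr p - V n x powr p\<bar>)" by (rule E_abs_le[OF fin])
      also have "\<dots> \<le> E (joint n) (\<lambda>x. \<epsilon> * (1 + U n x powr (2 * p) + V n x powr (2 * p)) + C * \<bar>U n x - V n x\<bar>)"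
        by (intro E_mono fin C(2) UV0)
      also have "\<dots> = \<epsilon> * (1 + E (joint n) (\<lambda>x. U n x powr (2 * p)) + E (joint n) (\<lambda>x. V n x powr (2 *
          p))) + C * E (joint n) (\<lambda>x. \<bar>U n x - V n x\<bar>)"
        by (simp add: E_add fin)
      also have "\<dots> \<le> \<epsilon> * (1 + BU + BV) + C * (CL * real n powr (- eta))"
        using BU(2)[of n] BV(2)[of n] elim \<epsilon> C(1) by (intro add_mono mult_left_mono) auto
      also have "\<epsilon> * (1 + BU + BV) = e / 2"
      proof -
        have "e / (2 * X) * X = e / 2" if "X > 0" for X using that by simp
        then show ?thesis unfolding \<epsilon>_def using s0 .
      qed
      finally show ?case using elim by simp
    qed
    then show "\<exists>no. \<forall>n\<ge>no. norm (E (joint n) (\<lambda>x. U n x powr p) - E (joint n) (\<lambda>x. V n x powr p) - 0) < e"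
      by (simp add: eventually_sequentially)
  qed
  moreover have "(\<lambda>n. E (joint n) (\<lambda>x. V n x powr p)) \<longlonglongrightarrow> approx_const powr p * ((real m - 1) powr (p /
      fluid_exp) * yule (p / fluid_exp) m)"
    unfolding Vp[OF p] using p rr0
    by (intro tendsto_mult tendsto_const branching_limit switch_at_top switch_eventually
        switch_after_branching switch_div_tendsto) simp
  ultimately have "(\<lambda>n. (E (joint n) (\<lambda>x. U n x powr p) - E (joint n) (\<lambda>x. V n x powr p)) + E (joint n)
      (\<lambda>x. V n x powr p)) \<longlonglongrightarrow> 0 + approx_const powr p * ((real m - 1) powr (p / fluid_exp) * yule (p /
      fluid_exp) m)"
    by (rule tendsto_add)
  then have "(\<lambda>n. E (joint n) (\<lambda>x. U n x powr p)) \<longlonglongrightarrow> approx_const powr p * ((real m - 1) powr (p /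
      fluid_exp) * yule (p / fluid_exp) m)" by simp
  moreover have "\<forall>\<^sub>F n in sequentially. E (joint n) (\<lambda>x. U n x powr p) = E (descend 1 (n - 1) (m, 1))
      (\<lambda>t. real (Suc (snd t)) powr p) / real n powr (p * nu)"
    using ev
  proof eventually_elim
    case (elim n)
    have "U n x powr p = real (Suc (snd (snd x))) powr p / real n powr (p * nu)" for x
      unfolding U_def by (simp add: powr_divide powr_powr mult.commute)
    then show ?case using E_joint_snd[of n "\<lambda>t. real (Suc (snd t)) powr p / real n powr (p * nu)"] elim by simp
  qed
  ultimately show ?thesis by (simp add: filterlim_cong)
qed

lemma pa_graph_moment_limit:
  assumes p: "p > 0"
  shows "(\<lambda>n. E (pa_graph m \<rho> n) (\<lambda>G. real (num_descendants G n) powr p) / real n powr (p * nu))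
     \<longlonglongrightarrow> (fluid_const * ((a + 1) * (real m - 1) / \<theta>) powr (1 - nu)) powr p
        * (Gamma (p * (1 - nu) + real m / (real m - 1)) / Gamma (real m / (real m - 1)))"
proof -
  have "\<forall>\<^sub>F n in sequentially. E (descend 1 (n - 1) (m, 1)) (\<lambda>t. real (Suc (snd t)) powr p) / real n powr (p * nu) =
     E (pa_graph m \<rho> n) (\<lambda>G. real (num_descendants G n) powr p) / real n powr (p * nu)"
    using eventually_ge_at_top[of 3]
  proof eventually_elim
    case (elim n)
    have "E (pa_graph m \<rho> n) (\<lambda>G. real (num_descendants G n) powr p) = E (map_pmf (\<lambda>G. num_descendants G
        n) (pa_graph m \<rho> n)) (\<lambda>x. real x powr p)"
      by simp
    also have "\<dots> = E (descend 1 (n - 1) (m, 1)) (\<lambda>t. real (Suc (snd t)) powr p)"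
      unfolding num_descendants_law[OF elim] by simp
    finally show ?case by simp
  qed
  note ev_eq = this
  have lim_eq: "approx_const powr p * ((real m - 1) powr (p / fluid_exp) * yule (p / fluid_exp) m) =
     (fluid_const * ((a + 1) * (real m - 1) / \<theta>) powr (1 - nu)) powr p * (Gamma (p * (1 - nu) + real m /
         (real m - 1)) / Gamma (real m / (real m - 1)))"
  proof -
    have "((a + 1) * (real m - 1) / \<theta>) powr (1 - nu) = ((a + 1) / \<theta>) powr (1 / fluid_exp) * (real m - 1)
        powr (1 / fluid_exp)"
      unfolding one_minus_nu using a_pos \<theta>_pos m1_pos by (simp add: powr_mult powr_divide)
    moreover have "((real m - 1) powr (1 / fluid_exp)) powr p = (real m - 1) powr (p / fluid_exp)" by
        (simp add: powr_powr)
    moreover have "p / fluid_exp = p * (1 - nu)" unfolding one_minus_nu by simp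
    ultimately show ?thesis
      using fluid_const_pos a_pos \<theta>_pos m1_pos
      by (simp add: approx_const_def powr_mult yule_def gamma_ratio_def add.commute mult_ac)
  qed
  show ?thesis
    using Lim_transform_eventually[OF num_descendants_moment_limit[OF p] ev_eq] unfolding lim_eq .
qed

end

lemma Gamma_moment:
  fixes \<alpha> s c :: real
  assumes "prob_space M" "distributed M lborel \<xi> (\<lambda>x. ennreal (gamma_density \<alpha> 1 x))" "\<alpha> > 0" "s > 0"
    and g: "g \<in> borel_measurable borel" "\<And>x. x > 0 \<Longrightarrow> g x = c * x powr s" and "c \<ge> 0"
  shows "prob_space.expectation M (\<lambda>\<omega>. g (\<xi> \<omega>)) = c * (Gamma (s + \<alpha>) / Gamma \<alpha>)"
proof -
  have dens: "gamma_density \<alpha> 1 x \<ge> 0" for x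
    using assms(3) by (simp add: gamma_density_def)
  have "prob_space.expectation M (\<lambda>\<omega>. g (\<xi> \<omega>)) = (\<integral>x. gamma_density \<alpha> 1 x * g x \<partial>lborel)"
    using g(1) dens by (intro distributed_integral[symmetric, OF assms(2)]) auto
  also have "(\<lambda>x. gamma_density \<alpha> 1 x * g x) = (\<lambda>x. c / Gamma \<alpha> * (indicator {0..} x * x powr (s + \<alpha> - 1) / exp x))"
  proof
    fix x
    have "x powr (\<alpha> - 1) * x powr s = x powr (s + \<alpha> - 1)" by (simp flip: powr_add add: algebra_simps)
    then show "gamma_density \<alpha> 1 x * g x = c / Gamma \<alpha> * (indicator {0..} x * x powr (s + \<alpha> - 1) / exp x)"
      using g(2)[of x] by (cases "x > 0"; cases "x = 0") (auto simp: gamma_density_def exp_minus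
          field_simps indicator_def)
  qed
  also have "(\<integral>x. c / Gamma \<alpha> * (indicator {0..} x * x powr (s + \<alpha> - 1) / exp x) \<partial>lborel) = c / Gamma \<alpha>
      * (\<integral>x. indicator {0..} x * x powr (s + \<alpha> - 1) / exp x \<partial>lborel)"
    by (rule integral_mult_right_zero)
  also have "(\<integral>x. indicator {0..} x * x powr (s + \<alpha> - 1) / exp x \<partial>lborel) = Gamma (s + \<alpha>)"
  proof -
    have "(\<integral>x. indicator {0..} x * x powr (s + \<alpha> - 1) / exp x \<partial>lborel) = enn2real (\<integral>\<^sup>+x. ennreal
        (indicator {0..} x * x powr (s + \<alpha> - 1) / exp x) \<partial>lborel)"
      by (rule integral_eq_nn_integral) auto
    also have "(\<integral>\<^sup>+x. ennreal (indicator {0..} x * x powr (s + \<alpha> - 1) / exp x) \<partial>lborel) = ennreal (Gamma (s + \<alpha>))"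
      by (rule Gamma_conv_nn_integral_real[symmetric]) (use assms(3,4) in simp)
    finally show ?thesis using assms(3,4) Gamma_real_pos[of "s + \<alpha>"] by (simp only: enn2real_ennreal
        less_imp_le add_pos_pos)
  qed
  finally show ?thesis by simp
qed

theorem theorem1p3:
  fixes m :: nat and \<rho> \<nu> C \<beta> :: real
  assumes "m \<ge> 2" and "\<rho> > - real m"
    and "\<nu> = (real m - 1) * (real m + \<rho>) / (real m * (real m + \<rho> + 1))"
    and "C = Gamma ((real m - 1) * (real m + \<rho>) / (real m * (real m + \<rho> + 1))) *
             Gamma ((real m + \<rho>) / (real m * (real m + \<rho> + 1)) + 1) /
             Gamma ((real m + \<rho>) / (real m + \<rho> + 1))"
    and "\<beta> = (real m + \<rho> + 1) * (real m - 1) / (2 * real m + \<rho>)"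
  shows "0 < \<nu> \<and> \<nu> < 1 \<and>
    (\<forall>p::real. p > 0 \<longrightarrow>
      (\<lambda>n. measure_pmf.expectation (pa_graph m \<rho> n) (\<lambda>G. real (num_descendants G n) powr p)
             / real n powr (p * \<nu>))
      \<longlonglongrightarrow> (C * \<beta> powr (1 - \<nu>)) powr p *
          (Gamma (p * (1 - \<nu>) + real m / (real m - 1)) / Gamma (real m / (real m - 1)))) \<and>
    (\<forall>(M :: 'a measure) (\<xi> :: 'a \<Rightarrow> real).
      prob_space M \<and>
      distributed M lborel \<xi> (\<lambda>x. ennreal (gamma_density (real m / (real m - 1)) 1 x)) \<longrightarrow>
      (\<forall>p::real. p > 0 \<longrightarrow>
        (\<lambda>n. measure_pmf.expectation (pa_graph m \<rho> n)
               (\<lambda>G. (real n powr (- \<nu>) * real (num_descendants G n)) powr p))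
        \<longlonglongrightarrow> prob_space.expectation M (\<lambda>\<omega>. (C * (\<beta> * \<xi> \<omega>) powr (1 - \<nu>)) powr p)))"
proof -
  interpret pa_model m \<rho> by unfold_locales (use assms in auto)
  have m0: "real m > 0" using m_ge_2 by simp
  have \<theta>_eq: "2 * real m + \<rho> = \<theta>" by (simp add: \<theta>_def a_def)
  have a1: "a + 1 \<noteq> 0" "a + 1 > 0" using a_pos by auto
  have nu_eq: "\<nu> = nu"
    using \<theta>_pos unfolding assms(3) a_def[symmetric] nu_def chi_def fluid_exp_def by simp
  have fluid_exp_inv: "1 / fluid_exp = \<theta> / (real m * (a + 1))" by (simp add: fluid_exp_def)
  have C_eq: "C = fluid_const"
  proof -
    have "1 - 1 / fluid_exp = (real m - 1) * a / (real m * (a + 1))"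
      using nu_eq one_minus_nu assms(3) by (simp add: a_def)
    moreover have "a / (a + 1) + 1 / fluid_exp = a / (real m * (a + 1)) + 1"
    proof -
      have "a / (a + 1) = real m * a / (real m * (a + 1))" using m0 by simp
      moreover have "real m * a + \<theta> = a + real m * (a + 1)" by (simp add: \<theta>_def algebra_simps)
      ultimately have "a / (a + 1) + 1 / fluid_exp = (a + real m * (a + 1)) / (real m * (a + 1))"
        unfolding fluid_exp_inv by (simp only: add_divide_distrib[symmetric])
      then show ?thesis using m0 a1 by (simp add: add_divide_distrib)
    qed
    ultimately show ?thesis unfolding assms(4) fluid_const_def a_def[symmetric] by (simp only:)
  qed
  have \<beta>_eq: "\<beta> = (a + 1) * (real m - 1) / \<theta>" unfolding assms(5) \<theta>_eq a_def ..
  have \<beta>_pos: "\<beta> > 0" unfolding \<beta>_eq using a_pos m1_pos \<theta>_pos by simp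
  have lim: "(\<lambda>n. E (pa_graph m \<rho> n) (\<lambda>G. real (num_descendants G n) powr p) / real n powr (p * \<nu>))
      \<longlonglongrightarrow> (C * \<beta> powr (1 - \<nu>)) powr p *
          (Gamma (p * (1 - \<nu>) + real m / (real m - 1)) / Gamma (real m / (real m - 1)))" if "p > 0" for p
    unfolding nu_eq C_eq \<beta>_eq by (rule pa_graph_moment_limit[OF that])
  have gam: "(\<lambda>n. E (pa_graph m \<rho> n) (\<lambda>G. (real n powr (- \<nu>) * real (num_descendants G n)) powr p))
      \<longlonglongrightarrow> prob_space.expectation M (\<lambda>\<omega>. (C * (\<beta> * \<xi> \<omega>) powr (1 - \<nu>)) powr p)"
    if M: "prob_space M" "distributed M lborel \<xi> (\<lambda>x. ennreal (gamma_density (real m / (real m - 1)) 1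
        x))" and p: "p > 0"
    for M :: "'a measure" and \<xi> p
  proof -
    have "prob_space.expectation M (\<lambda>\<omega>. (C * (\<beta> * \<xi> \<omega>) powr (1 - \<nu>)) powr p) =
       (C * \<beta> powr (1 - \<nu>)) powr p * (Gamma (p * (1 - \<nu>) + real m / (real m - 1)) / Gamma (real m / (real m - 1)))"
    proof (rule Gamma_moment[OF M, where g = "\<lambda>x. (C * (\<beta> * x) powr (1 - \<nu>)) powr p"])
      show "p * (1 - \<nu>) > 0" unfolding nu_eq using p nu_bounds by simp
      show "real m / (real m - 1) > 0" using m0 m1_pos by simp
      fix x :: real assume "x > 0"
      then show "(C * (\<beta> * x) powr (1 - \<nu>)) powr p = (C * \<beta> powr (1 - \<nu>)) powr p * x powr (p * (1 - \<nu>))"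
        using \<beta>_pos fluid_const_pos unfolding C_eq by (simp add: powr_mult powr_powr mult_ac)
    qed auto
    moreover have "E (pa_graph m \<rho> n) (\<lambda>G. (real n powr (- \<nu>) * real (num_descendants G n)) powr p) =
       E (pa_graph m \<rho> n) (\<lambda>G. real (num_descendants G n) powr p) / real n powr (p * \<nu>)" for n
    proof -
      have "(real n powr (- \<nu>) * real x) powr p = real x powr p / real n powr (p * \<nu>)" for x
        by (simp add: powr_mult powr_powr powr_minus_divide powr_divide mult.commute)
      then show ?thesis by simp
    qed
    ultimately show ?thesis using lim[OF p] by simp
  qed
  show ?thesis using nu_bounds lim gam unfolding nu_eq[symmetric] by blast
qed

end
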